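(* Let $n,k$ be positive integers. If $H_{n,k}$ is non-empty, then $HE_{n,\delta}\cap H_{n,\delta}$ is a non-empty open subset of $\mathbb{P}_{n,\delta}$ (in the Euclidean topology) for any $\delta\geq (n+2)k$ with $\delta$ being a multiple of $k$.
   Context: We work over $\mathbb{C}$. A complex analytic space is called Brody hyperbolic if there are no non-constant holomorphic maps from $\mathbb{C}$ to it. A relatively compact open complex subspace $Y\subset X$ is hyperbolically embedded in $X$ if for any two distinct points $p,q\in\overline{Y}$ there are neighborhoods $U_p,U_q$ of $p,q$ in $X$ such that $d_Y(U_p\cap Y,U_q\cap Y)>0$, where $d_Y$ is the Kobayashi pseudodistance. $\mathbb{P}_{n,\delta}$ is the projective space of dimension $\binom{n+\delta}{n}-1$ whose points parametrize hypersurfaces of degree $\delta$ in $\mathbb{P}^n$. $H_{n,\delta}\subset\mathbb{P}_{n,\delta}$ is the subset corresponding to Brody hyperbolic hypersurfaces. $HE_{n,\delta}\subset\mathbb{P}_{n,\delta}$ is the subset of hypersurfaces of degree $\delta$ in $\mathbb{P}^n$ whose complement is hyperbolically embedded in $\mathbb{P}^n$. *)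

theory Defs
  imports "HOL-Analysis.Analysis" "HOL-Complex_Analysis.Complex_Analysis"
begin

section \<open>Complex projective spaces\<close>

text \<open>
  For a finite index set \<open>I\<close>, the vector space \<open>\<complex>\<^sup>I\<close> is realised as the set of functions vanishing
  outside \<open>I\<close>; the product topology on functions restricts to its Euclidean topology.
  A point of its projectivisation is an orbit of nonzero vectors under scaling, that is,
  a line through the origin with the origin removed.
  The same construction, with different \<open>I\<close>, serves for \<open>\<bbbP>\<^sup>n\<close> (where \<open>I = {..n}\<close>) and for the
  parameter space of hypersurfaces (where \<open>I\<close> is a set of monomials).
\<close>

definition nonzero_vecs :: "'i set \<Rightarrow> ('i \<Rightarrow> complex) set" where
  "nonzero_vecs I = {v. (\<forall>i. i \<notin> I \<longrightarrow> v i = 0) \<and> (\<exists>i. v i \<noteq> 0)}"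

definition proj_point :: "('i \<Rightarrow> complex) \<Rightarrow> ('i \<Rightarrow> complex) set" where
  "proj_point v = {(\<lambda>i. c * v i) | c. c \<noteq> 0}"

definition proj_space :: "'i set \<Rightarrow> ('i \<Rightarrow> complex) set set" where
  "proj_space I = proj_point ` nonzero_vecs I"

text \<open>The quotient topology; see \<open>quotient_map_proj_point\<close> below.\<close>

definition proj_topology :: "'i set \<Rightarrow> ('i \<Rightarrow> complex) set topology" where
  "proj_topology I = topology (\<lambda>U. U \<subseteq> proj_space I \<and>
     openin (top_of_set (nonzero_vecs I)) {v \<in> nonzero_vecs I. proj_point v \<in> U})"

lemma openin_proj_topology:
  "openin (proj_topology I) U \<longleftrightarrow> U \<subseteq> proj_space I \<and>
     openin (top_of_set (nonzero_vecs I)) {v \<in> nonzero_vecs I. proj_point v \<in> U}"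
proof -
  let ?pre = "\<lambda>U. {v \<in> nonzero_vecs I. proj_point v \<in> U}"
  have "istopology (\<lambda>U. U \<subseteq> proj_space I \<and> openin (top_of_set (nonzero_vecs I)) (?pre U))"
    unfolding istopology_def
  proof (intro conjI allI impI)
    fix S T
    assume *: "S \<subseteq> proj_space I \<and> openin (top_of_set (nonzero_vecs I)) (?pre S)"
      "T \<subseteq> proj_space I \<and> openin (top_of_set (nonzero_vecs I)) (?pre T)"
    then show "S \<inter> T \<subseteq> proj_space I" by blast
    have "?pre (S \<inter> T) = ?pre S \<inter> ?pre T" by blast
    then show "openin (top_of_set (nonzero_vecs I)) (?pre (S \<inter> T))"
      using * by (simp add: openin_Int)
  next
    fix \<K>
    assume *: "\<forall>K\<in>\<K>. K \<subseteq> proj_space I \<and> openin (top_of_set (nonzero_vecs I)) (?pre K)"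
    then show "\<Union>\<K> \<subseteq> proj_space I" by blast
    have "?pre (\<Union>\<K>) = (\<Union>K\<in>\<K>. ?pre K)" by blast
    then show "openin (top_of_set (nonzero_vecs I)) (?pre (\<Union>\<K>))"
      using * by (simp only:) (rule openin_Union, blast)
  qed
  then show ?thesis
    by (simp add: proj_topology_def topology_inverse')
qed

lemma topspace_proj_topology [simp]: "topspace (proj_topology I) = proj_space I"
proof -
  have "{v \<in> nonzero_vecs I. proj_point v \<in> proj_space I} = nonzero_vecs I"
    by (auto simp: proj_space_def)
  then have "openin (proj_topology I) (proj_space I)"
    by (simp add: openin_proj_topology)
  then show ?thesis
    by (metis openin_proj_topology openin_subset openin_topspace subset_antisym)
qed

lemma quotient_map_proj_point:
  "quotient_map (top_of_set (nonzero_vecs I)) (proj_topology I) proj_point"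
  by (auto simp: quotient_map_def proj_space_def openin_proj_topology)

definition affine_chart :: "'i set \<Rightarrow> 'i \<Rightarrow> ('i \<Rightarrow> complex) set set" where
  "affine_chart I i = {p \<in> proj_space I. \<forall>v\<in>p. v i \<noteq> 0}"

text \<open>
  The \<open>j\<close>-th affine coordinate in the chart \<open>i\<close>: a point of that chart contains exactly one
  vector whose \<open>i\<close>-th entry is \<open>1\<close>.
\<close>

definition affine_coord :: "'i \<Rightarrow> 'i \<Rightarrow> ('i \<Rightarrow> complex) set \<Rightarrow> complex" where
  "affine_coord i j p = (THE v. v \<in> p \<and> v i = 1) j"

lemma affine_coord_proj_point:
  assumes "v i \<noteq> 0"
  shows "affine_coord i j (proj_point v) = v j / v i"
proof -
  have "(THE w. w \<in> proj_point v \<and> w i = 1) = (\<lambda>j. inverse (v i) * v j)"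
  proof (rule the_equality)
    show "(\<lambda>j. inverse (v i) * v j) \<in> proj_point v \<and> inverse (v i) * v i = 1"
      using assms by (auto simp: proj_point_def intro!: exI[of _ "inverse (v i)"])
  next
    fix w assume w: "w \<in> proj_point v \<and> w i = 1"
    then obtain c where "w = (\<lambda>j. c * v j)" by (auto simp: proj_point_def)
    with w assms show "w = (\<lambda>j. inverse (v i) * v j)"
      by (metis inverse_unique mult.commute)
  qed
  then show ?thesis
    by (simp add: affine_coord_def divide_inverse mult.commute)
qed


section \<open>Hyperbolicity of subsets of projective space\<close>

text \<open>
  Holomorphic maps from an open set \<open>S \<subseteq> \<complex>\<close> to the projective space over \<open>I\<close> with image in \<open>Y\<close>:
  continuous maps that are holomorphic in the affine charts.  Since \<open>S\<close> is reduced, if \<open>Y\<close> is the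
  support of a closed (possibly non-reduced) analytic subspace, these are precisely the
  holomorphic maps from \<open>S\<close> to that subspace.
\<close>

definition holomorphic_map ::
  "complex set \<Rightarrow> 'i set \<Rightarrow> ('i \<Rightarrow> complex) set set \<Rightarrow> (complex \<Rightarrow> ('i \<Rightarrow> complex) set) \<Rightarrow> bool" where
  "holomorphic_map S I Y f \<longleftrightarrow>
     continuous_map (top_of_set S) (proj_topology I) f \<and> f ` S \<subseteq> Y \<and>
     (\<forall>i\<in>I. \<forall>j\<in>I. (\<lambda>z. affine_coord i j (f z)) holomorphic_on {z \<in> S. f z \<in> affine_chart I i})"

definition brody_hyperbolic :: "'i set \<Rightarrow> ('i \<Rightarrow> complex) set set \<Rightarrow> bool" where
  "brody_hyperbolic I Y \<longleftrightarrow> (\<forall>f. holomorphic_map UNIV I Y f \<longrightarrow> f constant_on UNIV)"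

text \<open>The distance of the Poincare metric of curvature \<open>-1\<close> on the unit disc.\<close>

definition poincare_dist :: "complex \<Rightarrow> complex \<Rightarrow> real" where
  "poincare_dist a b = 2 * artanh (norm (Moebius_function 0 a b))"

text \<open>
  \<open>x\<close> lists the points of a chain of \<open>m\<close> holomorphic discs in \<open>Y\<close> from \<open>p\<close> to \<open>q\<close>; the disc \<open>f l\<close>
  maps \<open>a l\<close> to \<open>x l\<close> and \<open>b l\<close> to \<open>x (Suc l)\<close>.
\<close>

definition disc_chain ::
  "'i set \<Rightarrow> ('i \<Rightarrow> complex) set set \<Rightarrow> ('i \<Rightarrow> complex) set \<Rightarrow> ('i \<Rightarrow> complex) set \<Rightarrow> nat \<Rightarrow>
   (nat \<Rightarrow> ('i \<Rightarrow> complex) set) \<Rightarrow> (nat \<Rightarrow> complex \<Rightarrow> ('i \<Rightarrow> complex) set) \<Rightarrow>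
   (nat \<Rightarrow> complex) \<Rightarrow> (nat \<Rightarrow> complex) \<Rightarrow> bool" where
  "disc_chain I Y p q m x f a b \<longleftrightarrow>
     m > 0 \<and> x 0 = p \<and> x m = q \<and>
     (\<forall>l<m. holomorphic_map (ball 0 1) I Y (f l) \<and> a l \<in> ball 0 1 \<and> b l \<in> ball 0 1 \<and>
            f l (a l) = x l \<and> f l (b l) = x (Suc l))"

text \<open>The value is \<open>\<infinity>\<close> if \<open>p\<close> and \<open>q\<close> are not joined by any chain of discs in \<open>Y\<close>.\<close>

definition kobayashi_dist ::
  "'i set \<Rightarrow> ('i \<Rightarrow> complex) set set \<Rightarrow> ('i \<Rightarrow> complex) set \<Rightarrow> ('i \<Rightarrow> complex) set \<Rightarrow> ennreal" where
  "kobayashi_dist I Y p q =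
     Inf {ennreal (\<Sum>l<m. poincare_dist (a l) (b l)) | m x f a b. disc_chain I Y p q m x f a b}"

definition kobayashi_setdist ::
  "'i set \<Rightarrow> ('i \<Rightarrow> complex) set set \<Rightarrow> ('i \<Rightarrow> complex) set set \<Rightarrow> ('i \<Rightarrow> complex) set set \<Rightarrow> ennreal" where
  "kobayashi_setdist I Y A B = (INF p\<in>A. INF q\<in>B. kobayashi_dist I Y p q)"

definition hyperbolically_embedded :: "'i set \<Rightarrow> ('i \<Rightarrow> complex) set set \<Rightarrow> bool" where
  "hyperbolically_embedded I Y \<longleftrightarrow>
     openin (proj_topology I) Y \<and>
     compactin (proj_topology I) (proj_topology I closure_of Y) \<and>
     (\<forall>p \<in> proj_topology I closure_of Y. \<forall>q \<in> proj_topology I closure_of Y. p \<noteq> q \<longrightarrow>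
        (\<exists>U V. openin (proj_topology I) U \<and> p \<in> U \<and> openin (proj_topology I) V \<and> q \<in> V \<and>
               kobayashi_setdist I Y (U \<inter> Y) (V \<inter> Y) > 0))"


section \<open>Hypersurfaces and their parameter space\<close>

text \<open>Exponent vectors of the monomials of degree \<open>d\<close> in the variables with indices \<open>0, \<dots>, n\<close>.\<close>

definition monomials :: "nat \<Rightarrow> nat \<Rightarrow> (nat \<Rightarrow> nat) set" where
  "monomials n d = {\<alpha>. (\<forall>i>n. \<alpha> i = 0) \<and> (\<Sum>i\<le>n. \<alpha> i) = d}"

lemma bij_betw_monomials:
  "bij_betw (\<lambda>\<alpha>. map \<alpha> [0..<Suc n]) (monomials n d)
     {l :: nat list. length l = Suc n \<and> sum_list l = d}"
proof (rule bij_betw_byWitness[where f' = "\<lambda>l i. if i \<le> n then l ! i else 0"])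
  show "\<forall>\<alpha>\<in>monomials n d. (\<lambda>i. if i \<le> n then map \<alpha> [0..<Suc n] ! i else 0) = \<alpha>"
    by (auto simp: monomials_def fun_eq_iff simp del: upt_Suc)
  show "\<forall>l\<in>{l. length l = Suc n \<and> sum_list l = d}.
      map (\<lambda>i. if i \<le> n then l ! i else 0) [0..<Suc n] = l"
    by (auto simp: list_eq_iff_nth_eq simp del: upt_Suc)
  show "(\<lambda>\<alpha>. map \<alpha> [0..<Suc n]) ` monomials n d \<subseteq> {l. length l = Suc n \<and> sum_list l = d}"
    by (auto simp: monomials_def interv_sum_list_conv_sum_set_nat atLeast0LessThan lessThan_Suc_atMost
        simp del: upt_Suc)
  show "(\<lambda>l i. if i \<le> n then l ! i else 0) ` {l. length l = Suc n \<and> sum_list l = d} \<subseteq> monomials n d"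
    by (auto simp: monomials_def sum_list_sum_nth atLeast0LessThan lessThan_Suc_atMost)
qed

lemma card_monomials: "card (monomials n d) = (n + d) choose n"
  using bij_betw_same_card[OF bij_betw_monomials[of n d]] card_length_sum_list[of "Suc n" d]
  by (simp add: binomial_symmetric[of d "d + n"] add.commute)

lemma finite_monomials: "finite (monomials n d)"
  by (rule card_ge_0_finite) (simp add: card_monomials)

text \<open>The value at \<open>v\<close> of the form of degree \<open>d\<close> with coefficients \<open>F\<close>.\<close>

definition eval_form :: "nat \<Rightarrow> nat \<Rightarrow> ((nat \<Rightarrow> nat) \<Rightarrow> complex) \<Rightarrow> (nat \<Rightarrow> complex) \<Rightarrow> complex" where
  "eval_form n d F v = (\<Sum>\<alpha>\<in>monomials n d. F \<alpha> * (\<Prod>i\<le>n. v i ^ \<alpha> i))"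

definition hypersurface_space :: "nat \<Rightarrow> nat \<Rightarrow> ((nat \<Rightarrow> nat) \<Rightarrow> complex) set set" where
  "hypersurface_space n d = proj_space (monomials n d)"

text \<open>
  The support in \<open>\<bbbP>\<^sup>n\<close> of the hypersurface with parameter \<open>P\<close>; the quantifiers range over all
  representatives of \<open>P\<close> and of \<open>p\<close>, on which the condition does not depend.
\<close>

definition hypersurface :: "nat \<Rightarrow> nat \<Rightarrow> ((nat \<Rightarrow> nat) \<Rightarrow> complex) set \<Rightarrow> (nat \<Rightarrow> complex) set set" where
  "hypersurface n d P = {p \<in> proj_space {..n}. \<forall>F\<in>P. \<forall>v\<in>p. eval_form n d F v = 0}"

lemma proj_point_in_hypersurface_iff:
  assumes "v \<in> nonzero_vecs {..n}"
  shows "proj_point v \<in> hypersurface n d (proj_point F) \<longleftrightarrow> eval_form n d F v = 0"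
proof -
  have scale: "eval_form n d (\<lambda>\<alpha>. c * F \<alpha>) (\<lambda>i. e * v i) = c * e ^ d * eval_form n d F v" for c e
  proof -
    have "(\<Prod>i\<le>n. (e * v i) ^ \<alpha> i) = e ^ d * (\<Prod>i\<le>n. v i ^ \<alpha> i)" if "\<alpha> \<in> monomials n d" for \<alpha>
      using that
      by (simp add: power_mult_distrib prod.distrib power_sum[symmetric] monomials_def)
    then show ?thesis
      unfolding eval_form_def sum_distrib_left
      by (intro sum.cong) (simp_all add: algebra_simps)
  qed
  have "eval_form n d F v = 0" if "\<forall>G\<in>proj_point F. \<forall>w\<in>proj_point v. eval_form n d G w = 0"
  proof -
    have "F \<in> proj_point F" "v \<in> proj_point v"
      by (auto simp: proj_point_def intro: exI[of _ 1])
    then show ?thesis using that by blast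
  qed
  moreover have "proj_point v \<in> proj_space {..n}"
    using assms by (simp add: proj_space_def)
  ultimately show ?thesis
    by (auto simp: hypersurface_def proj_point_def scale)
qed

definition H :: "nat \<Rightarrow> nat \<Rightarrow> ((nat \<Rightarrow> nat) \<Rightarrow> complex) set set" where
  "H n d = {P \<in> hypersurface_space n d. brody_hyperbolic {..n} (hypersurface n d P)}"

definition HE :: "nat \<Rightarrow> nat \<Rightarrow> ((nat \<Rightarrow> nat) \<Rightarrow> complex) set set" where
  "HE n d = {P \<in> hypersurface_space n d.
     hyperbolically_embedded {..n} (proj_space {..n} - hypersurface n d P)}"

end

theory Submission
  imports Defs
begin

text \<open>
  Measure a curve in \<open>\<bbbP>\<^sup>n\<close> by its Fubini--Study speed.  A sequence of discs, each contained in or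
  disjoint from \<open>{F\<^sub>j = 0}\<close>, with central speeds tending to infinity and with \<open>F\<^sub>j \<longlonglongrightarrow> F\<close>, yields
  by Brody reparametrisation and Hurwitz' theorem a nonconstant entire curve of bounded speed contained in
  or disjoint from \<open>{F = 0}\<close>.  Hence \<open>F\<close> lies in \<open>HE \<inter> H\<close> iff there is no such entire curve, iff the
  central speeds of these discs are uniformly bounded for all forms near \<open>F\<close>; so \<open>HE \<inter> H\<close> is open,
  and so is \<open>H\<close>.

  For non-emptiness take a hyperbolic form \<open>f\<close> of degree \<open>k\<close>, a point \<open>a\<close> with \<open>f a \<noteq> 0\<close>, linear forms
  \<open>L\<^sub>0, \<dots>, L\<^sub>n\<close> cutting out the point \<open>a\<close>, and put \<open>\<phi>\<^sub>i = f + \<epsilon> L\<^sub>i\<^sup>k\<close> for \<open>i \<le> n\<close> and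
  \<open>\<phi>\<^bsub>n+1\<^esub> = - (\<phi>\<^sub>0 + \<dots> + \<phi>\<^sub>n)\<close>.  Every proper partial sum of the \<open>\<phi>\<^sub>i\<close> is a multiple of a
  form near \<open>f\<close>, hence hyperbolic for small \<open>\<epsilon>\<close>.  Along an entire curve of bounded speed avoiding all
  \<open>{\<phi>\<^sub>i = 0}\<close>, the ratios \<open>\<phi>\<^sub>i / \<phi>\<^sub>0\<close> are exponentials of polynomials with vanishing sum, so by
  Borel's theorem either a proper partial sum vanishes on the curve or all the ratios are constant; in both
  cases the curve is constant.  So a product of the \<open>\<phi>\<^sub>i\<close> of degree \<open>\<delta>\<close> in which all of them occur is in
  \<open>HE \<inter> H\<close>.
\<close>

section \<open>Holomorphic curves in projective space\<close>

text \<open>Restricting to curves of bounded speed keeps the value distribution elementary: such a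
  curve has order at most two, so units along it have polynomial exponents, and Borel's theorem
  becomes the linear independence of exponentials of polynomials over the polynomials.

  Curves inside and outside the hypersurface are treated together because curves avoiding
  hypersurfaces may converge to a curve inside the limit hypersurface. This is why \<open>HE\<close>
  is intersected with \<open>H\<close>.

  The number \<open>n + 2\<close> counts factors: \<open>n + 1\<close> perturbations of
  \<open>f\<close>, and minus their sum, which supplies the linear relation for Borel's theorem. A
  common zero of the perturbations would be a zero of \<open>f\<close>, since one of the
  \<open>L\<close> vanishes identically, and then of all the \<open>L\<close>; so it would be the
  point \<open>a\<close>, where \<open>f\<close> does not vanish. Hence the perturbations define a
  finite map, and constant ratios force a constant curve. A vanishing sum that involves the last
  factor is traded for the complementary sum, so only sums of perturbations of \<open>f\<close>
  occur; divided by the number of terms they are close to \<open>f\<close>.\<close>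

lemma proj_point_self: "v \<in> proj_point v"
  by (auto simp: proj_point_def intro!: exI[of _ 1])

lemma proj_point_scale: "c \<noteq> 0 \<Longrightarrow> proj_point (\<lambda>i. c * v i) = proj_point v"
  unfolding proj_point_def
proof (intro set_eqI iffI)
  fix x assume "c \<noteq> 0" "x \<in> {\<lambda>i. ca * (c * v i) |ca. ca \<noteq> 0}"
  then obtain d where "d \<noteq> 0" "x = (\<lambda>i. d * (c * v i))" by auto
  then show "x \<in> {\<lambda>i. c * v i |c. c \<noteq> 0}"
    using \<open>c \<noteq> 0\<close> by (auto simp: mult.assoc[symmetric] intro!: exI[of _ "d * c"])
next
  fix x assume "c \<noteq> 0" "x \<in> {\<lambda>i. c * v i |c. c \<noteq> 0}"
  then obtain d where "d \<noteq> 0" "x = (\<lambda>i. d * v i)" by auto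
  then show "x \<in> {\<lambda>i. ca * (c * v i) |ca. ca \<noteq> 0}"
    using \<open>c \<noteq> 0\<close> by (auto intro!: exI[of _ "d / c"])
qed

lemma proj_point_eqD:
  assumes "proj_point v = proj_point w"
  obtains c where "c \<noteq> 0" "w = (\<lambda>i. c * v i)"
proof -
  have "w \<in> proj_point v" using proj_point_self[of w] by (simp add: assms)
  then show ?thesis using that by (auto simp: proj_point_def)
qed

lemma nonzero_vecs_scale: "v \<in> nonzero_vecs I \<Longrightarrow> c \<noteq> 0 \<Longrightarrow> (\<lambda>i. c * v i) \<in> nonzero_vecs I"
  by (auto simp: nonzero_vecs_def)

lemma nonzero_vecsE:
  assumes "v \<in> nonzero_vecs I"
  obtains i where "i \<in> I" "v i \<noteq> 0"
  using assms by (auto simp: nonzero_vecs_def)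

lemma proj_spaceE:
  assumes "p \<in> proj_space I"
  obtains v where "v \<in> nonzero_vecs I" "p = proj_point v"
  using assms by (auto simp: proj_space_def)

lemma affine_chart_iff:
  assumes "v \<in> nonzero_vecs I"
  shows "proj_point v \<in> affine_chart I i \<longleftrightarrow> v i \<noteq> 0"
  using assms proj_point_self[of v]
  by (auto simp: affine_chart_def proj_point_def proj_space_def)

definition nsq :: "'i set \<Rightarrow> ('i \<Rightarrow> complex) \<Rightarrow> real" where
  "nsq I v = (\<Sum>i\<in>I. (cmod (v i))\<^sup>2)"

lemma nsq_pos: "finite I \<Longrightarrow> v \<in> nonzero_vecs I \<Longrightarrow> nsq I v > 0"
  unfolding nsq_def by (elim nonzero_vecsE) (rule sum_pos2, auto)

lemma nsq_nonneg: "nsq I v \<ge> 0"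
  unfolding nsq_def by (rule sum_nonneg) auto

lemma norm_le_nsq: "finite I \<Longrightarrow> i \<in> I \<Longrightarrow> (cmod (v i))\<^sup>2 \<le> nsq I v"
  unfolding nsq_def by (rule member_le_sum) auto

lemma nsq_scale: "nsq I (\<lambda>i. c * v i) = (cmod c)\<^sup>2 * nsq I v"
  by (simp add: nsq_def norm_mult power_mult_distrib sum_distrib_left)

section \<open>Local homogeneous lifts of curves\<close>

definition proj_lift ::
  "'i set \<Rightarrow> complex set \<Rightarrow> (complex \<Rightarrow> ('i \<Rightarrow> complex) set) \<Rightarrow> (complex \<Rightarrow> 'i \<Rightarrow> complex) \<Rightarrow> bool" where
  "proj_lift I S f v \<longleftrightarrow> (\<forall>i. (\<lambda>z. v z i) holomorphic_on S) \<and>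
     (\<forall>z\<in>S. v z \<in> nonzero_vecs I \<and> f z = proj_point (v z))"

text \<open>Holomorphy through local lifts involves no choice of a chart, and homogeneous forms and
  Wronskians can be evaluated directly on a lift.\<close>

definition proj_hol :: "'i set \<Rightarrow> complex set \<Rightarrow> (complex \<Rightarrow> ('i \<Rightarrow> complex) set) \<Rightarrow> bool" where
  "proj_hol I S f \<longleftrightarrow> (\<forall>z\<in>S. \<exists>e>0. \<exists>v. ball z e \<subseteq> S \<and> proj_lift I (ball z e) f v)"

lemma proj_liftD:
  assumes "proj_lift I S f v"
  shows "(\<lambda>z. v z i) holomorphic_on S" "z \<in> S \<Longrightarrow> v z \<in> nonzero_vecs I"
    "z \<in> S \<Longrightarrow> f z = proj_point (v z)"
  using assms by (auto simp: proj_lift_def)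

lemma proj_lift_subset: "proj_lift I S f v \<Longrightarrow> T \<subseteq> S \<Longrightarrow> proj_lift I T f v"
  unfolding proj_lift_def by (meson holomorphic_on_subset subsetD)

lemma proj_lift_compose:
  assumes "proj_lift I S f v" "\<phi> holomorphic_on T" "\<phi> ` T \<subseteq> S"
  shows "proj_lift I T (\<lambda>z. f (\<phi> z)) (\<lambda>z. v (\<phi> z))"
  unfolding proj_lift_def
proof (intro conjI allI ballI)
  fix i
  show "(\<lambda>z. v (\<phi> z) i) holomorphic_on T"
    using holomorphic_on_compose_gen[OF assms(2), of "\<lambda>z. v z i" S] assms
    by (simp add: proj_lift_def o_def)
qed (use assms in \<open>auto simp: proj_lift_def\<close>)

lemma proj_lift_imp_proj_hol:
  assumes "proj_lift I S f v" "open S"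
  shows "proj_hol I S f"
  unfolding proj_hol_def using assms proj_lift_subset[OF assms(1)] openE[OF assms(2)] by metis

lemma proj_holE:
  assumes "proj_hol I S f" "z \<in> S"
  obtains e v where "e > 0" "ball z e \<subseteq> S" "proj_lift I (ball z e) f v"
  using assms unfolding proj_hol_def by blast

lemma proj_hol_open: "proj_hol I S f \<Longrightarrow> open S"
  unfolding proj_hol_def open_contains_ball by blast

lemma proj_hol_subset: "proj_hol I S f \<Longrightarrow> open T \<Longrightarrow> T \<subseteq> S \<Longrightarrow> proj_hol I T f"
proof -
  assume a: "proj_hol I S f" "open T" "T \<subseteq> S"
  show ?thesis unfolding proj_hol_def
  proof
    fix z assume z: "z \<in> T"
    then obtain e v where e: "e > 0" "ball z e \<subseteq> S" "proj_lift I (ball z e) f v"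
      using proj_holE a by blast
    obtain d where "d > 0" "ball z d \<subseteq> T" using openE[OF a(2) z] by blast
    moreover have "proj_lift I (ball z (min d e)) f v"
      by (rule proj_lift_subset[OF e(3)]) auto
    ultimately show "\<exists>e>0. \<exists>v. ball z e \<subseteq> T \<and> proj_lift I (ball z e) f v"
      using e(1) by (intro exI[of _ "min d e"] conjI exI[of _ v]) auto
  qed
qed

lemma proj_hol_in_space: "proj_hol I S f \<Longrightarrow> z \<in> S \<Longrightarrow> f z \<in> proj_space I"
proof -
  assume "proj_hol I S f" "z \<in> S"
  then obtain e v where "e > 0" "proj_lift I (ball z e) f v" by (elim proj_holE)
  then show ?thesis
    using proj_liftD(2,3)[of I "ball z e" f v z] by (simp add: proj_space_def)
qed

lemma proj_hol_compose:
  assumes f: "proj_hol I S f" and \<phi>: "\<phi> holomorphic_on T" "\<phi> ` T \<subseteq> S" and T: "open T"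
  shows "proj_hol I T (\<lambda>z. f (\<phi> z))"
  unfolding proj_hol_def
proof
  fix z assume z: "z \<in> T"
  then obtain e v where e: "e > 0" "ball (\<phi> z) e \<subseteq> S" "proj_lift I (ball (\<phi> z) e) f v"
    using proj_holE[OF f, of "\<phi> z"] \<phi>(2) by blast
  have "open (T \<inter> \<phi> -` ball (\<phi> z) e)"
    using holomorphic_on_imp_continuous_on[OF \<phi>(1)] T continuous_open_preimage by blast
  then obtain d where d: "d > 0" "ball z d \<subseteq> T \<inter> \<phi> -` ball (\<phi> z) e"
    using z e(1) by (elim openE[of _ z]) auto
  have "proj_lift I (ball z d) (\<lambda>z. f (\<phi> z)) (\<lambda>z. v (\<phi> z))"
    by (rule proj_lift_compose[OF e(3)]) (use d \<phi> in \<open>auto intro: holomorphic_on_subset\<close>)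
  then show "\<exists>e>0. \<exists>v. ball z e \<subseteq> T \<and> proj_lift I (ball z e) (\<lambda>z. f (\<phi> z)) v"
    using d by auto
qed

lemma openin_affine_chart:
  assumes "i \<in> I"
  shows "openin (proj_topology I) (affine_chart I i)"
proof -
  have "{v \<in> nonzero_vecs I. proj_point v \<in> affine_chart I i} = nonzero_vecs I \<inter> {v. v i \<noteq> 0}"
    by (auto simp: affine_chart_iff)
  moreover have "open {v :: 'a \<Rightarrow> complex. v i \<noteq> 0}"
    by (intro open_Collect_neq continuous_on_product_coordinates continuous_intros)
  ultimately show ?thesis
    by (auto simp: openin_proj_topology affine_chart_def openin_open_Int)
qed

text \<open>The chart coordinates of a point, the \<open>i\<close>-th of them being 1, form a local
  lift; conversely, dividing a lift by its \<open>i\<close>-th entry gives the chart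
  coordinates.\<close>

theorem holomorphic_map_iff:
  assumes S: "open S"
  shows "holomorphic_map S I Y f \<longleftrightarrow> proj_hol I S f \<and> f ` S \<subseteq> Y"
proof
  assume f: "holomorphic_map S I Y f"
  then have cont: "continuous_map (top_of_set S) (proj_topology I) f" and Y: "f ` S \<subseteq> Y"
    and hol: "\<And>i j. i \<in> I \<Longrightarrow> j \<in> I \<Longrightarrow>
       (\<lambda>z. affine_coord i j (f z)) holomorphic_on {z \<in> S. f z \<in> affine_chart I i}"
    by (auto simp: holomorphic_map_def)
  have "proj_hol I S f" unfolding proj_hol_def
  proof
    fix z assume z: "z \<in> S"
    then have "f z \<in> proj_space I"
      using cont by (auto simp: continuous_map_def Pi_iff)
    then obtain v0 where v0: "v0 \<in> nonzero_vecs I" "f z = proj_point v0" by (elim proj_spaceE)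
    then obtain i where i: "i \<in> I" "v0 i \<noteq> 0" by (elim nonzero_vecsE)
    let ?T = "{z \<in> S. f z \<in> affine_chart I i}"
    have "openin (top_of_set S) ?T"
      using openin_continuous_map_preimage[OF cont openin_affine_chart[OF i(1)]] by simp
    then have T: "open ?T" using S openin_open_eq by auto
    have zT: "z \<in> ?T" using z v0 i by (simp add: affine_chart_iff)
    define w where "w = (\<lambda>x j. if j \<in> I then affine_coord i j (f x) else 0)"
    have "proj_lift I ?T f w" unfolding proj_lift_def
    proof (intro conjI allI ballI)
      fix j show "(\<lambda>x. w x j) holomorphic_on ?T"
        using hol[OF i(1)] by (cases "j \<in> I") (auto simp: w_def)
    next
      fix x assume x: "x \<in> ?T"
      then obtain u where u: "u \<in> nonzero_vecs I" "f x = proj_point u"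
        by (auto simp: affine_chart_def elim: proj_spaceE)
      then have ui: "u i \<noteq> 0" using x by (simp add: affine_chart_iff)
      have weq: "w x = (\<lambda>j. (1 / u i) * u j)"
        using u ui by (auto simp: w_def fun_eq_iff affine_coord_proj_point nonzero_vecs_def)
      show "w x \<in> nonzero_vecs I" unfolding weq using u ui by (intro nonzero_vecs_scale) auto
      show "f x = proj_point (w x)" unfolding weq using u ui by (subst proj_point_scale) auto
    qed
    moreover obtain e where "e > 0" "ball z e \<subseteq> ?T" using openE[OF T zT] .
    ultimately show "\<exists>e>0. \<exists>v. ball z e \<subseteq> S \<and> proj_lift I (ball z e) f v"
      using proj_lift_subset[of I ?T f w "ball z e"] by blast
  qed
  with Y show "proj_hol I S f \<and> f ` S \<subseteq> Y" by simp
next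
  assume f: "proj_hol I S f \<and> f ` S \<subseteq> Y"
  have cont: "continuous_map (top_of_set S) (proj_topology I) f"
    unfolding continuous_map_def
  proof (intro conjI allI impI)
    show "f \<in> topspace (top_of_set S) \<rightarrow> topspace (proj_topology I)"
      using proj_hol_in_space f by auto
    fix U assume U: "openin (proj_topology I) U"
    have "\<exists>T. open T \<and> z \<in> T \<and> T \<subseteq> {x \<in> S. f x \<in> U}" if z: "z \<in> {x \<in> S. f x \<in> U}" for z
    proof -
      obtain e v where e: "e > 0" "ball z e \<subseteq> S" "proj_lift I (ball z e) f v"
        using proj_holE f z by blast
      from U obtain W where W: "open W"
        "{v \<in> nonzero_vecs I. proj_point v \<in> U} = nonzero_vecs I \<inter> W"
        by (auto simp: openin_proj_topology openin_open)
      have "continuous_on (ball z e) v"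
        using proj_liftD(1)[OF e(3)] by (intro continuous_on_coordinatewise_then_product holomorphic_on_imp_continuous_on)
      then have "open (ball z e \<inter> v -` W)"
        using W by (simp add: continuous_open_preimage)
      moreover have "x \<in> v -` W \<longleftrightarrow> f x \<in> U" if "x \<in> ball z e" for x
        using eqset_imp_iff[OF W(2), of "v x"] proj_liftD(2,3)[OF e(3) that] by simp
      ultimately show ?thesis
        using e z by (intro exI[of _ "ball z e \<inter> v -` W"]) auto
    qed
    then have "open {x \<in> S. f x \<in> U}" by (subst open_subopen) blast
    then show "openin (top_of_set S) {x \<in> topspace (top_of_set S). f x \<in> U}"
      using S by (simp add: openin_open_eq)
  qed
  moreover have "(\<lambda>z. affine_coord i j (f z)) holomorphic_on {z \<in> S. f z \<in> affine_chart I i}"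
    if "i \<in> I" "j \<in> I" for i j
  proof -
    let ?T = "{z \<in> S. f z \<in> affine_chart I i}"
    have "openin (top_of_set S) ?T"
      using openin_continuous_map_preimage[OF cont openin_affine_chart[OF that(1)]] by simp
    then have T: "open ?T" using S openin_open_eq by auto
    show ?thesis unfolding holomorphic_on_open[OF T] field_differentiable_def[symmetric]
    proof
      fix z assume z: "z \<in> ?T"
      obtain e v where e: "e > 0" "ball z e \<subseteq> S" "proj_lift I (ball z e) f v"
        using proj_holE f z by blast
      have vz: "v z i \<noteq> 0"
        using z proj_liftD(2,3)[OF e(3), of z] e(1) by (simp add: affine_chart_iff)
      have "continuous_on (ball z e) (\<lambda>x. v x i)"
        using proj_liftD(1)[OF e(3)] by (rule holomorphic_on_imp_continuous_on)
      then have op: "open (ball z e \<inter> (\<lambda>x. v x i) -` (-{0}))"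
        by (intro continuous_open_preimage) auto
      have "(\<lambda>x. v x j / v x i) holomorphic_on (ball z e \<inter> (\<lambda>x. v x i) -` (-{0}))"
        by (intro holomorphic_intros holomorphic_on_subset[OF proj_liftD(1)[OF e(3)]]) auto
      then have "(\<lambda>x. affine_coord i j (f x)) holomorphic_on (ball z e \<inter> (\<lambda>x. v x i) -` (-{0}))"
        by (rule holomorphic_transform)
          (use proj_liftD(3)[OF e(3)] in \<open>auto simp: affine_coord_proj_point\<close>)
      then show "(\<lambda>x. affine_coord i j (f x)) field_differentiable at z"
        using op vz e(1) holomorphic_on_imp_differentiable_at by auto
    qed
  qed
  ultimately show "holomorphic_map S I Y f" using f by (auto simp: holomorphic_map_def)
qed

section \<open>The speed of a curve\<close>

text \<open>The speed is invariant under multiplication of the lift by a nonvanishing function, and comparable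
  to the norm of the derivative for the Fubini--Study metric.\<close>

definition wron :: "(complex \<Rightarrow> 'i \<Rightarrow> complex) \<Rightarrow> 'i \<Rightarrow> 'i \<Rightarrow> complex \<Rightarrow> complex" where
  "wron v i j z = v z i * deriv (\<lambda>z. v z j) z - v z j * deriv (\<lambda>z. v z i) z"

definition speed :: "'i set \<Rightarrow> (complex \<Rightarrow> 'i \<Rightarrow> complex) \<Rightarrow> complex \<Rightarrow> real" where
  "speed I v z = (\<Sum>i\<in>I. \<Sum>j\<in>I. cmod (wron v i j z)) / nsq I (v z)"

text \<open>The choice of the lift is harmless: by \<open>speed_lift_unique\<close> all lifts near
  \<open>z\<close> give the same value.\<close>

definition fspeed :: "'i set \<Rightarrow> (complex \<Rightarrow> ('i \<Rightarrow> complex) set) \<Rightarrow> complex \<Rightarrow> real" where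
  "fspeed I f z = speed I (SOME v. \<exists>e>0. proj_lift I (ball z e) f v) z"

lemma speed_nonneg: "speed I v z \<ge> 0"
  unfolding speed_def by (intro divide_nonneg_nonneg sum_nonneg nsq_nonneg) auto

text \<open>The two terms containing the derivative of \<open>l\<close> cancel by
  antisymmetry.\<close>

lemma wron_scale:
  assumes "open T" "z \<in> T" "\<And>i. (\<lambda>x. v x i) holomorphic_on T" "l holomorphic_on T"
  shows "wron (\<lambda>x i. l x * v x i) i j z = (l z)\<^sup>2 * wron v i j z"
proof -
  have d: "(\<lambda>x. v x i) field_differentiable at z" "l field_differentiable at z" for i
    using assms holomorphic_on_imp_differentiable_at by blast+
  show ?thesis
    unfolding wron_def by (simp add: deriv_mult d algebra_simps power2_eq_square)
qed

lemma wron_cong: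
  assumes "open T" "z \<in> T" "\<And>x. x \<in> T \<Longrightarrow> v x = w x"
  shows "wron v i j z = wron w i j z"
proof -
  have "\<forall>\<^sub>F x in nhds z. v x i = w x i" for i
    using eventually_nhds_in_open[OF assms(1,2)] by eventually_elim (simp add: assms(3))
  then have "deriv (\<lambda>x. v x i) z = deriv (\<lambda>x. w x i) z" for i
    by (intro deriv_cong_ev) auto
  then show ?thesis using assms by (simp add: wron_def)
qed

text \<open>Where the \<open>i\<close>-th entry of \<open>v\<close> does not vanish, the factor is
  the quotient of the \<open>i\<close>-th entries and therefore holomorphic.\<close>

lemma proj_lift_transition:
  assumes v: "proj_lift I S f v" and w: "proj_lift I S f w" and S: "open S" "z \<in> S"
  obtains T l where "open T" "z \<in> T" "T \<subseteq> S" "l holomorphic_on T"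
    "\<And>x. x \<in> T \<Longrightarrow> l x \<noteq> 0 \<and> w x = (\<lambda>i. l x * v x i)"
proof -
  obtain i where i: "v z i \<noteq> 0" using proj_liftD(2)[OF v S(2)] by (elim nonzero_vecsE)
  define T where "T = S \<inter> (\<lambda>x. v x i) -` (-{0})"
  have "continuous_on S (\<lambda>x. v x i)"
    using proj_liftD(1)[OF v] by (rule holomorphic_on_imp_continuous_on)
  then have T: "open T" "z \<in> T" "T \<subseteq> S"
    using S i unfolding T_def by (auto intro: continuous_open_preimage)
  define l where "l = (\<lambda>x. w x i / v x i)"
  have "l holomorphic_on T" unfolding l_def
    using T proj_liftD(1)[OF v] proj_liftD(1)[OF w]
    by (intro holomorphic_intros) (auto intro: holomorphic_on_subset simp: T_def)
  moreover have "l x \<noteq> 0 \<and> w x = (\<lambda>i. l x * v x i)" if x: "x \<in> T" for x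
  proof -
    have "proj_point (v x) = proj_point (w x)"
      using x T proj_liftD(3)[OF v] proj_liftD(3)[OF w] by force
    then obtain c where c: "c \<noteq> 0" "w x = (\<lambda>i. c * v x i)" by (elim proj_point_eqD)
    then have "l x = c" using x by (auto simp: l_def T_def)
    with c show ?thesis by simp
  qed
  ultimately show ?thesis using that T by blast
qed

lemma speed_scale:
  assumes "open T" "z \<in> T" "\<And>i. (\<lambda>x. v x i) holomorphic_on T" "l holomorphic_on T"
    "\<And>x. x \<in> T \<Longrightarrow> w x = (\<lambda>i. l x * v x i)" "l z \<noteq> 0"
  shows "speed I w z = speed I v z"
proof -
  have "wron w i j z = (l z)\<^sup>2 * wron v i j z" for i j
    using wron_cong[OF assms(1,2), of w "\<lambda>x i. l x * v x i"] wron_scale[OF assms(1-4)] assms(5) by simp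
  then have "speed I w z = ((cmod (l z))\<^sup>2 * (\<Sum>i\<in>I. \<Sum>j\<in>I. cmod (wron v i j z))) / ((cmod (l z))\<^sup>2 * nsq I (v z))"
    using assms by (simp add: speed_def nsq_scale norm_mult norm_power sum_distrib_left)
  then show ?thesis using assms(6) by (simp add: speed_def)
qed

lemma speed_lift_unique:
  assumes v: "proj_lift I S f v" and w: "proj_lift I S f w" and S: "open S" "z \<in> S"
  shows "speed I w z = speed I v z"
proof -
  obtain T l where T: "open T" "z \<in> T" "T \<subseteq> S" "l holomorphic_on T"
    "\<And>x. x \<in> T \<Longrightarrow> l x \<noteq> 0 \<and> w x = (\<lambda>i. l x * v x i)"
    by (rule proj_lift_transition[OF assms]) blast
  show ?thesis
    by (rule speed_scale[OF T(1,2) _ T(4)])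
      (use T holomorphic_on_subset[OF proj_liftD(1)[OF v]] in auto)
qed

lemma fspeed_eq:
  assumes v: "proj_lift I S f v" and S: "open S" "z \<in> S"
  shows "fspeed I f z = speed I v z"
proof -
  obtain d where d: "d > 0" "ball z d \<subseteq> S" using openE[OF S] .
  then have "\<exists>v. \<exists>e>0. proj_lift I (ball z e) f v" using proj_lift_subset[OF v] by blast
  then have "\<exists>e>0. proj_lift I (ball z e) f (SOME v. \<exists>e>0. proj_lift I (ball z e) f v)"
    by (rule someI_ex)
  then obtain e where e: "e > 0" "proj_lift I (ball z e) f (SOME v. \<exists>e>0. proj_lift I (ball z e) f v)"
    by blast
  have "ball z (min d e) \<subseteq> S" "ball z (min d e) \<subseteq> ball z e" using d by auto
  then have "speed I (SOME v. \<exists>e>0. proj_lift I (ball z e) f v) z = speed I v z"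
    using e(1) d(1)
    by (intro speed_lift_unique[of I "ball z (min d e)" f] proj_lift_subset[OF v] proj_lift_subset[OF e(2)]) auto
  then show ?thesis by (simp add: fspeed_def)
qed

lemma fspeed_nonneg: "fspeed I f z \<ge> 0"
  unfolding fspeed_def by (rule speed_nonneg)

lemma fspeed_compose:
  assumes f: "proj_hol I S f" and \<phi>: "\<phi> holomorphic_on T" "\<phi> ` T \<subseteq> S" and T: "open T" "z \<in> T"
  shows "fspeed I (\<lambda>z. f (\<phi> z)) z = cmod (deriv \<phi> z) * fspeed I f (\<phi> z)"
proof -
  obtain e v where e: "e > 0" "ball (\<phi> z) e \<subseteq> S" "proj_lift I (ball (\<phi> z) e) f v"
    using proj_holE[OF f, of "\<phi> z"] \<phi>(2) T by blast
  define U where "U = T \<inter> \<phi> -` ball (\<phi> z) e"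
  have U: "open U" "z \<in> U" "U \<subseteq> T" "\<phi> ` U \<subseteq> ball (\<phi> z) e"
    using holomorphic_on_imp_continuous_on[OF \<phi>(1)] T continuous_open_preimage e(1)
    by (auto simp: U_def)
  have \<phi>U: "\<phi> holomorphic_on U" using \<phi>(1) U(3) by (rule holomorphic_on_subset)
  have l: "proj_lift I U (\<lambda>z. f (\<phi> z)) (\<lambda>z. v (\<phi> z))"
    by (rule proj_lift_compose[OF e(3) \<phi>U U(4)])
  have "wron (\<lambda>z. v (\<phi> z)) i j z = deriv \<phi> z * wron v i j (\<phi> z)" for i j
  proof -
    have "deriv (\<lambda>z. v (\<phi> z) i) z = deriv (\<lambda>x. v x i) (\<phi> z) * deriv \<phi> z" for i
    proof -
      have "deriv ((\<lambda>x. v x i) \<circ> \<phi>) z = deriv (\<lambda>x. v x i) (\<phi> z) * deriv \<phi> z"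
      proof (rule deriv_chain)
        show "\<phi> field_differentiable at z"
          using \<phi>U U holomorphic_on_imp_differentiable_at by blast
        show "(\<lambda>x. v x i) field_differentiable at (\<phi> z)"
          by (rule holomorphic_on_imp_differentiable_at[OF proj_liftD(1)[OF e(3)]]) (use e in auto)
      qed
      then show ?thesis by (simp add: o_def)
    qed
    then show ?thesis by (simp add: wron_def algebra_simps)
  qed
  then have "speed I (\<lambda>z. v (\<phi> z)) z = cmod (deriv \<phi> z) * speed I v (\<phi> z)"
    by (simp add: speed_def norm_mult sum_distrib_left)
  moreover have "fspeed I f (\<phi> z) = speed I v (\<phi> z)"
    by (rule fspeed_eq[OF e(3)]) (use e in auto)
  moreover have "fspeed I (\<lambda>z. f (\<phi> z)) z = speed I (\<lambda>z. v (\<phi> z)) z"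
    by (rule fspeed_eq[OF l U(1,2)])
  ultimately show ?thesis by simp
qed

lemma continuous_on_wron:
  assumes "open S" "\<And>i. (\<lambda>x. v x i) holomorphic_on S"
  shows "continuous_on S (wron v i j)"
  unfolding wron_def
  by (intro continuous_intros holomorphic_on_imp_continuous_on holomorphic_deriv assms)

lemma continuous_on_speed:
  assumes "proj_lift I S f v" "open S" "finite I"
  shows "continuous_on S (speed I v)"
  unfolding speed_def nsq_def
proof (intro continuous_intros continuous_on_wron holomorphic_on_imp_continuous_on ballI)
  fix z assume "z \<in> S"
  then show "(\<Sum>i\<in>I. (cmod (v z i))\<^sup>2) \<noteq> 0"
    using nsq_pos[OF assms(3) proj_liftD(2)[OF assms(1)]] by (force simp: nsq_def)
qed (use assms proj_liftD(1) in auto)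

lemma continuous_on_fspeed:
  assumes f: "proj_hol I S f" and I: "finite I"
  shows "continuous_on S (fspeed I f)"
proof -
  have "isCont (fspeed I f) z" if z: "z \<in> S" for z
  proof -
    obtain e v where e: "e > 0" "ball z e \<subseteq> S" "proj_lift I (ball z e) f v"
      using proj_holE[OF f z] .
    have "continuous_on (ball z e) (speed I v)" using continuous_on_speed[OF e(3) _ I] by auto
    then have "continuous_on (ball z e) (fspeed I f)"
      by (rule continuous_on_eq) (simp add: fspeed_eq[OF e(3)])
    then show ?thesis using e(1) by (simp add: continuous_on_eq_continuous_at)
  qed
  then show ?thesis by (simp add: continuous_at_imp_continuous_on)
qed

text \<open>The entries of the orthogonal projection onto the line \<open>p\<close>: bounded functions separating points,
  whose derivative along a curve is at most twice its speed.\<close>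

definition psi :: "'i set \<Rightarrow> 'i \<Rightarrow> 'i \<Rightarrow> ('i \<Rightarrow> complex) set \<Rightarrow> complex" where
  "psi I i j p = (let v = SOME v. v \<in> p in v i * cnj (v j) / of_real (nsq I v))"

lemma psi_proj_point: "psi I i j (proj_point v) = v i * cnj (v j) / of_real (nsq I v)"
proof -
  have "(SOME w. w \<in> proj_point v) \<in> proj_point v" using someI[of "\<lambda>w. w \<in> proj_point v" v] proj_point_self by blast
  then obtain c where c: "c \<noteq> 0" "(SOME w. w \<in> proj_point v) = (\<lambda>i. c * v i)"
    by (auto simp: proj_point_def)
  have "of_real (nsq I (\<lambda>i. c * v i)) = (c * cnj c) * of_real (nsq I v)"
    unfolding nsq_scale of_real_mult complex_norm_square ..
  then have "c * v i * cnj (c * v j) / of_real (nsq I (\<lambda>i. c * v i)) =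
    (c * cnj c) * (v i * cnj (v j)) / ((c * cnj c) * of_real (nsq I v))"
    by (simp add: mult_ac)
  also have "\<dots> = v i * cnj (v j) / of_real (nsq I v)"
    using c by (subst mult_divide_mult_cancel_left) auto
  finally show ?thesis by (simp add: psi_def c(2) Let_def)
qed

lemma psi_lift: "proj_lift I S f v \<Longrightarrow> z \<in> S \<Longrightarrow>
    psi I i j (f z) = v z i * cnj (v z j) / of_real (nsq I (v z))"
  by (simp add: proj_liftD(3) psi_proj_point)

lemma norm_psi_le:
  assumes "finite I" "i \<in> I" "j \<in> I" "p \<in> proj_space I"
  shows "norm (psi I i j p) \<le> 1"
proof -
  obtain v where v: "v \<in> nonzero_vecs I" "p = proj_point v" using assms(4) by (rule proj_spaceE)
  have "(cmod (v i) * cmod (v j))\<^sup>2 \<le> (nsq I v)\<^sup>2"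
    unfolding power_mult_distrib power2_eq_square[of "nsq I v"]
    by (intro mult_mono norm_le_nsq assms nsq_nonneg) auto
  then have "cmod (v i) * cmod (v j) \<le> nsq I v"
    by (rule power2_le_imp_le) (rule nsq_nonneg)
  then show ?thesis using nsq_pos[OF assms(1) v(1)]
    by (simp add: v(2) psi_proj_point norm_divide norm_mult divide_simps)
qed

text \<open>The trace of an orthogonal projection onto a line is 1, so one diagonal entry is at
  least the average. It singles out a chart that survives passage to a limit.\<close>

lemma ex_large_psi:
  assumes "finite I" "p \<in> proj_space I"
  obtains i where "i \<in> I" "norm (psi I i i p) \<ge> 1 / real (card I)"
proof -
  obtain v where v: "v \<in> nonzero_vecs I" "p = proj_point v" using assms(2) by (rule proj_spaceE)
  have ne: "I \<noteq> {}" using v(1) by (auto elim: nonzero_vecsE)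
  have pos: "nsq I v > 0" using nsq_pos[OF assms(1) v(1)] .
  have eq: "norm (psi I i i p) = (cmod (v i))\<^sup>2 / nsq I v" for i
    using pos by (simp add: v(2) psi_proj_point norm_divide norm_mult power2_eq_square)
  have "(\<Sum>i\<in>I. norm (psi I i i p)) = 1"
    using pos by (simp add: eq sum_divide_distrib[symmetric] nsq_def)
  moreover have "(\<Sum>i\<in>I. norm (psi I i i p)) < (\<Sum>i\<in>I. 1 / real (card I))"
    if "\<And>i. i \<in> I \<Longrightarrow> norm (psi I i i p) < 1 / real (card I)"
    using that ne assms(1) by (intro sum_strict_mono) auto
  ultimately show ?thesis using that ne assms(1) by force
qed

text \<open>A nonzero column of the projection matrix spans the line.\<close>

lemma psi_inj:
  assumes "p \<in> proj_space I" "q \<in> proj_space I" "finite I"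
    and eq: "\<And>i j. i \<in> I \<Longrightarrow> j \<in> I \<Longrightarrow> psi I i j p = psi I i j q"
  shows "p = q"
proof -
  obtain v where v: "v \<in> nonzero_vecs I" "p = proj_point v" using assms(1) by (rule proj_spaceE)
  obtain w where w: "w \<in> nonzero_vecs I" "q = proj_point w" using assms(2) by (rule proj_spaceE)
  obtain j where j: "j \<in> I" "v j \<noteq> 0" using v(1) by (elim nonzero_vecsE)
  define a where "a = cnj (v j) / of_real (nsq I v)"
  define b where "b = cnj (w j) / of_real (nsq I w)"
  have ab: "a * v i = b * w i" if "i \<in> I" for i
    using eq[OF that j(1)] by (simp add: v(2) w(2) psi_proj_point a_def b_def mult.commute)
  have a: "a \<noteq> 0" using j nsq_pos[OF assms(3) v(1)] by (simp add: a_def)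
  then have b: "b \<noteq> 0" using ab[OF j(1)] j by auto
  have "(\<lambda>i. a * v i) = (\<lambda>i. b * w i)"
  proof
    fix i show "a * v i = b * w i"
      using ab v(1) w(1) by (cases "i \<in> I") (auto simp: nonzero_vecs_def)
  qed
  then show ?thesis
    using proj_point_scale[OF a, of v] proj_point_scale[OF b, of w] v w by simp
qed

lemma continuous_map_psi:
  assumes "finite I"
  shows "continuous_map (proj_topology I) euclidean (psi I i j)"
proof -
  have "continuous_on (nonzero_vecs I) (\<lambda>v. v i * cnj (v j) / of_real (nsq I v))"
    unfolding nsq_def
  proof (intro continuous_intros continuous_on_product_then_coordinatewise[OF continuous_on_id] ballI)
    fix v assume "v \<in> nonzero_vecs I"
    then show "complex_of_real (\<Sum>i\<in>I. (cmod (v i))\<^sup>2) \<noteq> 0"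
      using nsq_pos[OF assms] unfolding nsq_def by (metis less_irrefl of_real_eq_0_iff)
  qed
  then have "continuous_on (nonzero_vecs I) (psi I i j \<circ> proj_point)"
    by (simp add: o_def psi_proj_point)
  then show ?thesis
    by (intro continuous_compose_quotient_map[OF quotient_map_proj_point]) simp
qed

lemma psi_derivative:
  assumes f: "proj_hol I S f" and z: "z \<in> S" and I: "finite I" "i \<in> I" "j \<in> I"
  shows "\<exists>D. ((\<lambda>x. psi I i j (f x)) has_derivative D) (at z) \<and>
    (\<forall>h. norm (D h) \<le> 2 * fspeed I f z * norm h)"
proof -
  obtain e v where e: "e > 0" "ball z e \<subseteq> S" "proj_lift I (ball z e) f v"
    using proj_holE[OF f z] .
  define d where "d = (\<lambda>i. deriv (\<lambda>x. v x i) z)"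
  define N where "N = nsq I (v z)"
  have Npos: "N > 0" unfolding N_def using e by (intro nsq_pos I proj_liftD(2)[OF e(3)]) auto
  have NS: "complex_of_real (nsq I u) = (\<Sum>k\<in>I. u k * cnj (u k))" for u
    unfolding nsq_def of_real_sum complex_norm_square ..
  have dv: "((\<lambda>x. v x k) has_derivative (\<lambda>h. h * d k)) (at z)" for k
  proof -
    have "(\<lambda>x. v x k) field_differentiable at z"
      by (rule holomorphic_on_imp_differentiable_at[OF proj_liftD(1)[OF e(3)]]) (use e in auto)
    then have "((\<lambda>x. v x k) has_field_derivative d k) (at z)"
      by (simp add: d_def field_differentiable_derivI)
    then show ?thesis by (simp add: has_field_derivative_def mult_commute_abs)
  qed
  note dc = bounded_linear.has_derivative[OF bounded_linear_cnj dv]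
  define A where "A = (\<lambda>h. v z i * cnj (h * d j) + h * d i * cnj (v z j))"
  define B where "B = (\<lambda>h. \<Sum>k\<in>I. v z k * cnj (h * d k) + h * d k * cnj (v z k))"
  define D where "D = (\<lambda>h. (A h * N - (v z i * cnj (v z j)) * B h) / (complex_of_real N * N))"
  have "((\<lambda>x. v x i * cnj (v x j) / (\<Sum>k\<in>I. v x k * cnj (v x k))) has_derivative D) (at z)"
    unfolding D_def A_def B_def N_def NS
    by (rule has_derivative_divide' has_derivative_mult has_derivative_sum dv dc)+
      (use Npos NS[of "v z"] in \<open>auto simp: N_def\<close>)
  then have hd: "((\<lambda>x. psi I i j (f x)) has_derivative D) (at z)"
    by (rule has_derivative_transform_within_open[of _ _ _ _ "ball z e"])
      (use e in \<open>auto simp: psi_lift[OF e(3)] NS\<close>)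
  define W where "W = (\<Sum>i\<in>I. \<Sum>j\<in>I. cmod (wron v i j z))"
  have sp: "fspeed I f z = W / N"
    using fspeed_eq[OF e(3), of z] e(1) by (simp add: speed_def W_def N_def)
  have W1: "(\<Sum>k\<in>I. cmod (wron v k l z)) \<le> W" if "l \<in> I" for l
    unfolding W_def by (intro sum_mono member_le_sum) (use that I in auto)
  have le: "cmod (v z a) * cmod (v z b) \<le> N" if "a \<in> I" "b \<in> I" for a b
  proof (rule power2_le_imp_le)
    have "(cmod (v z a))\<^sup>2 * (cmod (v z b))\<^sup>2 \<le> N * N"
      unfolding N_def by (intro mult_mono norm_le_nsq that I nsq_nonneg) auto
    then show "(cmod (v z a) * cmod (v z b))\<^sup>2 \<le> N\<^sup>2"
      unfolding power_mult_distrib power2_eq_square[of N] .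
  qed (use Npos in simp)
  \<comment> \<open>Summand by summand, the numerator of the quotient rule combines into Wronskians:
    the holomorphic and the antiholomorphic derivative contribute one each, which is the origin of
    the factor 2.\<close>
  have num: "A h * N - (v z i * cnj (v z j)) * B h =
     (\<Sum>k\<in>I. h * cnj (v z j) * cnj (v z k) * wron v k i z + cnj h * v z i * v z k * cnj (wron v k j z))" for h
    unfolding A_def B_def N_def NS sum_distrib_left sum_subtractf[symmetric]
    by (rule sum.cong) (auto simp: wron_def d_def algebra_simps)
  have "norm (D h) \<le> 2 * fspeed I f z * norm h" for h :: complex
  proof -
    have "norm (A h * N - (v z i * cnj (v z j)) * B h) \<le>
       (\<Sum>k\<in>I. norm h * N * cmod (wron v k i z) + norm h * N * cmod (wron v k j z))"
      unfolding num
    proof (intro sum_norm_le)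
      fix k assume k: "k \<in> I"
      have "norm (h * cnj (v z j) * cnj (v z k) * wron v k i z) \<le> norm h * N * cmod (wron v k i z)"
        using mult_left_mono[OF le[OF I(3) k], of "cmod h"]
        by (simp add: norm_mult mult.assoc[symmetric] mult_right_mono)
      moreover have "norm (cnj h * v z i * v z k * cnj (wron v k j z)) \<le> norm h * N * cmod (wron v k j z)"
        using mult_left_mono[OF le[OF I(2) k], of "cmod h"]
        by (simp add: norm_mult mult.assoc[symmetric] mult_right_mono)
      ultimately show "norm (h * cnj (v z j) * cnj (v z k) * wron v k i z + cnj h * v z i * v z k * cnj (wron v k j z))
         \<le> norm h * N * cmod (wron v k i z) + norm h * N * cmod (wron v k j z)"
        by (rule norm_triangle_mono)
    qed
    also have "\<dots> = norm h * N * ((\<Sum>k\<in>I. cmod (wron v k i z)) + (\<Sum>k\<in>I. cmod (wron v k j z)))"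
      by (simp add: sum.distrib sum_distrib_left algebra_simps)
    also have "\<dots> \<le> norm h * N * (W + W)"
      using W1 I Npos by (intro mult_left_mono add_mono) auto
    finally have "norm (A h * N - (v z i * cnj (v z j)) * B h) / (N * N) \<le> norm h * N * (W + W) / (N * N)"
      by (rule divide_right_mono) (use Npos in simp)
    then have "norm (D h) \<le> norm h * N * (W + W) / (N * N)"
      unfolding D_def norm_divide norm_mult norm_of_real using Npos by simp
    also have "\<dots> = 2 * fspeed I f z * norm h"
      using Npos by (simp add: sp field_simps)
    finally show ?thesis .
  qed
  with hd show ?thesis by blast
qed

lemma psi_lipschitz:
  assumes f: "proj_hol I S f" and S: "convex S" and B: "\<And>z. z \<in> S \<Longrightarrow> fspeed I f z \<le> B"
    and I: "finite I" "i \<in> I" "j \<in> I" and xy: "x \<in> S" "y \<in> S"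
  shows "norm (psi I i j (f x) - psi I i j (f y)) \<le> 2 * B * norm (x - y)"
proof -
  obtain D where D: "\<And>z. z \<in> S \<Longrightarrow> ((\<lambda>x. psi I i j (f x)) has_derivative D z) (at z)"
    "\<And>z h. z \<in> S \<Longrightarrow> norm (D z h) \<le> 2 * fspeed I f z * norm h"
    using psi_derivative[OF f _ I] by metis
  show ?thesis
  proof (rule differentiable_bound[OF S _ _ xy])
    show "((\<lambda>x. psi I i j (f x)) has_derivative D z) (at z within S)" if "z \<in> S" for z
      using D(1)[OF that] by (rule has_derivative_at_withinI)
    show "onorm (D z) \<le> 2 * B" if "z \<in> S" for z
    proof (rule onorm_le)
      fix h :: complex
      have "2 * fspeed I f z * norm h \<le> 2 * B * norm h"
        using B[OF that] by (intro mult_right_mono) auto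
      with D(2)[OF that, of h] show "norm (D z h) \<le> 2 * B * norm h" by linarith
    qed
  qed
qed

text \<open>For every local lift \<open>v\<close> the quotient equals \<open>v z k / v z i\<close>,
  as the non-holomorphic factors cancel. So a lift on all of \<open>S\<close> is computed from the
  projection entries alone, and convergence of these entries becomes convergence of lifts.\<close>

lemma proj_lift_psi:
  assumes f: "proj_hol I S f" and I: "finite I"
    and nz: "\<And>z. z \<in> S \<Longrightarrow> psi I i i (f z) \<noteq> 0"
  shows "proj_lift I S f (\<lambda>z k. psi I k i (f z) / psi I i i (f z))"
proof -
  have *: "\<exists>e>0. ball z e \<subseteq> S \<and> proj_lift I (ball z e) f (\<lambda>z k. psi I k i (f z) / psi I i i (f z))"
    if z: "z \<in> S" for z
  proof -
    obtain e v where e: "e > 0" "ball z e \<subseteq> S" "proj_lift I (ball z e) f v"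
      using proj_holE[OF f z] .
    have vi: "v x i \<noteq> 0" if "x \<in> ball z e" for x
      using nz[of x] that e(2) by (auto simp: psi_lift[OF e(3)])
    have eq: "(\<lambda>k. psi I k i (f x) / psi I i i (f x)) = (\<lambda>k. (1 / v x i) * v x k)" if "x \<in> ball z e" for x
      using that vi[OF that] nsq_pos[OF I proj_liftD(2)[OF e(3) that]]
      by (auto simp: psi_lift[OF e(3)] fun_eq_iff)
    have "proj_lift I (ball z e) f (\<lambda>z k. psi I k i (f z) / psi I i i (f z))"
      unfolding proj_lift_def
    proof (intro conjI allI ballI)
      fix k
      have "(\<lambda>x. (1 / v x i) * v x k) holomorphic_on ball z e"
        using vi by (intro holomorphic_intros proj_liftD(1)[OF e(3)]) auto
      then show "(\<lambda>x. psi I k i (f x) / psi I i i (f x)) holomorphic_on ball z e"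
        by (rule holomorphic_transform) (use eq in \<open>simp add: fun_eq_iff\<close>)
    next
      fix x assume x: "x \<in> ball z e"
      show "(\<lambda>k. psi I k i (f x) / psi I i i (f x)) \<in> nonzero_vecs I"
        unfolding eq[OF x] using vi[OF x] by (intro nonzero_vecs_scale proj_liftD(2)[OF e(3) x]) auto
      show "f x = proj_point (\<lambda>k. psi I k i (f x) / psi I i i (f x))"
        unfolding eq[OF x] using vi[OF x] by (subst proj_point_scale) (auto simp: proj_liftD(3)[OF e(3) x])
    qed
    then show ?thesis using e by blast
  qed
  show ?thesis unfolding proj_lift_def
  proof (intro conjI allI ballI)
    fix k
    show "(\<lambda>x. psi I k i (f x) / psi I i i (f x)) holomorphic_on S"
      unfolding holomorphic_on_open[OF proj_hol_open[OF f]] field_differentiable_def[symmetric]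
    proof
      fix z assume "z \<in> S"
      then obtain e where "e > 0" "proj_lift I (ball z e) f (\<lambda>z k. psi I k i (f z) / psi I i i (f z))"
        using * by blast
      then show "(\<lambda>x. psi I k i (f x) / psi I i i (f x)) field_differentiable at z"
        by (intro holomorphic_on_imp_differentiable_at[OF proj_liftD(1), of I "ball z e" f]) auto
    qed
  next
    fix z assume "z \<in> S"
    then obtain e where e: "e > 0" "proj_lift I (ball z e) f (\<lambda>z k. psi I k i (f z) / psi I i i (f z))"
      using * by blast
    show "(\<lambda>k. psi I k i (f z) / psi I i i (f z)) \<in> nonzero_vecs I"
      using proj_liftD(2)[OF e(2), of z] e(1) by simp
    show "f z = proj_point (\<lambda>k. psi I k i (f z) / psi I i i (f z))"
      using proj_liftD(3)[OF e(2), of z] e(1) by simp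
  qed
qed

lemma fspeed_zero_imp_constant:
  assumes f: "proj_hol I UNIV f" and z: "\<And>z. fspeed I f z = 0" and I: "finite I"
  shows "f constant_on UNIV"
proof -
  have "f x = f 0" for x
  proof (rule psi_inj[OF proj_hol_in_space[OF f] proj_hol_in_space[OF f] I])
    fix i j assume "i \<in> I" "j \<in> I"
    then show "psi I i j (f x) = psi I i j (f 0)"
      using psi_lipschitz[OF f convex_UNIV, of 0 i j x 0] z I by simp
  qed auto
  then show ?thesis by (auto simp: constant_on_def)
qed

section \<open>Brody's lemma\<close>

lemma proj_hol_affine:
  assumes f: "proj_hol I S f" and T: "open T" "\<And>z. z \<in> T \<Longrightarrow> a + of_real r * z \<in> S"
  shows "proj_hol I T (\<lambda>z. f (a + of_real r * z))"
  by (rule proj_hol_compose[OF f _ _ T(1)]) (use T(2) in \<open>auto intro!: holomorphic_intros\<close>)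

lemma fspeed_affine:
  assumes f: "proj_hol I S f" and T: "open T" "\<And>z. z \<in> T \<Longrightarrow> a + of_real r * z \<in> S"
    and z: "z \<in> T" and r: "r \<ge> 0"
  shows "fspeed I (\<lambda>z. f (a + of_real r * z)) z = r * fspeed I f (a + of_real r * z)"
proof -
  have "((\<lambda>z. a + of_real r * z) has_field_derivative of_real r) (at z)"
    by (auto intro!: derivative_eq_intros)
  then have "deriv (\<lambda>z. a + of_real r * z) z = of_real r" by (rule DERIV_imp_deriv)
  moreover have "fspeed I (\<lambda>z. f (a + of_real r * z)) z =
     cmod (deriv (\<lambda>z. a + of_real r * z) z) * fspeed I f (a + of_real r * z)"
    by (rule fspeed_compose[OF f _ _ T(1) z]) (use T(2) in \<open>auto intro!: holomorphic_intros\<close>)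
  ultimately show ?thesis using r by simp
qed

text \<open>Brody's reparametrisation: maximise \<open>(1/2 - \<bar>z\<bar>) * speed\<close> over a smaller disc.\<close>

lemma brody_reparametrisation:
  assumes f: "proj_hol I (ball 0 1) f" and I: "finite I" and M: "M > 0" "fspeed I f 0 \<ge> M"
  obtains a r where "r > 0" "\<And>z. z \<in> ball 0 (M / 4) \<Longrightarrow> a + of_real r * z \<in> ball 0 1"
    "fspeed I (\<lambda>z. f (a + of_real r * z)) 0 = 1"
    "\<And>z. z \<in> ball 0 (M / 4) \<Longrightarrow> fspeed I (\<lambda>z. f (a + of_real r * z)) z \<le> 2"
proof -
  let ?g = "\<lambda>z. (1/2 - norm z) * fspeed I f z"
  have "continuous_on (cball 0 (1/2)) (fspeed I f)"
    by (rule continuous_on_subset[OF continuous_on_fspeed[OF f I]]) auto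
  then have "continuous_on (cball 0 (1/2)) ?g" by (intro continuous_intros)
  then obtain a where a: "a \<in> cball 0 (1/2)" "\<And>z. z \<in> cball 0 (1/2) \<Longrightarrow> ?g z \<le> ?g a"
    using continuous_attains_sup[of "cball 0 (1/2)" ?g] by auto
  define s where "s = fspeed I f a"
  define \<rho> where "\<rho> = 1/2 - norm a"
  have "M / 2 \<le> ?g 0" using M by simp
  also have "\<dots> \<le> \<rho> * s" using a(2)[of 0] by (simp add: \<rho>_def s_def)
  finally have rs: "M / 2 \<le> \<rho> * s" .
  have \<rho>0: "\<rho> \<ge> 0" using a(1) by (simp add: \<rho>_def)
  have s0: "s \<ge> 0" unfolding s_def by (rule fspeed_nonneg)
  have "\<rho> * s > 0" using rs M by linarith
  then have pos: "\<rho> > 0" "s > 0" using \<rho>0 s0 by (auto simp: zero_less_mult_iff)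
  define r where "r = 1 / s"
  have r: "r > 0" using pos by (simp add: r_def)
  \<comment> \<open>As \<open>M / 2 \<le> \<rho> * s\<close>, a displacement of at most
    \<open>r * (M / 4)\<close> uses up at most half of the distance \<rho> to the circle of radius
    1/2. The weight is then at least \<rho>/2, so the speed is at most twice its value at
    \<open>a\<close>.\<close>
  have near: "norm (a + of_real r * z) \<le> 1/2 - \<rho> / 2" if "z \<in> ball 0 (M / 4)" for z
  proof -
    have "norm (of_real r * z) \<le> r * (M / 4)" using that r by (simp add: norm_mult)
    also have "\<dots> \<le> \<rho> / 2" using rs pos by (simp add: r_def field_simps)
    finally have "norm (of_real r * z) \<le> \<rho> / 2" .
    then show ?thesis using norm_triangle_ineq[of a "of_real r * z"] by (simp add: \<rho>_def field_simps)
  qed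
  have in1: "a + of_real r * z \<in> ball 0 1" if "z \<in> ball 0 (M / 4)" for z
    using near[OF that] pos by simp
  have sp: "fspeed I (\<lambda>z. f (a + of_real r * z)) z = r * fspeed I f (a + of_real r * z)"
    if "z \<in> ball 0 (M / 4)" for z
    by (rule fspeed_affine[OF f _ _ that]) (use in1 r in auto)
  show ?thesis
  proof (rule that[OF r in1])
    show "fspeed I (\<lambda>z. f (a + of_real r * z)) 0 = 1"
      using sp[of 0] M pos by (simp add: s_def r_def)
    fix z :: complex assume z: "z \<in> ball 0 (M / 4)"
    let ?w = "a + of_real r * z"
    have "(\<rho> / 2) * fspeed I f ?w \<le> (1/2 - norm ?w) * fspeed I f ?w"
      using near[OF z] by (intro mult_right_mono fspeed_nonneg) auto
    also have "\<dots> \<le> \<rho> * s"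
      using a(2)[of ?w] near[OF z] pos by (simp add: \<rho>_def s_def)
    finally have "fspeed I f ?w \<le> 2 * s" using pos by simp
    then have "r * fspeed I f ?w \<le> r * (2 * s)" using r by (intro mult_left_mono) auto
    then show "fspeed I (\<lambda>z. f (a + of_real r * z)) z \<le> 2"
      using sp[OF z] pos by (simp add: r_def)
  qed
qed

text \<open>The Arzela-Ascoli argument: finitely many points of \<open>D\<close> form an \<eta>-net
  for \<open>K\<close>, and two Lipschitz estimates of size \<open>e / 4\<close> transport the
  Cauchy property from the net. The Lipschitz bound is required only from index \<open>N\<close> on
  because in the application the domains grow.\<close>

lemma equilipschitz_uniformly_convergent:
  fixes F :: "nat \<Rightarrow> 'a::metric_space \<Rightarrow> 'b::complete_space"
  assumes K: "compact K" and L: "L > 0" and U: "open U" "K \<subseteq> U"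
    and lip: "\<And>n x y. n \<ge> N \<Longrightarrow> x \<in> U \<Longrightarrow> y \<in> U \<Longrightarrow> dist (F n x) (F n y) \<le> L * dist x y"
    and D: "\<And>X. open X \<Longrightarrow> X \<noteq> {} \<Longrightarrow> \<exists>d\<in>D. d \<in> X"
    and conv: "\<And>d. d \<in> D \<Longrightarrow> convergent (\<lambda>n. F n d)"
  shows "uniformly_convergent_on K F"
proof (rule Cauchy_uniformly_convergent, rule uniformly_Cauchy_onI)
  fix e :: real assume e: "e > 0"
  define \<eta> where "\<eta> = e / (4 * L)"
  have \<eta>: "\<eta> > 0" using e L by (simp add: \<eta>_def)
  have "K \<subseteq> (\<Union>d\<in>D \<inter> U. ball d \<eta>)"
  proof
    fix x assume "x \<in> K"
    then have "open (U \<inter> ball x \<eta>)" "x \<in> U \<inter> ball x \<eta>" using U \<eta> by auto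
    then obtain d where "d \<in> D" "d \<in> U \<inter> ball x \<eta>" using D by blast
    then show "x \<in> (\<Union>d\<in>D \<inter> U. ball d \<eta>)" by (auto simp: dist_commute)
  qed
  then obtain D' where D': "D' \<subseteq> D \<inter> U" "finite D'" "K \<subseteq> (\<Union>d\<in>D'. ball d \<eta>)"
    using compactE_image[OF K, of "D \<inter> U" "\<lambda>d. ball d \<eta>"] by auto
  have "\<forall>d\<in>D'. \<exists>M. \<forall>m\<ge>M. \<forall>n\<ge>M. dist (F m d) (F n d) < e / 4"
  proof
    fix d assume "d \<in> D'"
    then have "Cauchy (\<lambda>n. F n d)" using conv D'(1) convergent_Cauchy by blast
    then show "\<exists>M. \<forall>m\<ge>M. \<forall>n\<ge>M. dist (F m d) (F n d) < e / 4"
      using e metric_CauchyD[of "\<lambda>n. F n d" "e / 4"] by simp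
  qed
  then obtain M where M: "\<And>d m n. d \<in> D' \<Longrightarrow> m \<ge> M d \<Longrightarrow> n \<ge> M d \<Longrightarrow> dist (F m d) (F n d) < e / 4"
    by metis
  define M' where "M' = Max (insert N (M ` D'))"
  have M': "M' \<ge> N" "\<And>d. d \<in> D' \<Longrightarrow> M' \<ge> M d" using D'(2) by (auto simp: M'_def)
  show "\<exists>M. \<forall>x\<in>K. \<forall>m\<ge>M. \<forall>n\<ge>M. dist (F m x) (F n x) < e"
  proof (intro exI[of _ M'] ballI allI impI)
    fix x m n assume x: "x \<in> K" and mn: "m \<ge> M'" "n \<ge> M'"
    obtain d where d: "d \<in> D'" "x \<in> ball d \<eta>" using D'(3) x by blast
    have "dist (F k x) (F k d) \<le> e / 4" if "k \<ge> M'" for k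
    proof -
      have "dist (F k x) (F k d) \<le> L * dist x d"
        using that M'(1) x U D'(1) d by (intro lip) auto
      also have "\<dots> \<le> L * \<eta>" using d L by (intro mult_left_mono) (auto simp: dist_commute)
      also have "\<dots> = e / 4" using L by (simp add: \<eta>_def)
      finally show ?thesis .
    qed
    from this[OF mn(1)] this[OF mn(2)] show "dist (F m x) (F n x) < e"
      using M[OF d(1), of m n] M'(2)[OF d(1)] mn e
        dist_triangle[of "F m x" "F n x" "F m d"] dist_triangle[of "F m d" "F n x" "F n d"]
      by (simp add: dist_commute)
  qed
qed

text \<open>Convergence is expressed through lifts because derivatives, forms and Hurwitz' theorem
  apply to these.\<close>

definition lifts_converge ::
  "'i set \<Rightarrow> complex set \<Rightarrow> (nat \<Rightarrow> complex \<Rightarrow> ('i \<Rightarrow> complex) set) \<Rightarrow> (complex \<Rightarrow> ('i \<Rightarrow> complex) set) \<Rightarrow>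
   (nat \<Rightarrow> complex \<Rightarrow> 'i \<Rightarrow> complex) \<Rightarrow> (complex \<Rightarrow> 'i \<Rightarrow> complex) \<Rightarrow> bool" where
  "lifts_converge I S h g w v \<longleftrightarrow> proj_lift I S g v \<and> (\<forall>\<^sub>F n in sequentially. proj_lift I S (h n) (w n)) \<and>
     (\<forall>i. uniform_limit S (\<lambda>n x. w n x i) (\<lambda>x. v x i) sequentially)"

lemma holomorphic_on_uniform_limit:
  assumes S: "open S" and u: "uniform_limit S f g sequentially"
    and h: "\<forall>\<^sub>F n in sequentially. f n holomorphic_on S"
  shows "g holomorphic_on S"
proof -
  obtain N where N: "\<And>n. n \<ge> N \<Longrightarrow> f n holomorphic_on S"
    using h by (auto simp: eventually_sequentially)
  show ?thesis
  proof (rule holomorphic_uniform_sequence[OF S, of "\<lambda>n. f (n + N)"])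
    show "f (n + N) holomorphic_on S" for n using N by simp
    fix x assume "x \<in> S"
    then obtain d where d: "d > 0" "cball x d \<subseteq> S" using S open_contains_cball by blast
    have "uniform_limit S (\<lambda>n. f (n + N)) g sequentially"
      using filterlim_compose[OF u filterlim_add_const_nat_at_top] by (simp add: o_def)
    then show "\<exists>d>0. cball x d \<subseteq> S \<and> uniform_limit (cball x d) (\<lambda>n. f (n + N)) g sequentially"
      using d uniform_limit_on_subset by blast
  qed
qed

lemma fspeed_tendsto:
  assumes c: "lifts_converge I S h g w v" and S: "open S" "z \<in> S" and I: "finite I"
  shows "(\<lambda>n. fspeed I (h n) z) \<longlonglongrightarrow> fspeed I g z"
proof -
  have v: "proj_lift I S g v" and w: "\<forall>\<^sub>F n in sequentially. proj_lift I S (h n) (w n)"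
    and u: "\<And>i. uniform_limit S (\<lambda>n x. w n x i) (\<lambda>x. v x i) sequentially"
    using c by (auto simp: lifts_converge_def)
  have p: "(\<lambda>n. w n z i) \<longlonglongrightarrow> v z i" for i
    using tendsto_uniform_limitI[OF u S(2)] .
  have d: "(\<lambda>n. deriv (\<lambda>x. w n x i) z) \<longlonglongrightarrow> deriv (\<lambda>x. v x i) z" for i
  proof (rule deriv_complex_uniform_limit[OF u _ _ S])
    show "\<forall>\<^sub>F n in sequentially. (\<lambda>x. w n x i) holomorphic_on S"
      using w by eventually_elim (rule proj_liftD(1))
  qed auto
  have "nsq I (v z) \<noteq> 0" using nsq_pos[OF I proj_liftD(2)[OF v S(2)]] by simp
  then have "(\<lambda>n. speed I (w n) z) \<longlonglongrightarrow> speed I v z"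
    unfolding speed_def wron_def nsq_def by (intro tendsto_intros p d) auto
  then have "(\<lambda>n. speed I (w n) z) \<longlonglongrightarrow> fspeed I g z"
    using fspeed_eq[OF v S] by simp
  moreover have "\<forall>\<^sub>F n in sequentially. speed I (w n) z = fspeed I (h n) z"
    using w by eventually_elim (simp add: fspeed_eq[OF _ S])
  ultimately show ?thesis by (rule Lim_transform_eventually)
qed

text \<open>The projection entries are bounded by 1 and, at speed at most 2, 4-Lipschitz. A diagonal
  subsequence converges on a countable dense set, hence locally uniformly, and quotients of entries
  turn this into convergence of holomorphic lifts.\<close>

lemma brody_limit:
  assumes hol: "\<And>n. proj_hol I (ball 0 (real n)) (h n)"
    and sp: "\<And>n z. z \<in> ball 0 (real n) \<Longrightarrow> fspeed I (h n) z \<le> 2" and I: "finite I"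
  obtains g k where "strict_mono (k :: nat \<Rightarrow> nat)" "proj_hol I UNIV g"
    "\<And>z. \<exists>e>0. \<exists>w v. lifts_converge I (ball z e) (\<lambda>n. h (k n)) g w v"
proof -
  obtain D :: "complex set" where D: "countable D"
    "\<And>X. open X \<Longrightarrow> X \<noteq> {} \<Longrightarrow> \<exists>d\<in>D. d \<in> X"
    by (rule countable_dense_setE) blast
  \<comment> \<open>The value 0 outside the domain of \<open>h n\<close> makes every sequence
    defined from index 0, as the diagonal argument demands.\<close>
  define F where "F = (\<lambda>n (z, i, j). if norm z < real n then psi I i j (h n z) else 0)"
  have "countable (D \<times> I \<times> I)" by (intro countable_SIGMA D(1) countable_finite[OF I])
  moreover have "norm (F n x) \<le> 1" if "x \<in> D \<times> I \<times> I" for n x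
    using that norm_psi_le[OF I _ _ proj_hol_in_space[OF hol]] by (auto simp: F_def split: prod.splits)
  ultimately obtain k where k: "strict_mono (k :: nat \<Rightarrow> nat)"
    "\<And>x. x \<in> D \<times> I \<times> I \<Longrightarrow> \<exists>l. (\<lambda>n. F (k n) x) \<longlonglongrightarrow> l"
    by (rule function_convergent_subsequence[of "D \<times> I \<times> I" F 1]) (blast, rule that)
  have kn: "k n \<ge> n" for n using k(1) by (rule seq_suble)
  have lip: "dist (F (k n) (x, i, j)) (F (k n) (y, i, j)) \<le> 4 * dist x y"
    if "i \<in> I" "j \<in> I" "norm x < real n" "norm y < real n" for n x y i j
  proof -
    have "norm x < real (k n)" "norm y < real (k n)" using that kn[of n] by linarith+
    then show ?thesis
      using psi_lipschitz[OF hol[of "k n"] convex_ball sp[of _ "k n"] I that(1,2), where x = x and y = y]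
      by (simp add: F_def dist_norm)
  qed
  define \<Psi> where "\<Psi> = (\<lambda>z i j. lim (\<lambda>n. F (k n) (z, i, j)))"
  have ul: "uniform_limit (ball 0 R) (\<lambda>n z. F (k n) (z, i, j)) (\<lambda>z. \<Psi> z i j) sequentially"
    if ij: "i \<in> I" "j \<in> I" for R i j
  proof -
    have "uniformly_convergent_on (cball 0 R) (\<lambda>n z. F (k n) (z, i, j))"
    proof (rule equilipschitz_uniformly_convergent[where U = "ball 0 (R + 1)" and L = 4 and D = D and N = "nat \<lceil>R + 1\<rceil>"])
      fix n and x y :: complex assume "nat \<lceil>R + 1\<rceil> \<le> n" "x \<in> ball (0::complex) (R + 1)" "y \<in> ball 0 (R + 1)"
      moreover have "R + 1 \<le> real n"
        using real_nat_ceiling_ge[of "R + 1"] \<open>nat \<lceil>R + 1\<rceil> \<le> n\<close> by linarith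
      ultimately have "norm x < real n" "norm y < real n" by auto
      then show "dist (F (k n) (x, i, j)) (F (k n) (y, i, j)) \<le> 4 * dist x y"
        by (rule lip[OF ij])
    qed (use D(2) k(2) ij in \<open>auto simp: convergent_def\<close>)
    then have "uniform_limit (cball 0 R) (\<lambda>n z. F (k n) (z, i, j)) (\<lambda>z. \<Psi> z i j) sequentially"
      by (simp add: uniformly_convergent_uniform_limit_iff \<Psi>_def)
    then show ?thesis by (rule uniform_limit_on_subset) auto
  qed
  have F\<Psi>: "(\<lambda>n. F (k n) (z, i, j)) \<longlonglongrightarrow> \<Psi> z i j" if "i \<in> I" "j \<in> I" for z i j
    using tendsto_uniform_limitI[OF ul[OF that], of z "norm z + 1"] by simp
  have evin: "\<forall>\<^sub>F n in sequentially. R \<le> real (k n)" for R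
  proof -
    have "\<forall>\<^sub>F n in sequentially. R \<le> real n"
      using filterlim_real_sequentially by (simp add: filterlim_at_top)
    then show ?thesis
    proof eventually_elim
      case (elim n)
      then show ?case using kn[of n] by linarith
    qed
  qed
  define g where "g = (\<lambda>z. SOME p. p \<in> proj_space I \<and> (\<forall>i\<in>I. \<forall>j\<in>I. psi I i j p = \<Psi> z i j))"
  have loc: "\<exists>e>0. \<exists>w v. lifts_converge I (ball z e) (\<lambda>n. h (k n)) g w v" for z
  proof -
    define c where "c = 1 / real (card I)"
    obtain n0 where "norm z < real n0" using reals_Archimedean2 by blast
    then have "norm z < real (k n0)" using kn[of n0] by linarith
    then have "h (k n0) z \<in> proj_space I" using proj_hol_in_space[OF hol] by simp
    then have "I \<noteq> {}" by (auto elim!: proj_spaceE nonzero_vecsE)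
    then have c: "c > 0" "c \<le> 1" using I by (auto simp: c_def card_gt_0_iff Suc_le_eq)
    \<comment> \<open>Since \<open>I\<close> is finite, limits that are all below \<open>c\<close>
      would force all diagonal entries below \<open>c\<close> at some late index, against
      \<open>ex_large_psi\<close>.\<close>
    have "\<exists>i\<in>I. norm (\<Psi> z i i) \<ge> c"
    proof (rule ccontr)
      assume "\<not> ?thesis"
      then have lt: "norm (\<Psi> z i i) < c" if "i \<in> I" for i using that by force
      have "\<forall>\<^sub>F n in sequentially. \<forall>i\<in>I. norm (F (k n) (z, i, i)) < c"
        using I lt by (intro eventually_ball_finite ballI order_tendstoD(2)[OF tendsto_norm[OF F\<Psi>]]) auto
      with evin[of "norm z + 1"] have "\<forall>\<^sub>F n in sequentially. False"
      proof eventually_elim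
        case (elim n)
        then have "h (k n) z \<in> proj_space I" using proj_hol_in_space[OF hol] by simp
        then obtain i where "i \<in> I" "norm (psi I i i (h (k n) z)) \<ge> c"
          using ex_large_psi[OF I] unfolding c_def by metis
        then show False using elim by (force simp: F_def)
      qed
      then show False by simp
    qed
    then obtain i where i: "i \<in> I" "norm (\<Psi> z i i) \<ge> c" by blast
    \<comment> \<open>On a ball of radius \<open>c / 16\<close> a 4-Lipschitz entry moves by at most
      \<open>c / 4\<close>. Starting above \<open>3/4 * c\<close> at the centre it stays above
      \<open>c / 2\<close>, uniformly in the index, so the denominators of the lifts are bounded
      away from 0.\<close>
    define e where "e = c / 16"
    have e: "e > 0" "e < 1" using c by (auto simp: e_def)
    define w where "w = (\<lambda>n x l. psi I l i (h (k n) x) / psi I i i (h (k n) x))"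
    define v where "v = (\<lambda>x l. if l \<in> I then \<Psi> x l i / \<Psi> x i i else 0)"
    have "\<forall>\<^sub>F n in sequentially. norm (F (k n) (z, i, i)) > 3/4 * c"
      using i c by (intro order_tendstoD(1)[OF tendsto_norm[OF F\<Psi>]]) auto
    moreover have "\<forall>\<^sub>F n in sequentially. norm z + 1 \<le> real n"
      using filterlim_real_sequentially by (simp add: filterlim_at_top)
    ultimately have ev: "\<forall>\<^sub>F n in sequentially. \<forall>x\<in>ball z e. norm x < real (k n) \<and> norm (F (k n) (x, i, i)) \<ge> c / 2"
    proof eventually_elim
      case (elim n)
      show ?case
      proof
        fix x assume x: "x \<in> ball z e"
        have nx: "norm x < real n" using x e elim(2) norm_triangle_ineq2[of x z]
          by (simp add: dist_norm norm_minus_commute)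
        have "dist (F (k n) (x, i, i)) (F (k n) (z, i, i)) \<le> 4 * dist x z"
          using nx elim by (intro lip i) auto
        also have "\<dots> \<le> c / 4" using x by (simp add: e_def dist_commute)
        finally have "dist (F (k n) (x, i, i)) (F (k n) (z, i, i)) \<le> c / 4" .
        then have "norm (F (k n) (x, i, i)) \<ge> c / 2"
          using elim(1) norm_triangle_ineq2[of "F (k n) (z, i, i)" "F (k n) (x, i, i)"]
          by (simp add: dist_norm norm_minus_commute)
        then show "norm x < real (k n) \<and> norm (F (k n) (x, i, i)) \<ge> c / 2"
          using nx kn[of n] by linarith
      qed
    qed
    have \<Psi>ge: "norm (\<Psi> x i i) \<ge> c / 2" if "x \<in> ball z e" for x
    proof (rule tendsto_lowerbound[OF tendsto_norm[OF F\<Psi>[OF i(1) i(1)]]])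
      show "\<forall>\<^sub>F n in sequentially. c / 2 \<le> norm (F (k n) (x, i, i))"
        using ev by eventually_elim (use that in blast)
    qed auto
    have wl: "\<forall>\<^sub>F n in sequentially. proj_lift I (ball z e) (h (k n)) (w n)"
      using ev
    proof eventually_elim
      case (elim n)
      show ?case unfolding w_def
      proof (rule proj_lift_psi[OF proj_hol_subset[OF hol] I])
        show "ball z e \<subseteq> ball 0 (real (k n))" using elim by auto
        fix x assume "x \<in> ball z e"
        then have "norm x < real (k n)" "norm (F (k n) (x, i, i)) \<ge> c / 2" using elim by auto
        then show "psi I i i (h (k n) x) \<noteq> 0" using c by (auto simp: F_def)
      qed auto
    qed
    have sub: "ball z e \<subseteq> ball 0 (norm z + 1)"
    proof
      fix x assume "x \<in> ball z e"
      then show "x \<in> ball 0 (norm z + 1)"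
        using e norm_triangle_ineq2[of x z] by (simp add: dist_norm norm_minus_commute)
    qed
    have wu: "uniform_limit (ball z e) (\<lambda>n x. w n x l) (\<lambda>x. v x l) sequentially" for l
    proof (cases "l \<in> I")
      case True
      have \<Psi>le: "norm (\<Psi> x l i) \<le> 1" for x
      proof (rule tendsto_upperbound[OF tendsto_norm[OF F\<Psi>[OF True i(1)]]])
        show "\<forall>\<^sub>F n in sequentially. norm (F (k n) (x, l, i)) \<le> 1"
          using evin[of "norm x + 1"]
          by eventually_elim (use norm_psi_le[OF I True i(1) proj_hol_in_space[OF hol]] in \<open>simp add: F_def\<close>)
      qed auto
      have "uniform_limit (ball z e) (\<lambda>n x. F (k n) (x, l, i) / F (k n) (x, i, i)) (\<lambda>x. \<Psi> x l i / \<Psi> x i i) sequentially"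
      proof (rule uniform_lim_divide[where b = "c / 2"])
        show "bounded ((\<lambda>x. \<Psi> x l i) ` ball z e)" using \<Psi>le by (auto simp: bounded_iff)
      qed (use \<Psi>ge c in \<open>auto intro!: uniform_limit_on_subset[OF ul sub] True i\<close>)
      moreover have "\<forall>\<^sub>F n in sequentially. \<forall>x\<in>ball z e. F (k n) (x, l, i) / F (k n) (x, i, i) = w n x l"
        using ev by eventually_elim (auto simp: F_def w_def)
      from this have "uniform_limit (ball z e) (\<lambda>n x. F (k n) (x, l, i) / F (k n) (x, i, i)) (\<lambda>x. \<Psi> x l i / \<Psi> x i i) sequentially
        \<longleftrightarrow> ?thesis"
        by (rule uniform_limit_cong) (simp add: v_def True)
      ultimately show ?thesis by blast
    next
      case False
      have "\<forall>\<^sub>F n in sequentially. \<forall>x\<in>ball z e. w n x l = 0"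
        using wl
      proof eventually_elim
        case (elim n)
        then show ?case using False proj_liftD(2)[OF elim] by (auto simp: nonzero_vecs_def)
      qed
      then have "?thesis \<longleftrightarrow> uniform_limit (ball z e) (\<lambda>n x. 0) (\<lambda>x. 0 :: complex) sequentially"
        by (rule uniform_limit_cong) (simp add: v_def False)
      then show ?thesis by (simp add: uniform_limit_const)
    qed
    have vnz: "v x \<in> nonzero_vecs I" if "x \<in> ball z e" for x
    proof -
      have "v x i = 1" using \<Psi>ge[OF that] c i by (auto simp: v_def)
      moreover have "v x l = 0" if "l \<notin> I" for l using that by (simp add: v_def)
      ultimately show ?thesis by (auto simp: nonzero_vecs_def intro!: exI[of _ i])
    qed
    have gv: "g x = proj_point (v x)" if x: "x \<in> ball z e" for x
    proof -
      \<comment> \<open>The limits of the entries are again the entries of a line, namely the one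
        spanned by \<open>v x\<close>; so the choice in the definition of \<open>g\<close> has a
        witness.\<close>
      have ps: "psi I l j (proj_point (v x)) = \<Psi> x l j" if lj: "l \<in> I" "j \<in> I" for l j
      proof -
        have p: "(\<lambda>n. w n x i) \<longlonglongrightarrow> v x i" for i
          using tendsto_uniform_limitI[OF wu x] .
        have q: "(\<lambda>n. nsq I (w n x)) \<longlonglongrightarrow> nsq I (v x)"
          unfolding nsq_def by (intro tendsto_intros p)
        have "nsq I (v x) \<noteq> 0" using nsq_pos[OF I vnz[OF x]] by simp
        then have "(\<lambda>n. w n x l * cnj (w n x j) / of_real (nsq I (w n x))) \<longlonglongrightarrow> psi I l j (proj_point (v x))"
          unfolding psi_proj_point by (intro tendsto_intros p q) auto
        moreover have "\<forall>\<^sub>F n in sequentially. w n x l * cnj (w n x j) / of_real (nsq I (w n x)) = F (k n) (x, l, j)"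
          using wl ev
        proof eventually_elim
          case (elim n)
          then show ?case using x by (simp add: psi_lift[OF elim(1) x] F_def)
        qed
        ultimately have "(\<lambda>n. F (k n) (x, l, j)) \<longlonglongrightarrow> psi I l j (proj_point (v x))"
          by (rule Lim_transform_eventually)
        then show ?thesis using F\<Psi>[OF lj] LIMSEQ_unique by blast
      qed
      have pp: "proj_point (v x) \<in> proj_space I" using vnz[OF x] by (simp add: proj_space_def)
      have "\<exists>p. p \<in> proj_space I \<and> (\<forall>i\<in>I. \<forall>j\<in>I. psi I i j p = \<Psi> x i j)"
        using pp ps by blast
      then have "g x \<in> proj_space I \<and> (\<forall>i\<in>I. \<forall>j\<in>I. psi I i j (g x) = \<Psi> x i j)"
        unfolding g_def by (rule someI_ex)
      then show ?thesis using ps pp by (intro psi_inj[OF _ pp I]) auto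
    qed
    have "proj_lift I (ball z e) g v"
      unfolding proj_lift_def
    proof (intro conjI allI ballI)
      fix l show "(\<lambda>x. v x l) holomorphic_on ball z e"
      proof (rule holomorphic_on_uniform_limit[OF _ wu])
        show "\<forall>\<^sub>F n in sequentially. (\<lambda>x. w n x l) holomorphic_on ball z e"
          using wl by eventually_elim (rule proj_liftD(1))
      qed auto
    qed (use vnz gv in auto)
    with wl wu e show ?thesis unfolding lifts_converge_def by blast
  qed
  have "proj_hol I UNIV g"
    unfolding proj_hol_def using loc by (fastforce simp: lifts_converge_def)
  then show ?thesis using that k(1) loc by blast
qed

section \<open>Curves and families of hypersurfaces\<close>

text \<open>Boundedness of the limit is what makes uniform convergence stable under products, and
  therefore under evaluation of forms.\<close>

definition bdd_uniform_limit :: "'a set \<Rightarrow> (nat \<Rightarrow> 'a \<Rightarrow> complex) \<Rightarrow> ('a \<Rightarrow> complex) \<Rightarrow> bool" where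
  "bdd_uniform_limit S f l \<longleftrightarrow> uniform_limit S f l sequentially \<and> bounded (l ` S)"

lemma bdd_uniform_limit_const:
  assumes "c \<longlonglongrightarrow> c0"
  shows "bdd_uniform_limit S (\<lambda>n x. c n) (\<lambda>x. c0)"
  unfolding bdd_uniform_limit_def
proof
  show "uniform_limit S (\<lambda>n x. c n) (\<lambda>x. c0) sequentially"
    by (rule uniform_limitI) (use tendstoD[OF assms] in \<open>auto elim: eventually_mono\<close>)
qed (auto simp: bounded_iff)

lemma bdd_uniform_limit_add:
  assumes "bdd_uniform_limit S f l" "bdd_uniform_limit S g m"
  shows "bdd_uniform_limit S (\<lambda>n x. f n x + g n x) (\<lambda>x. l x + m x)"
  using assms unfolding bdd_uniform_limit_def by (auto intro: uniform_limit_add bounded_plus_comp)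

lemma bdd_uniform_limit_mult:
  assumes "bdd_uniform_limit S f l" "bdd_uniform_limit S g m"
  shows "bdd_uniform_limit S (\<lambda>n x. f n x * g n x) (\<lambda>x. l x * m x)"
proof -
  obtain A B where "\<And>x. x \<in> S \<Longrightarrow> norm (l x) \<le> A" "\<And>x. x \<in> S \<Longrightarrow> norm (m x) \<le> B"
    using assms by (auto simp: bdd_uniform_limit_def bounded_iff)
  then have "norm (l x * m x) \<le> A * B" if "x \<in> S" for x
    unfolding norm_mult using that order_trans[OF norm_ge_zero] by (intro mult_mono) blast+
  then have "bounded ((\<lambda>x. l x * m x) ` S)" by (auto simp: bounded_iff)
  then show ?thesis
    using assms unfolding bdd_uniform_limit_def by (auto intro: uniform_lim_mult)
qed

lemma bdd_uniform_limit_sum: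
  assumes "finite A" "\<And>i. i \<in> A \<Longrightarrow> bdd_uniform_limit S (\<lambda>n x. f i n x) (\<lambda>x. l i x)"
  shows "bdd_uniform_limit S (\<lambda>n x. \<Sum>i\<in>A. f i n x) (\<lambda>x. \<Sum>i\<in>A. l i x)"
  using assms
  by (induction A rule: finite_induct) (simp_all add: bdd_uniform_limit_const bdd_uniform_limit_add)

lemma bdd_uniform_limit_power:
  assumes "bdd_uniform_limit S f l"
  shows "bdd_uniform_limit S (\<lambda>n x. f n x ^ k) (\<lambda>x. l x ^ k)"
  by (induction k) (simp_all add: bdd_uniform_limit_const bdd_uniform_limit_mult assms)

lemma bdd_uniform_limit_prod:
  assumes "finite A" "\<And>i. i \<in> A \<Longrightarrow> bdd_uniform_limit S (\<lambda>n x. f i n x) (\<lambda>x. l i x)"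
  shows "bdd_uniform_limit S (\<lambda>n x. \<Prod>i\<in>A. f i n x) (\<lambda>x. \<Prod>i\<in>A. l i x)"
  using assms
  by (induction A rule: finite_induct) (simp_all add: bdd_uniform_limit_const bdd_uniform_limit_mult)

lemma uniform_limit_eval_form:
  assumes c: "lifts_converge {..n} S h g w v" and K: "compact K" "K \<subseteq> S"
    and F: "\<And>\<alpha>. \<alpha> \<in> monomials n d \<Longrightarrow> (\<lambda>j. Fs j \<alpha>) \<longlonglongrightarrow> F \<alpha>"
  shows "uniform_limit K (\<lambda>j x. eval_form n d (Fs j) (w j x)) (\<lambda>x. eval_form n d F (v x)) sequentially"
proof -
  have "bdd_uniform_limit K (\<lambda>j x. w j x i) (\<lambda>x. v x i)" for i
    unfolding bdd_uniform_limit_def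
  proof
    show "uniform_limit K (\<lambda>j x. w j x i) (\<lambda>x. v x i) sequentially"
      using c K(2) by (auto simp: lifts_converge_def intro: uniform_limit_on_subset)
    have "continuous_on K (\<lambda>x. v x i)"
      using c K(2) by (auto simp: lifts_converge_def dest!: proj_liftD(1)
          intro: holomorphic_on_imp_continuous_on holomorphic_on_subset)
    then show "bounded ((\<lambda>x. v x i) ` K)"
      using K(1) compact_continuous_image compact_imp_bounded by blast
  qed
  then have "bdd_uniform_limit K (\<lambda>j x. eval_form n d (Fs j) (w j x)) (\<lambda>x. eval_form n d F (v x))"
    unfolding eval_form_def
    by (intro bdd_uniform_limit_sum bdd_uniform_limit_mult bdd_uniform_limit_const
        bdd_uniform_limit_prod bdd_uniform_limit_power F finite_monomials) auto
  then show ?thesis by (simp add: bdd_uniform_limit_def)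
qed

lemma holomorphic_on_eval_form:
  assumes "\<And>i. (\<lambda>x. v x i) holomorphic_on S"
  shows "(\<lambda>x. eval_form n d F (v x)) holomorphic_on S"
  unfolding eval_form_def by (intro holomorphic_intros assms)

lemma proj_lift_in_hypersurface_iff:
  assumes "proj_lift {..n} S f v" "z \<in> S"
  shows "f z \<in> hypersurface n d (proj_point F) \<longleftrightarrow> eval_form n d F (v z) = 0"
  using proj_liftD(2,3)[OF assms] by (simp add: proj_point_in_hypersurface_iff)

text \<open>Avoidance alone is not preserved by limits, but by Hurwitz' theorem the disjunction
  is.\<close>

definition in_or_avoids :: "nat \<Rightarrow> nat \<Rightarrow> ((nat \<Rightarrow> nat) \<Rightarrow> complex) \<Rightarrow> complex set \<Rightarrow> (complex \<Rightarrow> (nat \<Rightarrow> complex) set) \<Rightarrow> bool" where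
  "in_or_avoids n d F S f \<longleftrightarrow> f ` S \<subseteq> hypersurface n d (proj_point F) \<or>
     f ` S \<inter> hypersurface n d (proj_point F) = {}"

lemma limit_in_hypersurface:
  assumes c: "lifts_converge {..n} S h g w v" and z: "z \<in> S"
    and F: "\<And>\<alpha>. \<alpha> \<in> monomials n d \<Longrightarrow> (\<lambda>j. Fs j \<alpha>) \<longlonglongrightarrow> F \<alpha>"
    and fr: "\<exists>\<^sub>F j in sequentially. h j z \<in> hypersurface n d (proj_point (Fs j))"
  shows "g z \<in> hypersurface n d (proj_point F)"
proof -
  have v: "proj_lift {..n} S g v" and w: "\<forall>\<^sub>F j in sequentially. proj_lift {..n} S (h j) (w j)"
    using c by (auto simp: lifts_converge_def)
  have "uniform_limit {z} (\<lambda>j x. eval_form n d (Fs j) (w j x)) (\<lambda>x. eval_form n d F (v x)) sequentially"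
    by (rule uniform_limit_eval_form[OF c _ _ F]) (use z in auto)
  then have lim: "(\<lambda>j. eval_form n d (Fs j) (w j z)) \<longlonglongrightarrow> eval_form n d F (v z)" by simp
  have "\<exists>\<^sub>F j in sequentially. eval_form n d (Fs j) (w j z) = 0"
    by (rule frequently_rev_mp[OF fr])
      (use w in eventually_elim, simp add: proj_lift_in_hypersurface_iff[OF _ z])
  then have "eval_form n d F (v z) = 0"
    using tendsto_imp_eventually_ne[OF lim] by (auto simp: frequently_def)
  then show ?thesis by (simp add: proj_lift_in_hypersurface_iff[OF v z])
qed

lemma hurwitz_hypersurface:
  assumes c: "lifts_converge {..n} S h g w v" and S: "open S" "connected S"
    and F: "\<And>\<alpha>. \<alpha> \<in> monomials n d \<Longrightarrow> (\<lambda>j. Fs j \<alpha>) \<longlonglongrightarrow> F \<alpha>"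
    and ev: "\<forall>\<^sub>F j in sequentially. h j ` S \<inter> hypersurface n d (proj_point (Fs j)) = {}"
  shows "in_or_avoids n d F S g"
proof -
  have v: "proj_lift {..n} S g v" and w: "\<forall>\<^sub>F j in sequentially. proj_lift {..n} S (h j) (w j)"
    using c by (auto simp: lifts_converge_def)
  obtain N where N: "\<And>j. j \<ge> N \<Longrightarrow> proj_lift {..n} S (h j) (w j) \<and>
      h j ` S \<inter> hypersurface n d (proj_point (Fs j)) = {}"
    using eventually_conj[OF w ev] by (auto simp: eventually_sequentially)
  \<comment> \<open>Only the tail from \<open>N\<close> on is used, since Hurwitz' theorem is
    applied to a sequence without zeros at any index.\<close>
  have nz: "eval_form n d (Fs (j + N)) (w (j + N) z) \<noteq> 0" if "z \<in> S" for j z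
  proof -
    have "proj_lift {..n} S (h (j + N)) (w (j + N))" "h (j + N) z \<notin> hypersurface n d (proj_point (Fs (j + N)))"
      using N[of "j + N"] that by auto
    then show ?thesis using proj_lift_in_hypersurface_iff that by blast
  qed
  \<comment> \<open>Hurwitz' theorem excludes constant limits. A constant limit is either zero, and
    then the curve is contained, or nonzero, and then it avoids.\<close>
  show ?thesis
  proof (cases "(\<lambda>x. eval_form n d F (v x)) constant_on S")
    case True
    then obtain a where "\<And>x. x \<in> S \<Longrightarrow> eval_form n d F (v x) = a" by (auto simp: constant_on_def)
    then show ?thesis
      by (cases "a = 0") (auto simp: in_or_avoids_def proj_lift_in_hypersurface_iff[OF v])
  next
    case False
    have "eval_form n d F (v z) \<noteq> 0" if z: "z \<in> S" for z
    proof (rule Hurwitz_no_zeros[OF S _ _ _ False nz z])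
      show "(\<lambda>x. eval_form n d (Fs (j + N)) (w (j + N) x)) holomorphic_on S" for j
        using N[of "j + N"] by (intro holomorphic_on_eval_form) (auto dest: proj_liftD(1))
      show "(\<lambda>x. eval_form n d F (v x)) holomorphic_on S"
        by (rule holomorphic_on_eval_form[OF proj_liftD(1)[OF v]])
      show "uniform_limit K (\<lambda>j x. eval_form n d (Fs (j + N)) (w (j + N) x)) (\<lambda>x. eval_form n d F (v x)) sequentially"
        if "compact K" "K \<subseteq> S" for K
        using filterlim_compose[OF uniform_limit_eval_form[OF c that F] filterlim_add_const_nat_at_top]
        by (simp add: o_def)
    qed
    then show ?thesis by (auto simp: in_or_avoids_def proj_lift_in_hypersurface_iff[OF v])
  qed
qed

text \<open>The set of parameters mapped into the hypersurface is open and closed, and the plane is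
  connected.\<close>

lemma in_or_avoids_local_to_global:
  assumes "\<And>z. \<exists>e>0. in_or_avoids n d F (ball z e) g"
  shows "in_or_avoids n d F UNIV g"
proof -
  let ?A = "{z. g z \<in> hypersurface n d (proj_point F)}"
  have loc: "\<exists>e>0. ball z e \<subseteq> ?A \<or> ball z e \<subseteq> - ?A" for z
    using assms[of z] by (auto simp: in_or_avoids_def image_subset_iff)
  have "open ?A" unfolding open_contains_ball
  proof
    fix z assume "z \<in> ?A"
    then show "\<exists>e>0. ball z e \<subseteq> ?A" using loc[of z] by (metis ComplD centre_in_ball subsetD)
  qed
  moreover have "open (- ?A)" unfolding open_contains_ball
  proof
    fix z assume "z \<in> - ?A"
    then show "\<exists>e>0. ball z e \<subseteq> - ?A" using loc[of z] by (metis ComplD centre_in_ball subsetD)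
  qed
  ultimately have "?A = {} \<or> ?A = UNIV"
    using clopen[of ?A] by (simp add: closed_def)
  then show ?thesis by (auto simp: in_or_avoids_def)
qed

lemma fspeed_constant:
  assumes "p \<in> proj_space I"
  shows "fspeed I (\<lambda>_. p) z = 0"
proof -
  obtain u where "u \<in> nonzero_vecs I" "p = proj_point u" using assms by (rule proj_spaceE)
  then have "proj_lift I UNIV (\<lambda>_. p) (\<lambda>_. u)" by (auto simp: proj_lift_def)
  then show ?thesis by (simp add: fspeed_eq speed_def wron_def)
qed

lemma fspeed_nonzero_imp_nonconstant:
  assumes "proj_hol I UNIV g" "fspeed I g z \<noteq> 0"
  shows "\<not> g constant_on UNIV"
proof
  assume "g constant_on UNIV"
  then obtain p where "g = (\<lambda>_. p)" by (auto simp: constant_on_def fun_eq_iff)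
  then show False using assms fspeed_constant proj_hol_in_space by fastforce
qed

definition brody_curve :: "nat \<Rightarrow> (complex \<Rightarrow> (nat \<Rightarrow> complex) set) \<Rightarrow> bool" where
  "brody_curve n g \<longleftrightarrow> proj_hol {..n} UNIV g \<and> (\<forall>z. fspeed {..n} g z \<le> 2) \<and> \<not> g constant_on UNIV"

text \<open>The normalisation to speed 1 at the origin passes to the limit and makes it nonconstant.
  The last conclusion keeps track of containment; it is what yields openness of hyperbolicity of the
  hypersurface by itself.\<close>

proposition brody_alternative:
  assumes F: "\<And>\<alpha>. \<alpha> \<in> monomials n d \<Longrightarrow> (\<lambda>j. Fs j \<alpha>) \<longlonglongrightarrow> F \<alpha>"
    and f: "\<And>j. proj_hol {..n} (ball 0 1) (f j)" "\<And>j. fspeed {..n} (f j) 0 \<ge> real j"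
      "\<And>j. in_or_avoids n d (Fs j) (ball 0 1) (f j)"
  obtains g where "brody_curve n g" "in_or_avoids n d F UNIV g"
    "(\<forall>j. f j ` ball 0 1 \<subseteq> hypersurface n d (proj_point (Fs j))) \<longrightarrow>
       range g \<subseteq> hypersurface n d (proj_point F)"
proof -
  \<comment> \<open>A disc of central speed \<open>4 * j\<close> is reparametrised over radius
    \<open>j\<close>, because \<open>brody_reparametrisation\<close> costs a factor 4. At
    \<open>j = 0\<close> the ball is empty and any reparametrisation will do.\<close>
  let ?P = "\<lambda>j a r. r > 0 \<and> (\<forall>z\<in>ball 0 (real j). a + of_real r * z \<in> ball 0 1) \<and>
    (j > 0 \<longrightarrow> fspeed {..n} (\<lambda>z. f (4 * j) (a + of_real r * z)) 0 = 1) \<and>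
    (\<forall>z\<in>ball 0 (real j). fspeed {..n} (\<lambda>z. f (4 * j) (a + of_real r * z)) z \<le> 2)"
  have "\<exists>a r. ?P j a r" for j
  proof (cases "j = 0")
    case True
    then show ?thesis by (intro exI[of _ 0] exI[of _ 1]) auto
  next
    case False
    then have M: "real (4 * j) > 0" by simp
    obtain a r where "r > 0" "\<And>z. z \<in> ball 0 (real (4 * j) / 4) \<Longrightarrow> a + of_real r * z \<in> ball 0 1"
      "fspeed {..n} (\<lambda>z. f (4 * j) (a + of_real r * z)) 0 = 1"
      "\<And>z. z \<in> ball 0 (real (4 * j) / 4) \<Longrightarrow> fspeed {..n} (\<lambda>z. f (4 * j) (a + of_real r * z)) z \<le> 2"
      by (rule brody_reparametrisation[OF f(1) finite_atMost M f(2)]) blast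
    then show ?thesis by (intro exI[of _ a] exI[of _ r]) auto
  qed
  then obtain a r where ar: "\<And>j. ?P j (a j) (r j)" by metis
  define h where "h = (\<lambda>j z. f (4 * j) (a j + of_real (r j) * z))"
  have hol: "proj_hol {..n} (ball 0 (real j)) (h j)" for j
    unfolding h_def by (rule proj_hol_affine[OF f(1)]) (use ar in auto)
  have sp: "fspeed {..n} (h j) z \<le> 2" if "z \<in> ball 0 (real j)" for j z
    using ar that unfolding h_def by blast
  have h0: "fspeed {..n} (h j) 0 = 1" if "j > 0" for j
    using ar that unfolding h_def by blast
  have hA: "in_or_avoids n d (Fs (4 * j)) (ball 0 (real j)) (h j)" for j
    using f(3)[of "4 * j"] ar[of j] unfolding in_or_avoids_def h_def by blast
  obtain g k where k: "strict_mono (k :: nat \<Rightarrow> nat)" and g: "proj_hol {..n} UNIV g"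
    and loc: "\<And>z. \<exists>e>0. \<exists>w v. lifts_converge {..n} (ball z e) (\<lambda>j. h (k j)) g w v"
    using brody_limit[OF hol sp finite_atMost] by metis
  have kn: "k j \<ge> j" for j using k by (rule seq_suble)
  have evin: "\<forall>\<^sub>F j in sequentially. R \<le> real (k j)" for R
  proof -
    have "\<forall>\<^sub>F n in sequentially. R \<le> real n"
      using filterlim_real_sequentially by (simp add: filterlim_at_top)
    then show ?thesis
    proof eventually_elim
      case (elim n)
      then show ?case using kn[of n] by linarith
    qed
  qed
  have tend: "(\<lambda>j. fspeed {..n} (h (k j)) z) \<longlonglongrightarrow> fspeed {..n} g z" for z
  proof -
    obtain e w v where "e > 0" "lifts_converge {..n} (ball z e) (\<lambda>j. h (k j)) g w v" using loc by blast
    then show ?thesis using fspeed_tendsto[of "{..n}" "ball z e" "\<lambda>j. h (k j)" g w v z] by simp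
  qed
  have "fspeed {..n} g 0 = 1"
  proof -
    have "\<forall>\<^sub>F j in sequentially. fspeed {..n} (h (k j)) 0 = 1"
      using evin[of 1] by eventually_elim (use h0 in auto)
    then have "(\<lambda>j. fspeed {..n} (h (k j)) 0) \<longlonglongrightarrow> 1" by (rule tendsto_eventually)
    then show ?thesis using tend LIMSEQ_unique by blast
  qed
  moreover have "fspeed {..n} g z \<le> 2" for z
  proof (rule tendsto_upperbound[OF tend])
    show "\<forall>\<^sub>F j in sequentially. fspeed {..n} (h (k j)) z \<le> 2"
      using evin[of "norm z + 1"] by eventually_elim (use sp in auto)
  qed auto
  ultimately have bc: "brody_curve n g"
    using g fspeed_nonzero_imp_nonconstant[OF g, of 0] by (auto simp: brody_curve_def)
  have k4: "strict_mono (\<lambda>j. 4 * k j)" using k by (auto simp: strict_mono_def)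
  have F': "(\<lambda>j. Fs (4 * k j) \<alpha>) \<longlonglongrightarrow> F \<alpha>" if "\<alpha> \<in> monomials n d" for \<alpha>
    using LIMSEQ_subseq_LIMSEQ[OF F[OF that] k4] by (simp add: o_def)
  let ?X = "\<lambda>j. hypersurface n d (proj_point (Fs (4 * k j)))"
  let ?in = "\<lambda>j. h (k j) ` ball 0 (real (k j)) \<subseteq> ?X j"
  have freq: "range g \<subseteq> hypersurface n d (proj_point F)" if fr: "\<exists>\<^sub>F j in sequentially. ?in j"
  proof (rule image_subsetI)
    fix z
    obtain e w v where e: "e > 0" and c: "lifts_converge {..n} (ball z e) (\<lambda>j. h (k j)) g w v" using loc by blast
    show "g z \<in> hypersurface n d (proj_point F)"
    proof (rule limit_in_hypersurface[OF c _ F'])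
      show "\<exists>\<^sub>F j in sequentially. h (k j) z \<in> ?X j"
        by (rule frequently_rev_mp[OF fr], use evin[of "norm z + 1"] in eventually_elim) auto
    qed (use e in auto)
  qed
  \<comment> \<open>Either infinitely many discs are contained, and containment is a closed
    condition, or all but finitely many avoid, and Hurwitz' theorem applies on small balls.\<close>
  have "in_or_avoids n d F UNIV g"
  proof (cases "\<exists>\<^sub>F j in sequentially. ?in j")
    case True
    then show ?thesis using freq by (simp add: in_or_avoids_def)
  next
    case False
    then have "\<forall>\<^sub>F j in sequentially. \<not> ?in j" by (simp add: not_frequently)
    then have av: "\<forall>\<^sub>F j in sequentially. h (k j) ` ball 0 (real (k j)) \<inter> ?X j = {}"
      by eventually_elim (use hA in \<open>auto simp: in_or_avoids_def\<close>)
    show ?thesis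
    proof (rule in_or_avoids_local_to_global)
      fix z
      obtain e w v where e: "e > 0" and c: "lifts_converge {..n} (ball z e) (\<lambda>j. h (k j)) g w v" using loc by blast
      have "in_or_avoids n d F (ball z e) g"
      proof (rule hurwitz_hypersurface[OF c _ _ F'])
        show "\<forall>\<^sub>F j in sequentially. h (k j) ` ball z e \<inter> ?X j = {}"
          using av evin[of "norm z + e"]
        proof eventually_elim
          case (elim j)
          have "ball z e \<subseteq> ball 0 (real (k j))"
          proof
            fix x assume "x \<in> ball z e"
            then show "x \<in> ball 0 (real (k j))"
              using elim(2) norm_triangle_ineq2[of x z] by (simp add: dist_norm norm_minus_commute)
          qed
          with elim(1) show ?case by blast
        qed
      qed auto
      then show "\<exists>e>0. in_or_avoids n d F (ball z e) g" using e by blast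
    qed
  qed
  moreover have "range g \<subseteq> hypersurface n d (proj_point F)"
    if *: "\<forall>j. f j ` ball 0 1 \<subseteq> hypersurface n d (proj_point (Fs j))"
  proof (rule freq)
    have "?in j" for j using *[rule_format, of "4 * k j"] ar[of "k j"] unfolding h_def by blast
    then show "\<exists>\<^sub>F j in sequentially. ?in j" by simp
  qed
  ultimately show ?thesis by (intro that[OF bc] impI)
qed

section \<open>Uniform bounds on discs and openness of hyperbolicity\<close>

definition discs_bounded :: "nat \<Rightarrow> nat \<Rightarrow> ((nat \<Rightarrow> nat) \<Rightarrow> complex) \<Rightarrow> real \<Rightarrow> bool" where
  "discs_bounded n d F C \<longleftrightarrow> (\<forall>f. proj_hol {..n} (ball 0 1) f \<and> in_or_avoids n d F (ball 0 1) f \<longrightarrow>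
     fspeed {..n} f 0 \<le> C)"

definition near_form :: "nat \<Rightarrow> nat \<Rightarrow> real \<Rightarrow> ((nat \<Rightarrow> nat) \<Rightarrow> complex) \<Rightarrow> ((nat \<Rightarrow> nat) \<Rightarrow> complex) \<Rightarrow> bool" where
  "near_form n d e F G \<longleftrightarrow> (\<forall>\<alpha>\<in>monomials n d. cmod (G \<alpha> - F \<alpha>) < e)"

lemma near_form_tendsto:
  assumes "\<And>j. near_form n d (1 / real (Suc j)) F (Fs j)" "\<alpha> \<in> monomials n d"
  shows "(\<lambda>j. Fs j \<alpha>) \<longlonglongrightarrow> F \<alpha>"
proof (rule LIM_zero_cancel, rule Lim_null_comparison)
  show "\<forall>\<^sub>F j in sequentially. norm (Fs j \<alpha> - F \<alpha>) \<le> 1 / real (Suc j)"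
    using assms by (intro always_eventually allI less_imp_le) (auto simp: near_form_def)
  show "(\<lambda>j. 1 / real (Suc j)) \<longlonglongrightarrow> 0" using LIMSEQ_inverse_real_of_nat by (simp add: inverse_eq_divide)
qed

proposition discs_bounded_near:
  assumes "\<And>g. brody_curve n g \<Longrightarrow> \<not> in_or_avoids n d F UNIV g"
  obtains e C where "e > 0" "\<And>G. near_form n d e F G \<Longrightarrow> discs_bounded n d G C"
proof -
  have "\<exists>j. \<forall>G. near_form n d (1 / real (Suc j)) F G \<longrightarrow> discs_bounded n d G (real j)"
  proof (rule ccontr)
    assume "\<not> ?thesis"
    then have "\<forall>j. \<exists>G f. near_form n d (1 / real (Suc j)) F G \<and> proj_hol {..n} (ball 0 1) f \<and>
        in_or_avoids n d G (ball 0 1) f \<and> fspeed {..n} f 0 > real j"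
      unfolding discs_bounded_def not_ex not_all not_imp not_le by blast
    then obtain Fs f where *: "\<And>j. near_form n d (1 / real (Suc j)) F (Fs j)"
      "\<And>j. proj_hol {..n} (ball 0 1) (f j)" "\<And>j. in_or_avoids n d (Fs j) (ball 0 1) (f j)"
      "\<And>j. fspeed {..n} (f j) 0 > real j" unfolding choice_iff by blast
    obtain g where "brody_curve n g" "in_or_avoids n d F UNIV g"
      by (rule brody_alternative[OF near_form_tendsto[OF *(1)] *(2) less_imp_le[OF *(4)] *(3)])
    then show False using assms by blast
  qed
  then obtain j where "\<forall>G. near_form n d (1 / real (Suc j)) F G \<longrightarrow> discs_bounded n d G (real j)" by blast
  then show ?thesis by (intro that[of "1 / real (Suc j)"]) auto
qed

definition hyperbolic_form :: "nat \<Rightarrow> nat \<Rightarrow> ((nat \<Rightarrow> nat) \<Rightarrow> complex) \<Rightarrow> bool" where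
  "hyperbolic_form n d F \<longleftrightarrow> (\<forall>g. proj_hol {..n} UNIV g \<and> range g \<subseteq> hypersurface n d (proj_point F) \<longrightarrow>
     g constant_on UNIV)"

lemma hyperbolic_form_iff:
  "hyperbolic_form n d F \<longleftrightarrow> brody_hyperbolic {..n} (hypersurface n d (proj_point F))"
  by (simp add: hyperbolic_form_def brody_hyperbolic_def holomorphic_map_iff)

text \<open>Zooming affinely at a point of nonzero speed prescribes the central speed at will. This
  refutes bounds on discs and turns entire curves into input for
  \<open>brody_alternative\<close>.\<close>

lemma fast_disc:
  assumes g: "proj_hol I UNIV g" "\<not> g constant_on UNIV" and I: "finite I" and c: "c \<ge> 0"
  obtains a r where "r \<ge> 0" "proj_hol I (ball 0 1) (\<lambda>z. g (a + of_real r * z))"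
    "fspeed I (\<lambda>z. g (a + of_real r * z)) 0 = c"
proof -
  obtain a where a: "fspeed I g a \<noteq> 0" using fspeed_zero_imp_constant[OF g(1) _ I] g(2) by blast
  then have pos: "fspeed I g a > 0" using fspeed_nonneg[of I g a] by linarith
  define r where "r = c / fspeed I g a"
  have r: "r \<ge> 0" using pos c by (simp add: r_def)
  show ?thesis
  proof (rule that[OF r])
    show "proj_hol I (ball 0 1) (\<lambda>z. g (a + of_real r * z))"
      by (rule proj_hol_affine[OF g(1)]) auto
    have "fspeed I (\<lambda>z. g (a + of_real r * z)) 0 = r * fspeed I g (a + of_real r * 0)"
      by (rule fspeed_affine[OF g(1), of "ball 0 1"]) (use r in auto)
    then show "fspeed I (\<lambda>z. g (a + of_real r * z)) 0 = c" using a by (simp add: r_def)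
  qed
qed

text \<open>The curves in the approximating hypersurfaces come without a speed bound; replaced by
  discs of central speed \<open>j\<close> they have a Brody curve inside the limit hypersurface. The
  lemma is needed to make the partial sums of the later construction hyperbolic.\<close>

proposition hyperbolic_form_near:
  assumes "hyperbolic_form n d F"
  obtains e where "e > 0" "\<And>G. near_form n d e F G \<Longrightarrow> hyperbolic_form n d G"
proof -
  have "\<exists>j. \<forall>G. near_form n d (1 / real (Suc j)) F G \<longrightarrow> hyperbolic_form n d G"
  proof (rule ccontr)
    assume "\<not> ?thesis"
    then have "\<forall>j. \<exists>G g. near_form n d (1 / real (Suc j)) F G \<and> proj_hol {..n} UNIV g \<and>
        range g \<subseteq> hypersurface n d (proj_point G) \<and> \<not> g constant_on UNIV"
      unfolding hyperbolic_form_def by blast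
    then obtain Fs g where *: "\<And>j. near_form n d (1 / real (Suc j)) F (Fs j)"
      "\<And>j. proj_hol {..n} UNIV (g j)" "\<And>j. range (g j) \<subseteq> hypersurface n d (proj_point (Fs j))"
      "\<And>j. \<not> g j constant_on UNIV" unfolding choice_iff by blast
    have "\<forall>j. \<exists>f. proj_hol {..n} (ball 0 1) f \<and> fspeed {..n} f 0 = real j \<and>
        f ` ball 0 1 \<subseteq> hypersurface n d (proj_point (Fs j))"
    proof
      fix j
      obtain a r where "proj_hol {..n} (ball 0 1) (\<lambda>z. g j (a + of_real r * z))"
        "fspeed {..n} (\<lambda>z. g j (a + of_real r * z)) 0 = real j"
        by (rule fast_disc[OF *(2,4) finite_atMost of_nat_0_le_iff, of j j]) blast
      then show "\<exists>f. proj_hol {..n} (ball 0 1) f \<and> fspeed {..n} f 0 = real j \<and>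
          f ` ball 0 1 \<subseteq> hypersurface n d (proj_point (Fs j))"
        using *(3)[of j] by (intro exI[of _ "\<lambda>z. g j (a + of_real r * z)"]) auto
    qed
    then obtain f where f: "\<And>j. proj_hol {..n} (ball 0 1) (f j)" "\<And>j. fspeed {..n} (f j) 0 = real j"
        "\<And>j. f j ` ball 0 1 \<subseteq> hypersurface n d (proj_point (Fs j))" unfolding choice_iff by blast
    have io: "\<And>j. in_or_avoids n d (Fs j) (ball 0 1) (f j)" using f(3) by (simp add: in_or_avoids_def)
    obtain g where "brody_curve n g" "(\<forall>j. f j ` ball 0 1 \<subseteq> hypersurface n d (proj_point (Fs j))) \<longrightarrow>
       range g \<subseteq> hypersurface n d (proj_point F)"
      by (rule brody_alternative[OF near_form_tendsto[OF *(1)] f(1) eq_refl[OF f(2)[symmetric]] io])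
    with f(3) have "brody_curve n g" "range g \<subseteq> hypersurface n d (proj_point F)" by blast+
    then show False using assms by (auto simp: brody_curve_def hyperbolic_form_def)
  qed
  then obtain j where "\<forall>G. near_form n d (1 / real (Suc j)) F G \<longrightarrow> hyperbolic_form n d G" by blast
  then show ?thesis by (intro that[of "1 / real (Suc j)"]) auto
qed

section \<open>Openness\<close>

text \<open>Tychonoff's theorem: the sphere is closed in a product of closed discs over
  \<open>I\<close> and of \<open>{0}\<close> elsewhere, the index type being arbitrary.\<close>

lemma compact_unit_sphere:
  assumes I: "finite I"
  shows "compact {v. v \<in> nonzero_vecs I \<and> nsq I v = 1}"
proof -
  define S where "S = {v. v \<in> nonzero_vecs I \<and> nsq I v = 1}"
  let ?P = "PiE UNIV (\<lambda>i. if i \<in> I then cball (0::complex) 1 else {0})"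
  have "compactin (product_topology (\<lambda>i. euclidean) UNIV) ?P"
    by (subst compactin_PiE) auto
  then have cP: "compact ?P" by (simp add: euclidean_product_topology)
  have "continuous_on UNIV (nsq I)"
    unfolding nsq_def
    by (intro continuous_intros continuous_on_product_then_coordinatewise[OF continuous_on_id])
  then have cl: "closed {v. nsq I v = 1}"
    by (intro closed_Collect_eq continuous_intros)
  have "S = ?P \<inter> {v. nsq I v = 1}"
  proof (intro set_eqI iffI)
    fix v assume v: "v \<in> S"
    have "(cmod (v i))\<^sup>2 \<le> 1\<^sup>2" if "i \<in> I" for i
      using norm_le_nsq[OF I that, of v] v by (simp add: S_def)
    then have "cmod (v i) \<le> 1" if "i \<in> I" for i using that power2_le_imp_le[of "cmod (v i)" 1] by simp
    then show "v \<in> ?P \<inter> {v. nsq I v = 1}" using v by (auto simp: S_def nonzero_vecs_def)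
  next
    fix v assume v: "v \<in> ?P \<inter> {v. nsq I v = 1}"
    then have z: "v i = 0" if "i \<notin> I" for i using that by (auto simp: PiE_iff split: if_splits)
    have "\<exists>i. v i \<noteq> 0"
    proof (rule ccontr)
      assume "\<not> ?thesis"
      then have "nsq I v = 0" by (simp add: nsq_def)
      then show False using v by simp
    qed
    then show "v \<in> S" using v z by (auto simp: S_def nonzero_vecs_def)
  qed
  then have "compact S" using compact_Int_closed[OF cP cl] by simp
  then show ?thesis by (simp only: S_def)
qed

lemma compact_space_proj_topology:
  assumes I: "finite I"
  shows "compact_space (proj_topology I)"
proof -
  define S where "S = {v. v \<in> nonzero_vecs I \<and> nsq I v = 1}"
  have "compact S" unfolding S_def by (rule compact_unit_sphere[OF I])
  moreover have SI: "S \<subseteq> nonzero_vecs I" by (auto simp: S_def)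
  ultimately have "compactin (top_of_set (nonzero_vecs I)) S"
    by (simp add: compactin_subtopology)
  then have "compactin (proj_topology I) (proj_point ` S)"
    using image_compactin quotient_imp_continuous_map[OF quotient_map_proj_point] by blast
  moreover have "proj_point ` S = proj_space I"
  proof (intro equalityI subsetI)
    fix p assume "p \<in> proj_space I"
    then obtain v where v: "v \<in> nonzero_vecs I" "p = proj_point v" by (rule proj_spaceE)
    define c where "c = complex_of_real (1 / sqrt (nsq I v))"
    have pos: "nsq I v > 0" using nsq_pos[OF I v(1)] .
    then have c: "c \<noteq> 0" by (simp add: c_def)
    have "nsq I (\<lambda>i. c * v i) = 1"
      using pos unfolding nsq_scale c_def norm_of_real by (simp add: power_divide)
    then have "(\<lambda>i. c * v i) \<in> S" using nonzero_vecs_scale[OF v(1) c] by (simp add: S_def)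
    moreover have "p = proj_point (\<lambda>i. c * v i)" by (subst proj_point_scale[OF c]) (rule v(2))
    ultimately show "p \<in> proj_point ` S" by blast
  qed (use SI in \<open>auto simp: proj_space_def\<close>)
  ultimately show ?thesis by (simp add: compact_space_def)
qed

lemma openin_complement_hypersurface:
  "openin (proj_topology {..n}) (proj_space {..n} - hypersurface n d (proj_point F))"
proof -
  have "{v \<in> nonzero_vecs {..n}. proj_point v \<in> proj_space {..n} - hypersurface n d (proj_point F)} =
    nonzero_vecs {..n} \<inter> {v. eval_form n d F v \<noteq> 0}"
    by (auto simp: proj_point_in_hypersurface_iff proj_space_def)
  moreover have "open {v. eval_form n d F v \<noteq> 0}"
    unfolding eval_form_def
    by (intro open_Collect_neq continuous_intros continuous_on_product_then_coordinatewise[OF continuous_on_id])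
  ultimately show ?thesis
    by (simp add: openin_proj_topology openin_open_Int)
qed

section \<open>Kobayashi distance estimates from bounds on the speed\<close>

lemma neg_ln_le_artanh:
  fixes t :: real
  assumes "0 \<le> t" "t < 1"
  shows "- ln (1 - t) \<le> 2 * artanh t"
proof -
  have "2 * artanh t = ln (1 + t) - ln (1 - t)"
    using assms by (simp add: artanh_def ln_div)
  moreover have "ln (1 + t) \<ge> 0" using assms by simp
  ultimately show ?thesis by simp
qed

text \<open>The derivative estimate is integrated along the segment from 0 to \<open>b\<close>,
  where the bound on the speed has a logarithmic primitive.\<close>

lemma psi_radial_bound:
  assumes f: "proj_hol I (ball 0 1) f" and I: "finite I" "i \<in> I" "j \<in> I"
    and sp: "\<And>z. z \<in> ball 0 1 \<Longrightarrow> fspeed I f z \<le> C / (1 - norm z)" and b: "b \<in> ball 0 1"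
  shows "norm (psi I i j (f b) - psi I i j (f 0)) \<le> 2 * C * (- ln (1 - norm b))"
proof -
  obtain D where D: "\<And>z. z \<in> ball 0 1 \<Longrightarrow> ((\<lambda>x. psi I i j (f x)) has_derivative D z) (at z)"
    "\<And>z h. z \<in> ball 0 1 \<Longrightarrow> norm (D z h) \<le> 2 * fspeed I f z * norm h"
    using psi_derivative[OF f _ I] by metis
  have b1: "norm b < 1" using b by simp
  have in1: "of_real s * b \<in> ball 0 1" "s * norm b < 1" if "s \<in> {0..1}" for s
  proof -
    have "s * norm b \<le> 1 * norm b" using that by (intro mult_right_mono) auto
    then show "s * norm b < 1" using b1 by linarith
    then show "of_real s * b \<in> ball 0 1" using that by (simp add: norm_mult)
  qed
  let ?g = "\<lambda>s. psi I i j (f (of_real s * b))"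
  let ?\<phi> = "\<lambda>s. 2 * C * (- ln (1 - s * norm b))"
  have g: "(?g has_vector_derivative D (of_real s * b) b) (at s)" if "s \<in> {0..1}" for s
  proof -
    have "((\<lambda>s. complex_of_real s * b) has_derivative (\<lambda>h. of_real h * b)) (at s)"
      by (auto intro!: derivative_eq_intros)
    then have "((\<lambda>x. psi I i j (f x)) \<circ> (\<lambda>s. complex_of_real s * b) has_derivative
        D (of_real s * b) \<circ> (\<lambda>h. of_real h * b)) (at s)"
      by (rule diff_chain_at) (rule D(1)[OF in1(1)[OF that]])
    moreover have "linear (D (of_real s * b))"
      using D(1)[OF in1(1)[OF that]] by (rule has_derivative_linear)
    then have "D (of_real s * b) \<circ> (\<lambda>h. of_real h * b) = (\<lambda>h. h *\<^sub>R D (of_real s * b) b)"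
      by (auto simp: fun_eq_iff scaleR_conv_of_real[symmetric] linear_scale)
    ultimately show ?thesis by (simp add: has_vector_derivative_def o_def)
  qed
  have \<phi>: "(?\<phi> has_vector_derivative 2 * C * (norm b / (1 - s * norm b))) (at s)" if "s \<in> {0..1}" for s
    unfolding has_real_derivative_iff_has_vector_derivative[symmetric]
    using in1(2)[OF that] by (auto intro!: derivative_eq_intros simp: field_simps)
  have "norm (?g 1 - ?g 0) \<le> ?\<phi> 1 - ?\<phi> 0"
  proof (rule differentiable_bound_general)
    show "continuous_on {0..1} ?g"
      using g by (intro continuous_at_imp_continuous_on ballI has_vector_derivative_continuous)
    show "continuous_on {0..1} ?\<phi>"
      using \<phi> by (intro continuous_at_imp_continuous_on ballI has_vector_derivative_continuous)
    fix s :: real assume "0 < s" "s < 1"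
    then have s: "s \<in> {0..1}" by simp
    show "(?g has_vector_derivative D (of_real s * b) b) (at s)" by (rule g[OF s])
    show "(?\<phi> has_vector_derivative 2 * C * (norm b / (1 - s * norm b))) (at s)" by (rule \<phi>[OF s])
    have "norm (D (of_real s * b) b) \<le> 2 * fspeed I f (of_real s * b) * norm b"
      by (rule D(2)[OF in1(1)[OF s]])
    also have "\<dots> \<le> 2 * (C / (1 - s * norm b)) * norm b"
      using sp[OF in1(1)[OF s]] s by (intro mult_right_mono mult_left_mono) (auto simp: norm_mult)
    finally show "norm (D (of_real s * b) b) \<le> 2 * C * (norm b / (1 - s * norm b))" by simp
  qed simp
  then show ?thesis by simp
qed

text \<open>A Moebius transformation moves \<open>a\<close> to the centre. The radial integral of
  \<open>1 / (1 - t)\<close> is then below the Poincare length, whose density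
  \<open>2 / (1 - t^2)\<close> is the sum of \<open>1 / (1 - t)\<close> and
  \<open>1 / (1 + t)\<close>.\<close>

lemma psi_poincare_bound:
  assumes Y: "\<And>f. proj_hol I (ball 0 1) f \<Longrightarrow> f ` ball 0 1 \<subseteq> Y \<Longrightarrow> fspeed I f 0 \<le> C"
    and C: "C \<ge> 0" and I: "finite I" "i \<in> I" "j \<in> I"
    and f: "proj_hol I (ball 0 1) f" "f ` ball 0 1 \<subseteq> Y" and ab: "a \<in> ball 0 1" "b \<in> ball 0 1"
  shows "norm (psi I i j (f b) - psi I i j (f a)) \<le> 2 * C * poincare_dist a b"
proof -
  define \<phi> where "\<phi> = Moebius_function 0 (- a)"
  define c where "c = Moebius_function 0 a b"
  have \<phi>: "\<phi> holomorphic_on ball 0 1" "\<phi> ` ball 0 1 \<subseteq> ball 0 1"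
    using ab Moebius_function_norm_lt_1[of "-a"] Moebius_function_holomorphic[of "-a"] by (auto simp: \<phi>_def)
  have c: "c \<in> ball 0 1" using ab Moebius_function_norm_lt_1 by (auto simp: c_def)
  have \<phi>c: "\<phi> c = b" using ab by (simp add: \<phi>_def c_def Moebius_function_compose)
  have \<phi>0: "\<phi> 0 = a" by (simp add: \<phi>_def Moebius_function_simple)
  define h where "h = (\<lambda>z. f (\<phi> z))"
  have h: "proj_hol I (ball 0 1) h" unfolding h_def by (rule proj_hol_compose[OF f(1) \<phi>]) auto
  have hY: "h ` ball 0 1 \<subseteq> Y" using f(2) \<phi>(2) by (auto simp: h_def)
  \<comment> \<open>The affine disc of radius \<open>1 - norm z\<close> around \<open>z\<close>
    stays in the unit disc and has central speed \<open>(1 - norm z) * fspeed I h z\<close>, which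
    the hypothesis bounds by \<open>C\<close>.\<close>
  have sp: "fspeed I h z \<le> C / (1 - norm z)" if z: "z \<in> ball 0 1" for z
  proof -
    let ?r = "1 - norm z"
    have r: "?r > 0" using z by simp
    have in1: "z + of_real ?r * x \<in> ball 0 1" if "x \<in> ball 0 1" for x
    proof -
      have "norm (of_real ?r * x) < ?r" using r that by (simp add: norm_mult del: of_real_diff)
      then show ?thesis using norm_triangle_ineq[of z "of_real ?r * x"] by simp
    qed
    have "fspeed I (\<lambda>x. h (z + of_real ?r * x)) 0 \<le> C"
      by (rule Y[OF proj_hol_affine[OF h open_ball[of 0 1] in1]]) (use hY in1 in auto)
    moreover have "fspeed I (\<lambda>x. h (z + of_real ?r * x)) 0 = ?r * fspeed I h (z + of_real ?r * 0)"
      by (rule fspeed_affine[OF h open_ball[of 0 1] in1]) (use r in auto)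
    ultimately show ?thesis using r by (simp add: field_simps)
  qed
  have "norm (psi I i j (h c) - psi I i j (h 0)) \<le> 2 * C * (- ln (1 - norm c))"
    by (rule psi_radial_bound[OF h I sp c])
  also have "\<dots> \<le> 2 * C * poincare_dist a b"
    unfolding poincare_dist_def c_def[symmetric]
    using C c by (intro mult_left_mono neg_ln_le_artanh) auto
  finally show ?thesis by (simp add: h_def \<phi>c \<phi>0)
qed

text \<open>Telescoping along a chain of discs. If there is no chain, the infimum is
  infinite.\<close>

lemma psi_kobayashi_bound:
  assumes Y: "\<And>f. proj_hol I (ball 0 1) f \<Longrightarrow> f ` ball 0 1 \<subseteq> Y \<Longrightarrow> fspeed I f 0 \<le> C"
    and C: "C > 0" and I: "finite I" "i \<in> I" "j \<in> I"
  shows "ennreal (norm (psi I i j q - psi I i j p) / (2 * C)) \<le> kobayashi_dist I Y p q"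
  unfolding kobayashi_dist_def
proof (rule Inf_greatest, clarify)
  fix m x f a b assume ch: "disc_chain I Y p q m x f a b"
  have step: "norm (psi I i j (x (Suc l)) - psi I i j (x l)) \<le> 2 * C * poincare_dist (a l) (b l)" if "l < m" for l
  proof -
    have "holomorphic_map (ball 0 1) I Y (f l)" and ab: "a l \<in> ball 0 1" "b l \<in> ball 0 1"
      and x: "x l = f l (a l)" "x (Suc l) = f l (b l)"
      using ch that by (auto simp: disc_chain_def)
    then have "proj_hol I (ball 0 1) (f l)" "f l ` ball 0 1 \<subseteq> Y" by (auto simp: holomorphic_map_iff)
    then show ?thesis unfolding x by (intro psi_poincare_bound[OF Y less_imp_le[OF C] I _ _ ab]) auto
  qed
  have "psi I i j q - psi I i j p = (\<Sum>l<m. psi I i j (x (Suc l)) - psi I i j (x l))"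
    using ch sum_lessThan_telescope[of "\<lambda>l. psi I i j (x l)" m] by (simp add: disc_chain_def)
  then have "norm (psi I i j q - psi I i j p) \<le> (\<Sum>l<m. norm (psi I i j (x (Suc l)) - psi I i j (x l)))"
    by (simp add: norm_sum)
  also have "\<dots> \<le> (\<Sum>l<m. 2 * C * poincare_dist (a l) (b l))"
    using step by (intro sum_mono) auto
  finally have "norm (psi I i j q - psi I i j p) / (2 * C) \<le> (\<Sum>l<m. poincare_dist (a l) (b l))"
    using C by (simp add: sum_distrib_left[symmetric] field_simps)
  then show "ennreal (norm (psi I i j q - psi I i j p) / (2 * C)) \<le> ennreal (\<Sum>l<m. poincare_dist (a l) (b l))"
    by (rule ennreal_leI)
qed

text \<open>The projection entries are continuous on the whole projective space, so they separate
  boundary points of \<open>Y\<close> as well, and \<open>psi_kobayashi_bound\<close> turns the gap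
  into a lower bound for the distance inside \<open>Y\<close>.\<close>

proposition hyperbolically_embeddedI:
  assumes I: "finite I" and op: "openin (proj_topology I) Y"
    and Y: "\<And>f. proj_hol I (ball 0 1) f \<Longrightarrow> f ` ball 0 1 \<subseteq> Y \<Longrightarrow> fspeed I f 0 \<le> C"
  shows "hyperbolically_embedded I Y"
  unfolding hyperbolically_embedded_def
proof (intro conjI op ballI impI)
  have "closedin (proj_topology I) (proj_topology I closure_of Y)" by simp
  then show "compactin (proj_topology I) (proj_topology I closure_of Y)"
    by (rule closedin_compact_space[OF compact_space_proj_topology[OF I]])
  fix p q assume pq: "p \<in> proj_topology I closure_of Y" "q \<in> proj_topology I closure_of Y" "p \<noteq> q"
  have sp: "p \<in> proj_space I" "q \<in> proj_space I"
    using pq closure_of_subset_topspace[of "proj_topology I" Y] by auto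
  then obtain i j where ij: "i \<in> I" "j \<in> I" "psi I i j p \<noteq> psi I i j q"
    using psi_inj[OF sp I] pq(3) by blast
  \<comment> \<open>\<open>psi_kobayashi_bound\<close> divides by the constant, so it is made
    positive.\<close>
  define C' where "C' = max C 1"
  have Y': "fspeed I f 0 \<le> C'" if "proj_hol I (ball 0 1) f" "f ` ball 0 1 \<subseteq> Y" for f
    using Y[OF that] by (simp add: C'_def)
  have C': "C' > 0" by (simp add: C'_def)
  \<comment> \<open>Removing a third of the gap at either end leaves a third of it between the two
    neighbourhoods.\<close>
  define \<eta> where "\<eta> = dist (psi I i j p) (psi I i j q) / 3"
  have \<eta>: "\<eta> > 0" using ij by (simp add: \<eta>_def)
  define U where "U = (\<lambda>r. {x \<in> topspace (proj_topology I). psi I i j x \<in> ball (psi I i j r) \<eta>})"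
  have U: "openin (proj_topology I) (U r)" for r
    unfolding U_def by (rule openin_continuous_map_preimage[OF continuous_map_psi[OF I]]) simp
  have "ennreal (\<eta> / (2 * C')) \<le> kobayashi_setdist I Y (U p \<inter> Y) (U q \<inter> Y)"
    unfolding kobayashi_setdist_def
  proof (intro INF_greatest)
    fix x y assume "x \<in> U p \<inter> Y" "y \<in> U q \<inter> Y"
    then have "dist (psi I i j p) (psi I i j x) < \<eta>" "dist (psi I i j q) (psi I i j y) < \<eta>"
      by (auto simp: U_def)
    then have "\<eta> \<le> norm (psi I i j y - psi I i j x)"
      using dist_triangle[of "psi I i j p" "psi I i j q" "psi I i j x"]
        dist_triangle[of "psi I i j x" "psi I i j q" "psi I i j y"]
      unfolding dist_norm[of "psi I i j y", symmetric] by (simp add: \<eta>_def dist_commute)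
    then have "ennreal (\<eta> / (2 * C')) \<le> ennreal (norm (psi I i j y - psi I i j x) / (2 * C'))"
      using C' by (intro ennreal_leI divide_right_mono) auto
    also have "\<dots> \<le> kobayashi_dist I Y x y"
      by (rule psi_kobayashi_bound[OF Y' C' I ij(1,2)])
    finally show "ennreal (\<eta> / (2 * C')) \<le> kobayashi_dist I Y x y" .
  qed
  moreover have "ennreal (\<eta> / (2 * C')) > 0" using \<eta> C' by simp
  ultimately have "kobayashi_setdist I Y (U p \<inter> Y) (U q \<inter> Y) > 0" by (rule order_less_le_trans[rotated])
  moreover have "p \<in> U p" "q \<in> U q" using sp \<eta> by (auto simp: U_def)
  ultimately show "\<exists>U V. openin (proj_topology I) U \<and> p \<in> U \<and> openin (proj_topology I) V \<and> q \<in> V \<and>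
      kobayashi_setdist I Y (U \<inter> Y) (V \<inter> Y) > 0"
    using U by blast
qed

text \<open>Two points on an entire curve in \<open>Y\<close> have Kobayashi distance 0: the disc
  obtained by stretching the parameter by \<open>1 / t\<close> joins them at Poincare distance
  \<open>2 * artanh t\<close>, and \<open>t\<close> may tend to 0.\<close>

proposition hyperbolically_embedded_imp_constant:
  assumes he: "hyperbolically_embedded I Y" and g: "proj_hol I UNIV g" "range g \<subseteq> Y"
  shows "g constant_on UNIV"
proof (rule ccontr)
  assume "\<not> ?thesis"
  then obtain a b where ab: "g a \<noteq> g b" unfolding constant_on_def by metis
  have "Y \<subseteq> topspace (proj_topology I)"
    using he openin_subset[of "proj_topology I" Y] by (simp add: hyperbolically_embedded_def)
  then have cl: "Y \<subseteq> proj_topology I closure_of Y" by (rule closure_of_subset)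
  have "g a \<in> proj_topology I closure_of Y" "g b \<in> proj_topology I closure_of Y" using cl g(2) by auto
  then obtain U V where UV: "g a \<in> U" "g b \<in> V" "kobayashi_setdist I Y (U \<inter> Y) (V \<inter> Y) > 0"
    using he ab unfolding hyperbolically_embedded_def by blast
  have le: "kobayashi_setdist I Y (U \<inter> Y) (V \<inter> Y) \<le> ennreal (2 * artanh (inverse (real (Suc (Suc m)))))" for m
  proof -
    \<comment> \<open>Starting the sequence at 1/2 keeps \<open>t\<close> inside the open unit disc
      for every \<open>m\<close>.\<close>
    define t where "t = inverse (real (Suc (Suc m)))"
    have t: "0 < t" "t < 1" by (auto simp: t_def field_simps)
    let ?f = "\<lambda>z. g (a + (b - a) * of_real (1 / t) * z)"
    have "proj_hol I (ball 0 1) ?f"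
      by (rule proj_hol_compose[OF g(1)]) (auto intro!: holomorphic_intros)
    then have "holomorphic_map (ball 0 1) I Y ?f" using g(2) by (auto simp: holomorphic_map_iff)
    moreover have "?f 0 = g a" "?f (of_real t) = g b" using t by auto
    moreover have "complex_of_real t \<in> ball 0 1" using t by simp
    ultimately have "disc_chain I Y (g a) (g b) 1 (\<lambda>l. if l = 0 then g a else g b) (\<lambda>_. ?f) (\<lambda>_. 0) (\<lambda>_. of_real t)"
      by (simp add: disc_chain_def)
    then have "kobayashi_dist I Y (g a) (g b) \<le> ennreal (\<Sum>l<1::nat. poincare_dist 0 (of_real t))"
      unfolding kobayashi_dist_def
      by (intro Inf_lower CollectI exI[of _ "1 :: nat"] exI[of _ "\<lambda>l. if l = 0 then g a else g b"]
          exI[of _ "\<lambda>_ :: nat. ?f"] exI[of _ "\<lambda>_ :: nat. 0 :: complex"] exI[of _ "\<lambda>_ :: nat. complex_of_real t"] conjI refl)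
    also have "(\<Sum>l<1::nat. poincare_dist 0 (of_real t)) = 2 * artanh t"
      using t by (simp add: poincare_dist_def Moebius_function_simple)
    finally have "kobayashi_dist I Y (g a) (g b) \<le> ennreal (2 * artanh (inverse (real (Suc (Suc m)))))"
      unfolding t_def .
    moreover have "kobayashi_setdist I Y (U \<inter> Y) (V \<inter> Y) \<le> kobayashi_dist I Y (g a) (g b)"
      unfolding kobayashi_setdist_def by (rule INF_lower2[of "g a"], use UV g(2) in blast, rule INF_lower, use UV g(2) in blast)
    ultimately show ?thesis by order
  qed
  have "(\<lambda>m. 2 * artanh (inverse (real (Suc (Suc m))))) \<longlonglongrightarrow> 2 * artanh 0"
    by (intro tendsto_intros LIMSEQ_Suc[OF LIMSEQ_inverse_real_of_nat]) auto
  then have "(\<lambda>m. ennreal (2 * artanh (inverse (real (Suc (Suc m)))))) \<longlonglongrightarrow> ennreal 0"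
    by (intro tendsto_ennrealI) simp
  then have "kobayashi_setdist I Y (U \<inter> Y) (V \<inter> Y) \<le> ennreal 0"
    using le by (intro tendsto_lowerbound[where f = "\<lambda>m. ennreal (2 * artanh (inverse (real (Suc (Suc m)))))"]) auto
  then show False using UV(3) by simp
qed

lemma discs_bounded_imp:
  assumes "discs_bounded n d F C"
  shows "hyperbolic_form n d F"
    "hyperbolically_embedded {..n} (proj_space {..n} - hypersurface n d (proj_point F))"
proof -
  show "hyperbolic_form n d F"
    unfolding hyperbolic_form_def
  proof (intro allI impI, rule ccontr)
    fix g assume g: "proj_hol {..n} UNIV g \<and> range g \<subseteq> hypersurface n d (proj_point F)"
      "\<not> g constant_on UNIV"
    obtain a r where "proj_hol {..n} (ball 0 1) (\<lambda>z. g (a + of_real r * z))"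
      "fspeed {..n} (\<lambda>z. g (a + of_real r * z)) 0 = max 0 C + 1"
      by (rule fast_disc[OF conjunct1[OF g(1)] g(2) finite_atMost, of "max 0 C + 1"]) auto
    moreover have "in_or_avoids n d F (ball 0 1) (\<lambda>z. g (a + of_real r * z))"
      using g(1) by (auto simp: in_or_avoids_def)
    ultimately show False using assms unfolding discs_bounded_def by fastforce
  qed
  show "hyperbolically_embedded {..n} (proj_space {..n} - hypersurface n d (proj_point F))"
  proof (rule hyperbolically_embeddedI[OF finite_atMost openin_complement_hypersurface])
    fix f assume "proj_hol {..n} (ball 0 1) f" "f ` ball 0 1 \<subseteq> proj_space {..n} - hypersurface n d (proj_point F)"
    then show "fspeed {..n} f 0 \<le> C"
      using assms unfolding discs_bounded_def in_or_avoids_def by blast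
  qed
qed

text \<open>A Brody curve inside the hypersurface contradicts its hyperbolicity, and one outside
  contradicts the hyperbolic embedding; so \<open>discs_bounded_near\<close> applies. For the
  converse the bound is read off at \<open>G = F\<close>.\<close>

proposition HE_Int_H_iff:
  assumes F: "F \<in> nonzero_vecs (monomials n d)"
  shows "proj_point F \<in> HE n d \<inter> H n d \<longleftrightarrow> (\<exists>e>0. \<exists>C. \<forall>G. near_form n d e F G \<longrightarrow> discs_bounded n d G C)"
proof
  assume a: "proj_point F \<in> HE n d \<inter> H n d"
  have "\<not> in_or_avoids n d F UNIV g" if "brody_curve n g" for g
  proof
    assume io: "in_or_avoids n d F UNIV g"
    have g: "proj_hol {..n} UNIV g" "\<not> g constant_on UNIV" using that by (auto simp: brody_curve_def)
    have hf: "hyperbolic_form n d F"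
      using a by (simp add: H_def hyperbolic_form_iff)
    have he: "hyperbolically_embedded {..n} (proj_space {..n} - hypersurface n d (proj_point F))"
      using a by (simp add: HE_def)
    show False
    proof (cases "range g \<subseteq> hypersurface n d (proj_point F)")
      case True
      then show False using hf g unfolding hyperbolic_form_def by simp
    next
      case False
      with io have "range g \<inter> hypersurface n d (proj_point F) = {}" by (simp add: in_or_avoids_def)
      then have "range g \<subseteq> proj_space {..n} - hypersurface n d (proj_point F)"
        using proj_hol_in_space[OF g(1)] by auto
      then show False using hyperbolically_embedded_imp_constant[OF he g(1)] g(2) by simp
    qed
  qed
  from discs_bounded_near[OF this] show "\<exists>e>0. \<exists>C. \<forall>G. near_form n d e F G \<longrightarrow> discs_bounded n d G C"
    by metis
next
  assume "\<exists>e>0. \<exists>C. \<forall>G. near_form n d e F G \<longrightarrow> discs_bounded n d G C"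
  then obtain e C where "e > 0" "\<And>G. near_form n d e F G \<Longrightarrow> discs_bounded n d G C" by blast
  then have "discs_bounded n d F C" by (simp add: near_form_def)
  from discs_bounded_imp[OF this] show "proj_point F \<in> HE n d \<inter> H n d"
    using F by (auto simp: HE_def H_def hypersurface_space_def proj_space_def hyperbolic_form_iff)
qed

text \<open>One constant serves all forms near \<open>F\<close>, so these belong to the set too.
  \<open>near_form\<close> restricts finitely many coefficients, hence is open in the product
  topology.\<close>

theorem openin_HE_Int_H: "openin (proj_topology (monomials n d)) (HE n d \<inter> H n d)"
  unfolding openin_proj_topology
proof
  show "HE n d \<inter> H n d \<subseteq> proj_space (monomials n d)"
    by (auto simp: H_def hypersurface_space_def)
  let ?N = "nonzero_vecs (monomials n d)"
  let ?A = "{F \<in> ?N. proj_point F \<in> HE n d \<inter> H n d}"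
  have "\<exists>T. open T \<and> F \<in> T \<and> ?N \<inter> T \<subseteq> ?A" if "F \<in> ?A" for F
  proof -
    from that have F: "F \<in> ?N" "proj_point F \<in> HE n d \<inter> H n d" by auto
    from F(2)[unfolded HE_Int_H_iff[OF F(1)]]
    obtain e C where e: "e > 0" "\<And>G. near_form n d e F G \<Longrightarrow> discs_bounded n d G C" by blast
    have "{G. near_form n d e F G} = (\<Inter>\<alpha>\<in>monomials n d. {G. cmod (G \<alpha> - F \<alpha>) < e})"
      by (auto simp: near_form_def)
    moreover have "open {G. cmod (G \<alpha> - F \<alpha>) < e}" for \<alpha>
      by (intro open_Collect_less continuous_intros continuous_on_product_then_coordinatewise[OF continuous_on_id])
    ultimately have "open {G. near_form n d e F G}"
      by (simp add: open_INT finite_monomials)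
    moreover have "F \<in> {G. near_form n d e F G}" using e(1) by (simp add: near_form_def)
    moreover have "?N \<inter> {G. near_form n d e F G} \<subseteq> ?A"
    proof
      fix G assume G: "G \<in> ?N \<inter> {G. near_form n d e F G}"
      then have "discs_bounded n d G C" using e(2) by blast
      from discs_bounded_imp[OF this] show "G \<in> ?A"
        using G by (auto simp: HE_def H_def hypersurface_space_def proj_space_def hyperbolic_form_iff)
    qed
    ultimately show ?thesis by blast
  qed
  then have "\<exists>T. openin (top_of_set ?N) T \<and> F \<in> T \<and> T \<subseteq> ?A" if "F \<in> ?A" for F
    using that openin_open_Int by blast
  then show "openin (top_of_set ?N) ?A" by (subst openin_subopen) blast
qed

section \<open>Entire units of finite order\<close>

text \<open>After division by one exponential, one of the terms is a polynomial. Differentiation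
  lowers its degree until it disappears, while the operator induced on each other coefficient,
  \<open>pderiv q + q * pderiv r\<close> with nonconstant \<open>r\<close>, is injective; this
  reduces the number of terms.\<close>

lemma exp_poly_independent:
  fixes p q :: "'a \<Rightarrow> complex poly"
  assumes "finite A"
    and "\<And>i j. i \<in> A \<Longrightarrow> j \<in> A \<Longrightarrow> i \<noteq> j \<Longrightarrow> degree (p i - p j) > 0"
    and "\<And>z. (\<Sum>i\<in>A. poly (q i) z * exp (poly (p i) z)) = 0"
  shows "\<forall>i\<in>A. q i = 0"
  using assms
proof (induction A arbitrary: p q rule: finite_induct)
  case (insert a A)
  define r where "r = (\<lambda>i. p i - p a)"
  have r1: "degree (r i) > 0" if "i \<in> A" for i
    using insert.prems(1)[of i a] insert.hyps that by (auto simp: r_def)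
  have r2: "degree (r i - r j) > 0" if "i \<in> A" "j \<in> A" "i \<noteq> j" for i j
    using insert.prems(1)[of i j] that by (simp add: r_def)
  have main: "\<forall>i\<in>A. q i = 0"
    if "\<And>z. poly q0 z + (\<Sum>i\<in>A. poly (q i) z * exp (poly (r i) z)) = 0" for q0 and q :: "'a \<Rightarrow> complex poly"
    using that
  \<comment> \<open>Counting the zero polynomial as 0 and adding 1 otherwise, the measure also drops
    when a nonzero constant is differentiated.\<close>
  proof (induction "if q0 = 0 then 0 else Suc (degree q0)" arbitrary: q0 q rule: less_induct)
    case less
    show ?case
    proof (cases "q0 = 0")
      case True
      then show ?thesis using insert.IH[of r q, OF r2] less.prems by simp
    next
      case False
      define q' where "q' = (\<lambda>i. pderiv (q i) + q i * pderiv (r i))"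
      have "poly (pderiv q0) z + (\<Sum>i\<in>A. poly (q' i) z * exp (poly (r i) z)) = 0" for z
      proof -
        have "((\<lambda>z. poly q0 z + (\<Sum>i\<in>A. poly (q i) z * exp (poly (r i) z))) has_field_derivative
           poly (pderiv q0) z + (\<Sum>i\<in>A. poly (q' i) z * exp (poly (r i) z))) (at z)"
          by (rule derivative_eq_intros poly_DERIV refl)+
            (auto simp: q'_def algebra_simps intro!: sum.cong)
        moreover have "((\<lambda>z. poly q0 z + (\<Sum>i\<in>A. poly (q i) z * exp (poly (r i) z))) has_field_derivative 0) (at z)"
          using less.prems by simp
        ultimately show ?thesis by (rule DERIV_unique)
      qed
      moreover have "(if pderiv q0 = 0 then 0 else Suc (degree (pderiv q0))) < (if q0 = 0 then 0 else Suc (degree q0))"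
        using False by (auto simp: degree_pderiv pderiv_eq_0_iff)
      ultimately have q': "q' i = 0" if "i \<in> A" for i using less.hyps that by blast
      show ?thesis
      proof (rule ballI, rule ccontr)
        fix i assume i: "i \<in> A" and qi: "q i \<noteq> 0"
        \<comment> \<open>If \<open>q' i\<close> vanished with \<open>q i\<close> nonzero, then
          \<open>pderiv (q i)\<close> would have degree at least that of \<open>q i\<close>.\<close>
        have pr: "pderiv (r i) \<noteq> 0" using r1[OF i] by (simp add: pderiv_eq_0_iff)
        have eq: "pderiv (q i) = - (q i * pderiv (r i))"
          using q'[OF i] by (simp add: q'_def eq_neg_iff_add_eq_0)
        then have "pderiv (q i) \<noteq> 0" using qi pr by simp
        then have "degree (q i) > 0" by (metis gr0I pderiv_eq_0_iff)
        moreover have "degree (pderiv (q i)) = degree (q i) + degree (pderiv (r i))"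
          using eq qi pr by (simp add: degree_mult_eq)
        ultimately show False by (simp add: degree_pderiv)
      qed
    qed
  qed
  have sum0: "poly (q a) z + (\<Sum>i\<in>A. poly (q i) z * exp (poly (r i) z)) = 0" for z
  proof -
    have "(poly (q a) z + (\<Sum>i\<in>A. poly (q i) z * exp (poly (r i) z))) * exp (poly (p a) z) =
      (\<Sum>i\<in>insert a A. poly (q i) z * exp (poly (p i) z))"
      using insert.hyps by (simp add: r_def exp_diff distrib_right sum_distrib_right)
    also have "\<dots> = 0" by (rule insert.prems(2))
    finally show ?thesis by simp
  qed
  have A: "\<forall>i\<in>A. q i = 0" by (rule main[OF sum0])
  then have "poly (q a) z = 0" for z using sum0[of z] by simp
  then have "q a = 0" using poly_all_0_iff_0 by blast
  with A show ?case by simp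
qed simp

text \<open>Borel's theorem for units with polynomial exponents: a vanishing sum splits into vanishing
  sums of proportional units.\<close>

lemma exp_poly_sum_class:
  fixes p :: "'a \<Rightarrow> complex poly"
  assumes A: "finite A" "a \<in> A" and sum0: "\<And>z. (\<Sum>i\<in>A. exp (poly (p i) z)) = 0"
  shows "(\<Sum>i | i \<in> A \<and> degree (p i - p a) = 0. exp (poly (p i) z)) = 0"
proof -
  \<comment> \<open>With the constant terms moved into coefficients, proportional units acquire
    equal exponents and distinct exponents have nonconstant differences; so the classes are the
    fibres of \<open>P\<close>.\<close>
  define c where "c = (\<lambda>i. coeff (p i) 0)"
  define P where "P = (\<lambda>i. p i - [:c i:])"
  have pP: "exp (poly (p i) z) = exp (c i) * exp (poly (P i) z)" for i z
    by (simp add: P_def exp_add[symmetric])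
  have P0: "coeff (P i) 0 = 0" for i by (simp add: P_def c_def)
  have cls: "degree (p i - p j) = 0 \<longleftrightarrow> P i = P j" for i j
  proof
    assume "degree (p i - p j) = 0"
    then obtain e where e: "p i - p j = [:e:]" by (rule degree_eq_zeroE)
    then have "c i - c j = e" unfolding c_def coeff_diff[symmetric] by simp
    with e show "P i = P j" by (auto simp: P_def algebra_simps) 
  next
    assume "P i = P j"
    moreover have "p i = P i + [:c i:]" "p j = P j + [:c j:]" by (simp_all add: P_def)
    ultimately have "p i - p j = [:c i:] - [:c j:]" by (metis add_diff_cancel_left)
    then show "degree (p i - p j) = 0" by simp
  qed
  define q where "q = (\<lambda>R. [:(\<Sum>i | i \<in> A \<and> P i = R. exp (c i)):])"
  have "\<forall>R\<in>P ` A. q R = 0"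
  proof (rule exp_poly_independent)
    show "degree (R - S) > 0" if "R \<in> P ` A" "S \<in> P ` A" "R \<noteq> S" for R S
    proof (rule ccontr)
      assume "\<not> ?thesis"
      then obtain e where e: "R - S = [:e:]" using degree_eq_zeroE by blast
      have "coeff (R - S) 0 = 0" using that P0 by auto
      then show False using e that by simp
    qed
    fix z
    have "(\<Sum>R\<in>P ` A. poly (q R) z * exp (poly R z)) =
      (\<Sum>R\<in>P ` A. \<Sum>i | i \<in> A \<and> P i = R. exp (poly (p i) z))"
      by (intro sum.cong refl) (auto simp: q_def pP sum_distrib_right)
    also have "\<dots> = 0" using A(1) by (simp add: sum.image_gen[OF A(1), symmetric] sum0)
    finally show "(\<Sum>R\<in>P ` A. poly (q R) z * exp (poly R z)) = 0" .
  qed (use A in auto)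
  then have "(\<Sum>i | i \<in> A \<and> P i = P a. exp (c i)) = 0" using A(2) by (auto simp: q_def)
  then have "(\<Sum>i | i \<in> A \<and> P i = P a. exp (c i) * exp (poly (P a) z)) = 0"
    by (simp add: sum_distrib_right[symmetric])
  also have "(\<Sum>i | i \<in> A \<and> P i = P a. exp (c i) * exp (poly (P a) z)) =
    (\<Sum>i | i \<in> A \<and> degree (p i - p a) = 0. exp (poly (p i) z))"
    by (intro sum.cong) (auto simp: cls pP)
  finally show ?thesis .
qed

section \<open>Taylor coefficients and circle means of the real part\<close>

lemma fourier_coefficient:
  fixes f :: "complex \<Rightarrow> complex"
  assumes f: "f holomorphic_on UNIV" and r: "r > 0"
  shows "((\<lambda>t. f (of_real r * cis t) / cis t ^ k) has_integral
    2 * pi * of_real r ^ k * ((deriv ^^ k) f 0 / fact k)) {0..2*pi}"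
proof -
  have "((\<lambda>u. f u / (u - 0) ^ Suc k) has_contour_integral (2 * pi * \<i>) / fact k * (deriv ^^ k) f 0) (circlepath 0 r)"
    by (rule Cauchy_has_contour_integral_higher_derivative_circlepath)
      (use f r in \<open>auto intro: holomorphic_on_imp_continuous_on holomorphic_on_subset\<close>)
  then have "((\<lambda>t. f (0 + of_real r * cis t) / (0 + of_real r * cis t - 0) ^ Suc k * of_real r * \<i> * cis t)
     has_integral (2 * pi * \<i>) / fact k * (deriv ^^ k) f 0) {0..2*pi}"
    unfolding circlepath_def by (subst (asm) has_contour_integral_part_circlepath_iff) auto
  from has_integral_mult_right[OF this, of "of_real r ^ k / \<i>"]
  have "((\<lambda>t. of_real r ^ k / \<i> * (f (0 + of_real r * cis t) / (0 + of_real r * cis t - 0) ^ Suc k * of_real r * \<i> * cis t))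
     has_integral of_real r ^ k / \<i> * ((2 * pi * \<i>) / fact k * (deriv ^^ k) f 0)) {0..2*pi}" .
  moreover have "of_real r ^ k / \<i> * (f (0 + of_real r * cis t) / (0 + of_real r * cis t - 0) ^ Suc k * of_real r * \<i> * cis t)
      = f (of_real r * cis t) / cis t ^ k" for t
  proof -
    have "\<i> * (x * \<i>) = - x" for x by (simp add: mult.left_commute[of \<i> x \<i>])
    then show ?thesis using r by (simp add: power_mult_distrib)
  qed
  ultimately show ?thesis by (simp add: mult_ac)
qed

lemma fourier_coefficient_negative:
  fixes f :: "complex \<Rightarrow> complex"
  assumes f: "f holomorphic_on UNIV" and r: "r > 0" and k: "k > 0"
  shows "((\<lambda>t. f (of_real r * cis t) * cis t ^ k) has_integral 0) {0..2*pi}"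
proof -
  have "((\<lambda>u. f u * u ^ (k - 1)) has_contour_integral 0) (circlepath 0 r)"
    by (rule Cauchy_theorem_convex_simple[of _ UNIV]) (use f in \<open>auto intro!: holomorphic_intros\<close>)
  then have "((\<lambda>t. f (0 + of_real r * cis t) * (0 + of_real r * cis t) ^ (k - 1) * of_real r * \<i> * cis t)
     has_integral 0) {0..2*pi}"
    unfolding circlepath_def by (subst (asm) has_contour_integral_part_circlepath_iff) auto
  from has_integral_mult_right[OF this, of "1 / (\<i> * of_real r ^ k)"]
  have "((\<lambda>t. 1 / (\<i> * of_real r ^ k) * (f (0 + of_real r * cis t) * (0 + of_real r * cis t) ^ (k - 1) * of_real r * \<i> * cis t))
     has_integral 0) {0..2*pi}" by simp
  moreover have "1 / (\<i> * of_real r ^ k) * (f (0 + of_real r * cis t) * (0 + of_real r * cis t) ^ (k - 1) * of_real r * \<i> * cis t)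
     = f (of_real r * cis t) * cis t ^ k" for t
  proof -
    have "1 / (\<i> * of_real r ^ k) * (f (0 + of_real r * cis t) * (0 + of_real r * cis t) ^ (k - 1) * of_real r * \<i> * cis t)
       = f (of_real r * cis t) * ((of_real r * cis t) ^ (k - 1) * (of_real r * cis t)) / of_real r ^ k"
      using r by (simp add: field_simps)
    also have "(of_real r * cis t) ^ (k - 1) * (of_real r * cis t) = of_real r ^ k * cis t ^ k"
      by (subst power_minus_mult[OF k]) (rule power_mult_distrib)
    finally show ?thesis using r by simp
  qed
  ultimately show ?thesis by simp
qed

lemma integrable_on_circle:
  fixes h :: "complex \<Rightarrow> real"
  assumes "continuous_on UNIV h"
  shows "(\<lambda>t. h (of_real r * cis t)) integrable_on {0..2*pi}"
  by (intro integrable_continuous_real continuous_on_compose2[OF assms] continuous_intros) auto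

text \<open>The Fourier coefficient of index \<open>- k\<close> vanishes. Adding its conjugate to
  the one of index \<open>k\<close> replaces \<open>f\<close> by twice its real part under the
  integral.\<close>

lemma coefficient_le_mean_Re:
  fixes f :: "complex \<Rightarrow> complex"
  assumes f: "f holomorphic_on UNIV" and r: "r > 0" and k: "k > 0"
  shows "pi * r ^ k * cmod ((deriv ^^ k) f 0 / fact k) \<le> integral {0..2*pi} (\<lambda>t. \<bar>Re (f (of_real r * cis t))\<bar>)"
proof -
  let ?c = "(deriv ^^ k) f 0 / fact k"
  have "((\<lambda>t. cnj (f (of_real r * cis t) * cis t ^ k)) has_integral cnj 0) {0..2*pi}"
    using has_integral_linear[OF fourier_coefficient_negative[OF assms] bounded_linear_cnj] by (simp add: o_def)
  from has_integral_add[OF fourier_coefficient[OF f r, of k] this]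
  have "((\<lambda>t. f (of_real r * cis t) / cis t ^ k + cnj (f (of_real r * cis t) * cis t ^ k)) has_integral
     2 * pi * of_real r ^ k * ?c) {0..2*pi}" by simp
  moreover have "f (of_real r * cis t) / cis t ^ k + cnj (f (of_real r * cis t) * cis t ^ k) =
     of_real (2 * Re (f (of_real r * cis t))) / cis t ^ k" for t
  proof -
    have "cnj (cis t) = inverse (cis t)" by (simp add: cis_cnj)
    then have "cnj (cis t ^ k) = inverse (cis t ^ k)" by (simp only: complex_cnj_power power_inverse)
    then have "f (of_real r * cis t) / cis t ^ k + cnj (f (of_real r * cis t) * cis t ^ k) =
      (f (of_real r * cis t) + cnj (f (of_real r * cis t))) / cis t ^ k"
      by (simp only: complex_cnj_mult divide_inverse distrib_right)
    then show ?thesis by (simp only: complex_add_cnj)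
  qed
  ultimately have I: "((\<lambda>t. of_real (2 * Re (f (of_real r * cis t))) / cis t ^ k) has_integral
     2 * pi * of_real r ^ k * ?c) {0..2*pi}" by simp
  have cont: "continuous_on UNIV (\<lambda>z. \<bar>Re (f z)\<bar>)"
    by (intro continuous_intros holomorphic_on_imp_continuous_on f)
  have "cmod (2 * pi * of_real r ^ k * ?c) \<le> integral {0..2*pi} (\<lambda>t. 2 * \<bar>Re (f (of_real r * cis t))\<bar>)"
    unfolding integral_unique[OF I, symmetric]
  proof (rule integral_norm_bound_integral)
    show "(\<lambda>t. 2 * \<bar>Re (f (of_real r * cis t))\<bar>) integrable_on {0..2*pi}"
      using integrable_on_circle[OF cont] by (rule integrable_on_mult_right)
  qed (use I in \<open>auto simp: norm_divide norm_mult norm_power has_integral_integrable\<close>)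
  also have "\<dots> = 2 * integral {0..2*pi} (\<lambda>t. \<bar>Re (f (of_real r * cis t))\<bar>)" by simp
  also have "cmod (2 * pi * of_real r ^ k * ?c) = 2 * (pi * r ^ k * cmod ?c)"
    using r by (simp only: norm_mult norm_power norm_of_real) simp
  finally show ?thesis by simp
qed

text \<open>With radius \<open>r = exp x\<close> the hypothesis says that the means are
  \<open>O(r^2)\<close>, so all Taylor coefficients of index at least 3 vanish. The exponential
  variable matches the logarithmic coordinate used for the means.\<close>

lemma entire_mean_Re_imp_poly:
  fixes f :: "complex \<Rightarrow> complex"
  assumes f: "f holomorphic_on UNIV"
    and b: "\<And>x. x \<ge> 0 \<Longrightarrow> integral {0..2*pi} (\<lambda>t. \<bar>Re (f (of_real (exp x) * cis t))\<bar>) \<le> C * exp (2 * x)"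
  obtains p where "\<And>z. f z = poly p z"
proof -
  have z: "(deriv ^^ k) f 0 / fact k = 0" if k: "k \<ge> 3" for k
  proof (rule ccontr)
    let ?c = "cmod ((deriv ^^ k) f 0 / fact k)"
    assume "(deriv ^^ k) f 0 / fact k \<noteq> 0"
    then have c: "?c > 0" by simp
    \<comment> \<open>For \<open>k \<ge> 3\<close> the quotient of \<open>r ^ k\<close> and
      \<open>r ^ 2\<close> is at least \<open>1 + x\<close>; this linear growth already contradicts
      a constant bound.\<close>
    have le: "pi * ?c * (1 + x) \<le> C" if x: "x \<ge> 0" for x
    proof -
      have "exp x ^ k = exp (2 * x) * exp ((real k - 2) * x)"
        by (simp add: exp_of_nat_mult[symmetric] exp_add[symmetric] algebra_simps)
      moreover have "exp ((real k - 2) * x) \<ge> exp x"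
        using k x mult_right_mono[of 1 "real k - 2" x] by simp
      then have "exp ((real k - 2) * x) \<ge> 1 + x" using exp_ge_add_one_self[of x] by linarith
      ultimately have "exp x ^ k \<ge> exp (2 * x) * (1 + x)" by simp
      then have "pi * ?c * (exp (2 * x) * (1 + x)) \<le> pi * ?c * exp x ^ k"
        using c by (intro mult_left_mono) auto
      also have "\<dots> = pi * exp x ^ k * ?c" by simp
      also have "\<dots> \<le> C * exp (2 * x)"
        using coefficient_le_mean_Re[OF f, of "exp x" k] b[OF x] k by force
      finally have "(pi * ?c * (1 + x)) * exp (2 * x) \<le> C * exp (2 * x)" by (simp add: mult_ac)
      then show ?thesis by simp
    qed
    define x where "x = \<bar>C\<bar> / (pi * ?c)"
    have "x \<ge> 0" using c by (simp add: x_def)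
    then have "pi * ?c * (1 + x) \<le> C" by (rule le)
    moreover have "pi * ?c * x = \<bar>C\<bar>" using c by (simp add: x_def)
    moreover have "pi * ?c * (1 + x) = pi * ?c + pi * ?c * x" by (simp add: distrib_left)
    moreover have "pi * ?c > 0" using c by simp
    ultimately show False by linarith
  qed
  let ?a = "\<lambda>k. (deriv ^^ k) f 0 / fact k"
  have "f w = poly [:?a 0, ?a 1, ?a 2:] w" for w
  proof -
    have "((\<lambda>k. ?a k * (w - 0) ^ k) sums f w)"
      by (rule holomorphic_power_series[of f 0 "norm w + 1"]) (use f holomorphic_on_subset in auto)
    moreover have "((\<lambda>k. ?a k * (w - 0) ^ k) sums (\<Sum>k\<in>{..<3}. ?a k * (w - 0) ^ k))"
      by (rule sums_finite) (use z in auto)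
    ultimately have "f w = (\<Sum>k\<in>{..<3}. ?a k * (w - 0) ^ k)" by (rule sums_unique2)
    then show ?thesis by (simp add: eval_nat_numeral algebra_simps)
  qed
  then show ?thesis by (rule that)
qed

section \<open>Growth of logarithmic circle means for a lift of bounded speed\<close>

lemma convexity_lower_bound:
  fixes f :: "real \<Rightarrow> real"
  assumes f1: "\<And>x. (f has_real_derivative f1 x) (at x)" and f2: "\<And>x. (f1 has_real_derivative f2 x) (at x)"
    and nn: "\<And>x. f2 x \<ge> 0" and x: "x \<ge> 0"
  shows "f x \<ge> f 0 + f1 0 * x"
proof -
  have mono: "f1 0 \<le> f1 y" if "y \<ge> 0" for y
    using f2 nn by (intro DERIV_nonneg_imp_nondecreasing[OF that]) blast
  have "f 0 - f1 0 * 0 \<le> f x - f1 0 * x"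
  proof (rule DERIV_nonneg_imp_nondecreasing[OF x])
    fix y assume "0 \<le> y" "y \<le> x"
    have "((\<lambda>x. f x - f1 0 * x) has_real_derivative f1 y - f1 0) (at y)"
      by (auto intro!: derivative_eq_intros f1)
    then show "\<exists>D. ((\<lambda>x. f x - f1 0 * x) has_real_derivative D) (at y) \<and> D \<ge> 0"
      using mono[OF \<open>0 \<le> y\<close>] by (intro exI[of _ "f1 y - f1 0"]) auto
  qed
  then show ?thesis by simp
qed

text \<open>In the logarithmic coordinate \<open>Complex x t\<close> the circle means of \<open>L\<close> are means over vertical
  segments, whose second derivative in \<open>x\<close> is the mean of the Laplacian, as \<open>M1\<close> is periodic.\<close>

lemma circle_mean_growth:
  fixes L L1 L2 M1 M2 :: "complex \<Rightarrow> real"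
  assumes d1: "\<And>x t. ((\<lambda>x. L (Complex x t)) has_real_derivative L1 (Complex x t)) (at x)"
    and d2: "\<And>x t. ((\<lambda>x. L1 (Complex x t)) has_real_derivative L2 (Complex x t)) (at x)"
    and d3: "\<And>x t. ((\<lambda>t. M1 (Complex x t)) has_real_derivative M2 (Complex x t)) (at t)"
    and c: "continuous_on UNIV L" "continuous_on UNIV L1" "continuous_on UNIV L2" "continuous_on UNIV M2"
    and per: "\<And>x. M1 (Complex x (2 * pi)) = M1 (Complex x 0)"
    and lap: "\<And>x t. L2 (Complex x t) + M2 (Complex x t) \<le> K * exp (2 * x)"
    and K: "K \<ge> 0"
  obtains C where "C \<ge> 0" "\<And>x. x \<ge> 0 \<Longrightarrow> integral {0..2*pi} (\<lambda>t. L (Complex x t)) \<le> C * exp (2 * x)"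
proof -
  have cont: "continuous_on A (\<lambda>t. G (Complex x t))" if "continuous_on UNIV G" for G :: "complex \<Rightarrow> real" and x A
    unfolding Complex_eq by (intro continuous_on_compose2[OF that] continuous_intros) auto
  have int: "(\<lambda>t. G (Complex x t)) integrable_on {0..2*pi}" if "continuous_on UNIV G" for G :: "complex \<Rightarrow> real" and x
    by (rule integrable_continuous_real[OF cont[OF that]])
  have leib: "((\<lambda>x. integral {0..2*pi} (\<lambda>t. G (Complex x t))) has_real_derivative
      integral {0..2*pi} (\<lambda>t. G' (Complex x t))) (at x)"
    if d: "\<And>x t. ((\<lambda>x. G (Complex x t)) has_real_derivative G' (Complex x t)) (at x)"
      and "continuous_on UNIV G" "continuous_on UNIV G'" for G G' :: "complex \<Rightarrow> real" and x
    unfolding box_real(2)[symmetric]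
  proof (rule leibniz_rule_field_derivative[where U = UNIV])
    show "(\<lambda>t. G (Complex y t)) integrable_on cbox 0 (2 * pi)" for y
      using int[OF that(2)] by simp
    show "continuous_on (UNIV \<times> cbox 0 (2 * pi)) (\<lambda>(x, t). G' (Complex x t))"
      unfolding split_beta Complex_eq
      by (intro continuous_on_compose2[OF that(3)] continuous_intros) auto
  qed (use d in auto)
  define \<Phi> where "\<Phi> = (\<lambda>x. integral {0..2*pi} (\<lambda>t. L (Complex x t)))"
  define \<Phi>1 where "\<Phi>1 = (\<lambda>x. integral {0..2*pi} (\<lambda>t. L1 (Complex x t)))"
  define \<Phi>2 where "\<Phi>2 = (\<lambda>x. integral {0..2*pi} (\<lambda>t. L2 (Complex x t)))"
  have \<Phi>1: "(\<Phi> has_real_derivative \<Phi>1 x) (at x)" for x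
    unfolding \<Phi>_def \<Phi>1_def by (rule leib[OF d1 c(1,2)])
  have \<Phi>2: "(\<Phi>1 has_real_derivative \<Phi>2 x) (at x)" for x
    unfolding \<Phi>1_def \<Phi>2_def by (rule leib[OF d2 c(2,3)])
  have le: "\<Phi>2 x \<le> 2 * pi * K * exp (2 * x)" for x
  proof -
    have "((\<lambda>t. M2 (Complex x t)) has_integral M1 (Complex x (2 * pi)) - M1 (Complex x 0)) {0..2*pi}"
    proof (rule fundamental_theorem_of_calculus)
      fix t assume "t \<in> {0..2 * pi}"
      show "((\<lambda>t. M1 (Complex x t)) has_vector_derivative M2 (Complex x t)) (at t within {0..2*pi})"
        using d3[of x t] by (simp add: has_real_derivative_iff_has_vector_derivative has_vector_derivative_at_within)
    qed simp
    then have M: "((\<lambda>t. M2 (Complex x t)) has_integral 0) {0..2*pi}" by (simp add: per)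
    have "((\<lambda>t. L2 (Complex x t) + M2 (Complex x t)) has_integral \<Phi>2 x + 0) {0..2*pi}"
      unfolding \<Phi>2_def by (rule has_integral_add[OF integrable_integral[OF int[OF c(3)]] M])
    moreover have "((\<lambda>t. K * exp (2 * x)) has_integral (2 * pi) * (K * exp (2 * x))) {0..2*pi}"
      using has_integral_const_real[of "K * exp (2 * x)" 0 "2 * pi"] by simp
    ultimately have "\<Phi>2 x + 0 \<le> (2 * pi) * (K * exp (2 * x))"
      by (rule has_integral_le) (rule lap)
    then show ?thesis by simp
  qed
  \<comment> \<open>The second derivative of \<open>c0 * exp (2 * x)\<close> is exactly the bound
    \<open>2 * pi * K * exp (2 * x)\<close> for \<Phi>2, so the difference with \<Phi> is convex and
    lies above its tangent at 0.\<close>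
  define c0 where "c0 = pi * K / 2"
  have "(c0 * exp (2 * x) - \<Phi> x) \<ge> (c0 * exp (2 * 0) - \<Phi> 0) + (2 * c0 * exp (2 * 0) - \<Phi>1 0) * x" if "x \<ge> 0" for x
  proof (rule convexity_lower_bound[OF _ _ _ that])
    show "((\<lambda>x. c0 * exp (2 * x) - \<Phi> x) has_real_derivative 2 * c0 * exp (2 * x) - \<Phi>1 x) (at x)" for x
      by (auto intro!: derivative_eq_intros \<Phi>1)
    show "((\<lambda>x. 2 * c0 * exp (2 * x) - \<Phi>1 x) has_real_derivative 4 * c0 * exp (2 * x) - \<Phi>2 x) (at x)" for x
      by (auto intro!: derivative_eq_intros \<Phi>2)
    show "4 * c0 * exp (2 * x) - \<Phi>2 x \<ge> 0" for x using le[of x] by (simp add: c0_def algebra_simps)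
  qed
  then have up: "\<Phi> x \<le> c0 * exp (2 * x) + (\<Phi> 0 - c0) + (\<Phi>1 0 - 2 * c0) * x" if "x \<ge> 0" for x
    using that by (force simp: algebra_simps)
  define C where "C = c0 + \<bar>\<Phi> 0 - c0\<bar> + \<bar>\<Phi>1 0 - 2 * c0\<bar>"
  show ?thesis
  proof (rule that)
    show "C \<ge> 0" using K by (simp add: C_def c0_def)
    fix x :: real assume x: "x \<ge> 0"
    have e: "1 \<le> exp (2 * x)" "x \<le> exp (2 * x)"
      using x exp_ge_add_one_self[of "2 * x"] by linarith+
    have "\<Phi> x \<le> c0 * exp (2 * x) + (\<Phi> 0 - c0) + (\<Phi>1 0 - 2 * c0) * x" by (rule up[OF x])
    also have "\<dots> \<le> c0 * exp (2 * x) + \<bar>\<Phi> 0 - c0\<bar> * 1 + \<bar>\<Phi>1 0 - 2 * c0\<bar> * x"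
      unfolding mult_1_right by (intro add_mono order_refl abs_ge_self mult_right_mono x)
    also have "\<dots> \<le> c0 * exp (2 * x) + \<bar>\<Phi> 0 - c0\<bar> * exp (2 * x) + \<bar>\<Phi>1 0 - 2 * c0\<bar> * exp (2 * x)"
      using e K by (intro add_mono mult_left_mono) (auto simp: c0_def)
    finally show "integral {0..2*pi} (\<lambda>t. L (Complex x t)) \<le> C * exp (2 * x)"
      by (simp add: C_def \<Phi>_def algebra_simps)
  qed
qed

text \<open>Lagrange's identity: \<open>P\<close> and \<open>R\<close> are the real and imaginary
  part of the Hermitian product of \<open>a\<close> and \<open>b\<close>, and each unordered pair is
  counted twice. Finally a sum of squares of nonnegative numbers is at most the square of their sum,
  which is the form in which \<open>speed\<close> enters.\<close>

lemma lagrange_bound: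
  fixes a b :: "'i \<Rightarrow> complex"
  assumes I: "finite I"
  defines "P \<equiv> \<Sum>i\<in>I. Re (a i) * Re (b i) + Im (a i) * Im (b i)"
    and "R \<equiv> \<Sum>i\<in>I. Re (a i) * Im (b i) - Im (a i) * Re (b i)"
  shows "nsq I b * nsq I a - (P\<^sup>2 + R\<^sup>2) \<le> (\<Sum>i\<in>I. \<Sum>j\<in>I. cmod (a i * b j - a j * b i))\<^sup>2 / 2"
proof -
  define p where "p = (\<lambda>i. Re (a i) * Re (b i) + Im (a i) * Im (b i))"
  define r where "r = (\<lambda>i. Re (a i) * Im (b i) - Im (a i) * Re (b i))"
  define A where "A = (\<lambda>i. (cmod (a i))\<^sup>2)"
  define B where "B = (\<lambda>i. (cmod (b i))\<^sup>2)"
  have tm: "(cmod (a i * b j - a j * b i))\<^sup>2 = A i * B j + A j * B i - 2 * (p i * p j) - 2 * (r i * r j)" for i j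
    unfolding A_def B_def p_def r_def cmod_power2 by (simp add: power2_eq_square algebra_simps)
  have "(\<Sum>i\<in>I. \<Sum>j\<in>I. (cmod (a i * b j - a j * b i))\<^sup>2) =
    (\<Sum>i\<in>I. \<Sum>j\<in>I. A i * B j) + (\<Sum>i\<in>I. \<Sum>j\<in>I. B i * A j)
      - 2 * (\<Sum>i\<in>I. \<Sum>j\<in>I. p i * p j) - 2 * (\<Sum>i\<in>I. \<Sum>j\<in>I. r i * r j)"
    by (simp add: tm sum.distrib sum_subtractf sum_distrib_left mult.commute)
  also have "\<dots> = 2 * (nsq I b * nsq I a) - 2 * (P\<^sup>2 + R\<^sup>2)"
    by (simp add: sum_product[symmetric] nsq_def A_def B_def P_def R_def p_def r_def power2_eq_square)
  finally have eq: "nsq I b * nsq I a - (P\<^sup>2 + R\<^sup>2) = (\<Sum>i\<in>I. \<Sum>j\<in>I. (cmod (a i * b j - a j * b i))\<^sup>2) / 2"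
    by simp
  have sq: "(\<Sum>s\<in>S. (x s)\<^sup>2) \<le> (\<Sum>s\<in>S. x s)\<^sup>2" if "finite S" "\<And>s. x s \<ge> 0" for S and x :: "'i \<times> 'i \<Rightarrow> real"
  proof -
    have "(\<Sum>s\<in>S. (x s)\<^sup>2) \<le> (\<Sum>s\<in>S. x s * (\<Sum>s\<in>S. x s))"
      unfolding power2_eq_square using that by (intro sum_mono mult_left_mono member_le_sum) auto
    then show ?thesis by (simp add: sum_distrib_right[symmetric] power2_eq_square)
  qed
  have "(\<Sum>i\<in>I. \<Sum>j\<in>I. (cmod (a i * b j - a j * b i))\<^sup>2) \<le> (\<Sum>i\<in>I. \<Sum>j\<in>I. cmod (a i * b j - a j * b i))\<^sup>2"
    using sq[of "I \<times> I" "\<lambda>(i, j). cmod (a i * b j - a j * b i)"] I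
    by (simp add: sum.cartesian_product split_beta)
  with eq show ?thesis by simp
qed

text \<open>The Cauchy-Riemann equations: moving along the imaginary axis multiplies the derivative
  by the imaginary unit.\<close>

lemma has_real_derivative_Complex:
  assumes "(g has_field_derivative D) (at (Complex x t))"
  shows "((\<lambda>x. Re (g (Complex x t))) has_real_derivative Re D) (at x)"
    "((\<lambda>x. Im (g (Complex x t))) has_real_derivative Im D) (at x)"
    "((\<lambda>t. Re (g (Complex x t))) has_real_derivative - Im D) (at t)"
    "((\<lambda>t. Im (g (Complex x t))) has_real_derivative Re D) (at t)"
proof -
  have "((\<lambda>x. Complex x t) has_vector_derivative 1) (at x)"
    unfolding Complex_eq by (auto intro!: derivative_eq_intros simp: has_vector_derivative_def scaleR_conv_of_real)
  from field_vector_diff_chain_at[OF this assms]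
  have 1: "((\<lambda>x. g (Complex x t)) has_vector_derivative D) (at x)" by (simp add: o_def)
  have "((\<lambda>t. Complex x t) has_vector_derivative \<i>) (at t)"
    unfolding Complex_eq by (auto intro!: derivative_eq_intros simp: has_vector_derivative_def scaleR_conv_of_real mult.commute)
  from field_vector_diff_chain_at[OF this assms]
  have 2: "((\<lambda>t. g (Complex x t)) has_vector_derivative \<i> * D) (at t)" by (simp add: o_def)
  show "((\<lambda>x. Re (g (Complex x t))) has_real_derivative Re D) (at x)"
    "((\<lambda>x. Im (g (Complex x t))) has_real_derivative Im D) (at x)"
    using bounded_linear.has_vector_derivative[OF bounded_linear_Re 1]
      bounded_linear.has_vector_derivative[OF bounded_linear_Im 1]
    by (simp_all add: has_real_derivative_iff_has_vector_derivative)
  show "((\<lambda>t. Re (g (Complex x t))) has_real_derivative - Im D) (at t)"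
    "((\<lambda>t. Im (g (Complex x t))) has_real_derivative Re D) (at t)"
    using bounded_linear.has_vector_derivative[OF bounded_linear_Re 2]
      bounded_linear.has_vector_derivative[OF bounded_linear_Im 2]
    by (simp_all add: has_real_derivative_iff_has_vector_derivative)
qed

text \<open>In the coordinate \<zeta> with \<open>z = exp \<zeta>\<close>, the Laplacian of
  \<open>ln N\<close> is four times the Gram determinant of \<open>V\<close> and its derivative
  divided by \<open>N^2\<close>. By \<open>lagrange_bound\<close> it is at most
  \<open>2 * (B * exp x)^2\<close>, the chain rule contributing \<open>exp x\<close> to the
  speed.\<close>

lemma log_nsq_growth:
  fixes v :: "complex \<Rightarrow> 'i \<Rightarrow> complex"
  assumes hol: "\<And>i. (\<lambda>z. v z i) holomorphic_on UNIV" and I: "finite I"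
    and pos: "\<And>z. nsq I (v z) > 0" and sp: "\<And>z. speed I v z \<le> B"
  obtains C where "C \<ge> 0"
    "\<And>x. x \<ge> 0 \<Longrightarrow> integral {0..2*pi} (\<lambda>t. ln (nsq I (v (of_real (exp x) * cis t)))) \<le> C * exp (2 * x)"
proof -
  define V where "V = (\<lambda>\<zeta> i. v (exp \<zeta>) i)"
  define V1 where "V1 = (\<lambda>\<zeta> i. deriv (\<lambda>z. v z i) (exp \<zeta>) * exp \<zeta>)"
  define V2 where "V2 = (\<lambda>\<zeta> i. deriv (\<lambda>\<zeta>. V1 \<zeta> i) \<zeta>)"
  have dv: "((\<lambda>z. v z i) has_field_derivative deriv (\<lambda>z. v z i) z) (at z)" for i z
    using holomorphic_derivI[OF hol] by simp
  have dV: "((\<lambda>\<zeta>. V \<zeta> i) has_field_derivative V1 \<zeta> i) (at \<zeta>)" for i \<zeta>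
    unfolding V_def V1_def by (rule DERIV_chain2[OF dv DERIV_exp])
  have V1hol: "(\<lambda>\<zeta>. V1 \<zeta> i) holomorphic_on UNIV" for i
    unfolding V1_def
    by (intro holomorphic_intros holomorphic_on_compose_gen[where g = "deriv (\<lambda>z. v z i)", unfolded o_def, of exp _ UNIV]
        holomorphic_deriv hol) auto
  have dV1: "((\<lambda>\<zeta>. V1 \<zeta> i) has_field_derivative V2 \<zeta> i) (at \<zeta>)" for i \<zeta>
    unfolding V2_def using holomorphic_derivI[OF V1hol] by simp
  have contV: "continuous_on UNIV (\<lambda>\<zeta>. V \<zeta> i)" "continuous_on UNIV (\<lambda>\<zeta>. V1 \<zeta> i)" "continuous_on UNIV (\<lambda>\<zeta>. V2 \<zeta> i)" for i
  proof -
    show "continuous_on UNIV (\<lambda>\<zeta>. V \<zeta> i)" using dV DERIV_isCont continuous_at_imp_continuous_on by blast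
    show "continuous_on UNIV (\<lambda>\<zeta>. V1 \<zeta> i)" using V1hol by (rule holomorphic_on_imp_continuous_on)
    show "continuous_on UNIV (\<lambda>\<zeta>. V2 \<zeta> i)" unfolding V2_def
      by (intro holomorphic_on_imp_continuous_on holomorphic_deriv V1hol open_UNIV)
  qed
  note D0 = has_real_derivative_Complex[OF dV]
  note D1 = has_real_derivative_Complex[OF dV1]
  \<comment> \<open>\<open>N\<close> and \<open>Q\<close> are the squared norms of \<open>V\<close>
    and \<open>V1\<close>, \<open>P\<close> and \<open>R\<close> the real and imaginary part of
    their Hermitian product, and \<open>T\<close> the real part of the product of \<open>V\<close>
    and \<open>V2\<close>.\<close>
  define N where "N = (\<lambda>\<zeta>. \<Sum>i\<in>I. (Re (V \<zeta> i))\<^sup>2 + (Im (V \<zeta> i))\<^sup>2)"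
  define P where "P = (\<lambda>\<zeta>. \<Sum>i\<in>I. Re (V \<zeta> i) * Re (V1 \<zeta> i) + Im (V \<zeta> i) * Im (V1 \<zeta> i))"
  define R where "R = (\<lambda>\<zeta>. \<Sum>i\<in>I. Re (V \<zeta> i) * Im (V1 \<zeta> i) - Im (V \<zeta> i) * Re (V1 \<zeta> i))"
  define Q where "Q = (\<lambda>\<zeta>. \<Sum>i\<in>I. (Re (V1 \<zeta> i))\<^sup>2 + (Im (V1 \<zeta> i))\<^sup>2)"
  define T where "T = (\<lambda>\<zeta>. \<Sum>i\<in>I. Re (V \<zeta> i) * Re (V2 \<zeta> i) + Im (V \<zeta> i) * Im (V2 \<zeta> i))"
  have Nnsq: "N \<zeta> = nsq I (V \<zeta>)" "Q \<zeta> = nsq I (V1 \<zeta>)" for \<zeta>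
    by (simp_all add: N_def Q_def nsq_def cmod_power2)
  have Npos: "N \<zeta> > 0" for \<zeta> using pos by (simp add: Nnsq V_def)
  then have Nnz: "N \<zeta> \<noteq> 0" for \<zeta> by (metis less_irrefl)
  have Nx: "((\<lambda>x. N (Complex x t)) has_real_derivative 2 * P (Complex x t)) (at x)" for x t
    unfolding N_def P_def sum_distrib_left
    by (rule derivative_eq_intros D0 refl)+ (auto simp: algebra_simps intro!: sum.cong)
  have Nt: "((\<lambda>t. N (Complex x t)) has_real_derivative - 2 * R (Complex x t)) (at t)" for x t
    unfolding N_def R_def sum_distrib_left
    by (rule derivative_eq_intros D0 refl)+ (auto simp: algebra_simps intro!: sum.cong)
  have Px: "((\<lambda>x. P (Complex x t)) has_real_derivative Q (Complex x t) + T (Complex x t)) (at x)" for x t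
    unfolding P_def Q_def T_def sum.distrib[symmetric]
    by (rule derivative_eq_intros D0 D1 refl)+ (auto simp: algebra_simps power2_eq_square intro!: sum.cong)
  have Rt: "((\<lambda>t. R (Complex x t)) has_real_derivative T (Complex x t) - Q (Complex x t)) (at t)" for x t
    unfolding R_def Q_def T_def sum_subtractf[symmetric]
    by (rule derivative_eq_intros D0 D1 refl)+ (auto simp: algebra_simps power2_eq_square intro!: sum.cong)
  define L where "L = (\<lambda>\<zeta>. ln (N \<zeta>))"
  define L1 where "L1 = (\<lambda>\<zeta>. 2 * P \<zeta> / N \<zeta>)"
  define L2 where "L2 = (\<lambda>\<zeta>. (2 * (Q \<zeta> + T \<zeta>) * N \<zeta> - 2 * P \<zeta> * (2 * P \<zeta>)) / (N \<zeta> * N \<zeta>))"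
  define M1 where "M1 = (\<lambda>\<zeta>. - 2 * R \<zeta> / N \<zeta>)"
  define M2 where "M2 = (\<lambda>\<zeta>. (- 2 * (T \<zeta> - Q \<zeta>) * N \<zeta> - (- 2 * R \<zeta>) * (- 2 * R \<zeta>)) / (N \<zeta> * N \<zeta>))"
  have cNP: "continuous_on UNIV N" "continuous_on UNIV P" "continuous_on UNIV R" "continuous_on UNIV Q" "continuous_on UNIV T"
    unfolding N_def P_def R_def Q_def T_def by (intro continuous_intros contV)+
  have per: "M1 (Complex x (2 * pi)) = M1 (Complex x 0)" for x
  proof -
    have "exp (Complex x (2 * pi)) = exp (Complex x 0)" by (simp add: exp_eq_polar)
    then show ?thesis by (simp add: M1_def R_def N_def V_def V1_def)
  qed
  have lap: "L2 (Complex x t) + M2 (Complex x t) \<le> 2 * B\<^sup>2 * exp (2 * x)" for x t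
  proof -
    let ?\<zeta> = "Complex x t"
    let ?W = "\<Sum>i\<in>I. \<Sum>j\<in>I. cmod (V ?\<zeta> i * V1 ?\<zeta> j - V ?\<zeta> j * V1 ?\<zeta> i)"
    have "V ?\<zeta> i * V1 ?\<zeta> j - V ?\<zeta> j * V1 ?\<zeta> i = exp ?\<zeta> * wron v i j (exp ?\<zeta>)" for i j
      by (simp add: V_def V1_def wron_def algebra_simps)
    then have "?W = exp x * (\<Sum>i\<in>I. \<Sum>j\<in>I. cmod (wron v i j (exp ?\<zeta>)))"
      by (simp add: norm_mult sum_distrib_left)
    also have "\<dots> = exp x * (speed I v (exp ?\<zeta>) * N ?\<zeta>)"
      using Nnz[of ?\<zeta>] by (simp add: speed_def Nnsq V_def)
    also have "\<dots> \<le> exp x * (B * N ?\<zeta>)"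
      using sp Npos[of ?\<zeta>] by (intro mult_left_mono mult_right_mono) auto
    finally have W: "?W \<le> exp x * (B * N ?\<zeta>)" .
    have "?W \<ge> 0" by (intro sum_nonneg) auto
    then have "?W\<^sup>2 \<le> (exp x * (B * N ?\<zeta>))\<^sup>2" using W by (rule power_mono[rotated])
    then have "Q ?\<zeta> * N ?\<zeta> - ((P ?\<zeta>)\<^sup>2 + (R ?\<zeta>)\<^sup>2) \<le> (exp x * (B * N ?\<zeta>))\<^sup>2 / 2"
      using lagrange_bound[OF I, of "V1 ?\<zeta>" "V ?\<zeta>"] lagrange_bound[OF I, of "V ?\<zeta>" "V1 ?\<zeta>"]
      unfolding Nnsq P_def R_def by linarith
    also have "\<dots> = (B\<^sup>2 * exp (2 * x) / 2) * (N ?\<zeta> * N ?\<zeta>)"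
      by (simp add: power_mult_distrib exp_double power2_eq_square)
    finally have le: "Q ?\<zeta> * N ?\<zeta> - ((P ?\<zeta>)\<^sup>2 + (R ?\<zeta>)\<^sup>2) \<le> (B\<^sup>2 * exp (2 * x) / 2) * (N ?\<zeta> * N ?\<zeta>)" .
    \<comment> \<open>The second derivatives, collected in \<open>T\<close>, enter with opposite
      signs and cancel, because the entries of \<open>V\<close> are harmonic.\<close>
    have "L2 ?\<zeta> + M2 ?\<zeta> = 4 * (Q ?\<zeta> * N ?\<zeta> - ((P ?\<zeta>)\<^sup>2 + (R ?\<zeta>)\<^sup>2)) / (N ?\<zeta> * N ?\<zeta>)"
      unfolding L2_def M2_def add_divide_distrib[symmetric] by (simp add: algebra_simps power2_eq_square)
    also have "\<dots> \<le> 4 * ((B\<^sup>2 * exp (2 * x) / 2) * (N ?\<zeta> * N ?\<zeta>)) / (N ?\<zeta> * N ?\<zeta>)"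
      using Npos[of ?\<zeta>] by (intro divide_right_mono mult_left_mono le) auto
    also have "\<dots> = 2 * B\<^sup>2 * exp (2 * x)" using Nnz[of ?\<zeta>] by simp
    finally show ?thesis .
  qed
  obtain C where C: "C \<ge> 0" "\<And>x. x \<ge> 0 \<Longrightarrow> integral {0..2*pi} (\<lambda>t. L (Complex x t)) \<le> C * exp (2 * x)"
  proof (rule circle_mean_growth[of L L1 L2 M1 M2 "2 * B\<^sup>2"])
    show "((\<lambda>x. L (Complex x t)) has_real_derivative L1 (Complex x t)) (at x)" for x t
      unfolding L_def L1_def
      by (rule derivative_eq_intros Nx Npos)+ (simp add: field_simps)
    show "((\<lambda>x. L1 (Complex x t)) has_real_derivative L2 (Complex x t)) (at x)" for x t
      unfolding L1_def L2_def by (rule DERIV_divide DERIV_cmult Px Nx Nnz)+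
    show "((\<lambda>t. M1 (Complex x t)) has_real_derivative M2 (Complex x t)) (at t)" for x t
      unfolding M1_def M2_def by (rule DERIV_divide DERIV_cmult Rt Nt Nnz)+
    show "continuous_on UNIV L" "continuous_on UNIV L1" "continuous_on UNIV L2" "continuous_on UNIV M2"
      unfolding L_def L1_def L2_def M2_def by (intro continuous_intros cNP ballI, (simp add: Nnz Npos)+)+
  qed (use per lap in auto)
  show ?thesis
  proof (rule that[OF C(1)])
    fix x :: real assume "x \<ge> 0"
    have "L (Complex x t) = ln (nsq I (v (of_real (exp x) * cis t)))" for t
      by (simp add: L_def Nnsq V_def exp_eq_polar)
    then show "integral {0..2*pi} (\<lambda>t. ln (nsq I (v (of_real (exp x) * cis t)))) \<le> C * exp (2 * x)"
      using C(2)[OF \<open>x \<ge> 0\<close>] by simp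
  qed
qed

text \<open>By Jensen's formula the circle means of \<open>ln (nsq I v)\<close>, hence those of \<open>\<bar>ln \<bar>u\<bar>\<bar>\<close>, are
  \<open>O(r\<^sup>2)\<close> for a lift of bounded speed.\<close>

proposition unit_dominated_imp_exp_poly:
  assumes hol: "\<And>i. (\<lambda>z. v z i) holomorphic_on UNIV" and I: "finite I"
    and c: "c > 0" "\<And>z. nsq I (v z) \<ge> c" and sp: "\<And>z. speed I v z \<le> B"
    and u: "u holomorphic_on UNIV" "\<And>z. u z \<noteq> 0" "\<And>z. (cmod (u z))\<^sup>2 \<le> K * nsq I (v z)"
  obtains p where "\<And>z. u z = exp (poly p z)"
proof -
  obtain f where f: "f holomorphic_on UNIV" "\<And>z. u z = exp (f z)"
    by (rule contractible_imp_holomorphic_log[OF u(1) convex_imp_contractible[OF convex_UNIV] u(2)]) blast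
  have pos: "nsq I (v z) > 0" for z using c(2)[of z] c(1) by linarith
  obtain C where C: "C \<ge> 0"
    "\<And>x. x \<ge> 0 \<Longrightarrow> integral {0..2*pi} (\<lambda>t. ln (nsq I (v (of_real (exp x) * cis t)))) \<le> C * exp (2 * x)"
    by (rule log_nsq_growth[OF hol I pos sp]) blast
  have K: "K > 0"
  proof -
    have "0 < (cmod (u 0))\<^sup>2" using u(2) by simp
    then have "0 < K * nsq I (v 0)" using u(3)[of 0] by linarith
    then show ?thesis using pos[of 0] by (simp add: zero_less_mult_iff)
  qed
  have "2 * Re (f z) \<le> ln K + ln (nsq I (v z))" for z
  proof -
    have "exp (2 * Re (f z)) \<le> K * nsq I (v z)"
      using u(3)[of z] by (simp add: f(2) exp_double)
    then have "2 * Re (f z) \<le> ln (K * nsq I (v z))"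
      using K pos[of z] by (subst ln_ge_iff) auto
    then show ?thesis using K pos[of z] by (simp add: ln_mult)
  qed
  moreover have "ln (nsq I (v z)) \<ge> ln c" for z using c(1) c(2)[of z] by (subst ln_le_cancel_iff) (use pos in auto)
  \<comment> \<open>The absolute value is twice the positive part minus the value itself. Domination
    by the lift controls the positive part; the lower bound \<open>c\<close> keeps the right-hand
    side large enough where \<open>Re (f z)\<close> is negative.\<close>
  ultimately have Re_le: "\<bar>Re (f z)\<bar> \<le> (\<bar>ln K\<bar> + \<bar>ln c\<bar>) + ln (nsq I (v z)) + - Re (f z) + \<bar>ln c\<bar>" for z
    by (smt (verit))
  define A where "A = \<bar>ln K\<bar> + 2 * \<bar>ln c\<bar>"
  have contv: "continuous_on UNIV (\<lambda>z. ln (nsq I (v z)))"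
    unfolding nsq_def
    by (intro continuous_intros holomorphic_on_imp_continuous_on hol ballI) (use pos in \<open>simp add: nsq_def less_imp_neq[symmetric]\<close>)
  have contf: "continuous_on UNIV (\<lambda>z. Re (f z))" "continuous_on UNIV (\<lambda>z. \<bar>Re (f z)\<bar>)"
    by (intro continuous_intros holomorphic_on_imp_continuous_on f)+
  \<comment> \<open>By the mean value property the term \<open>- Re (f z)\<close> contributes a
    constant, independent of the radius.\<close>
  have mean: "((\<lambda>t. Re (f (of_real r * cis t))) has_integral 2 * pi * Re (f 0)) {0..2*pi}" if "r > 0" for r
    using has_integral_linear[OF fourier_coefficient[OF f(1) that, of 0] bounded_linear_Re] by (simp add: o_def)
  have bound: "integral {0..2*pi} (\<lambda>t. \<bar>Re (f (of_real (exp x) * cis t))\<bar>) \<le> (2 * pi * (A + \<bar>Re (f 0)\<bar>) + C) * exp (2 * x)"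
    if x: "x \<ge> 0" for x
  proof -
    let ?z = "\<lambda>t. of_real (exp x) * cis t"
    have i1: "((\<lambda>t. A) has_integral (2 * pi) * A) {0..2*pi}"
      using has_integral_const_real[of A 0 "2 * pi"] by simp
    have i2: "((\<lambda>t. ln (nsq I (v (?z t)))) has_integral integral {0..2*pi} (\<lambda>t. ln (nsq I (v (?z t))))) {0..2*pi}"
      by (rule integrable_integral[OF integrable_on_circle[OF contv]])
    have i3: "((\<lambda>t. - Re (f (?z t))) has_integral - (2 * pi * Re (f 0))) {0..2*pi}"
      by (rule has_integral_neg[OF mean]) simp
    have "integral {0..2*pi} (\<lambda>t. \<bar>Re (f (?z t))\<bar>) \<le>
      (2 * pi) * A + integral {0..2*pi} (\<lambda>t. ln (nsq I (v (?z t)))) + - (2 * pi * Re (f 0))"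
    proof (rule has_integral_le[OF integrable_integral[OF integrable_on_circle[OF contf(2)]] has_integral_add[OF has_integral_add[OF i1 i2] i3]])
      fix t show "\<bar>Re (f (?z t))\<bar> \<le> A + ln (nsq I (v (?z t))) + - Re (f (?z t))"
        using Re_le[of "?z t"] by (simp add: A_def)
    qed
    also have "\<dots> \<le> (2 * pi) * A + C * exp (2 * x) + 2 * pi * \<bar>Re (f 0)\<bar>"
    proof -
      have "- (2 * pi * Re (f 0)) \<le> 2 * pi * \<bar>Re (f 0)\<bar>"
        using mult_left_mono[of "- Re (f 0)" "\<bar>Re (f 0)\<bar>" "2 * pi"] by simp
      then show ?thesis using C(2)[OF x] by linarith
    qed
    also have "\<dots> = (2 * pi * (A + \<bar>Re (f 0)\<bar>)) * 1 + C * exp (2 * x)" by (simp add: algebra_simps)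
    also have "\<dots> \<le> (2 * pi * (A + \<bar>Re (f 0)\<bar>)) * exp (2 * x) + C * exp (2 * x)"
      using x by (intro add_right_mono mult_left_mono) (auto simp: A_def)
    finally show ?thesis by (simp add: distrib_right)
  qed
  obtain p where "\<And>z. f z = poly p z" by (rule entire_mean_Re_imp_poly[OF f(1) bound]) (assumption, rule that)
  then show ?thesis using that[of p] f(2) by simp
qed

section \<open>Forms\<close>

text \<open>Forms are treated as functions, so that linear changes, powers and products need no
  explicit coefficients. The coefficients vanish off the monomials, as the parameter space
  requires.\<close>

definition is_form :: "nat \<Rightarrow> nat \<Rightarrow> ((nat \<Rightarrow> complex) \<Rightarrow> complex) \<Rightarrow> bool" where
  "is_form n d \<phi> \<longleftrightarrow> (\<exists>F. (\<forall>\<alpha>. \<alpha> \<notin> monomials n d \<longrightarrow> F \<alpha> = 0) \<and> (\<forall>v. eval_form n d F v = \<phi> v))"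

lemma is_formE:
  assumes "is_form n d \<phi>"
  obtains F where "\<And>\<alpha>. \<alpha> \<notin> monomials n d \<Longrightarrow> F \<alpha> = 0" "\<phi> = eval_form n d F"
  using assms unfolding is_form_def by (metis ext)

lemma is_form_eval: "(\<And>\<alpha>. \<alpha> \<notin> monomials n d \<Longrightarrow> F \<alpha> = 0) \<Longrightarrow> is_form n d (eval_form n d F)"
  unfolding is_form_def by blast

lemma eval_form_add: "eval_form n d (\<lambda>\<alpha>. F \<alpha> + G \<alpha>) v = eval_form n d F v + eval_form n d G v"
  by (simp add: eval_form_def distrib_right sum.distrib)

lemma eval_form_cmult: "eval_form n d (\<lambda>\<alpha>. c * F \<alpha>) v = c * eval_form n d F v"
  by (simp add: eval_form_def sum_distrib_left mult.assoc)

lemma eval_form_sum: "eval_form n d (\<lambda>\<alpha>. \<Sum>i\<in>J. F i \<alpha>) v = (\<Sum>i\<in>J. eval_form n d (F i) v)"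
  by (simp add: eval_form_def sum_distrib_right) (rule sum.swap)

lemma eval_form_scale_vec: "eval_form n d F (\<lambda>i. c * v i) = c ^ d * eval_form n d F v"
proof -
  have "(\<Prod>i\<le>n. (c * v i) ^ \<alpha> i) = c ^ d * (\<Prod>i\<le>n. v i ^ \<alpha> i)" if "\<alpha> \<in> monomials n d" for \<alpha>
    using that by (simp add: power_mult_distrib prod.distrib power_sum[symmetric] monomials_def)
  then show ?thesis
    unfolding eval_form_def sum_distrib_left by (intro sum.cong) (simp_all add: algebra_simps)
qed

lemma is_form_scale_vec: "is_form n d \<phi> \<Longrightarrow> \<phi> (\<lambda>i. c * v i) = c ^ d * \<phi> v"
  by (elim is_formE) (simp add: eval_form_scale_vec)

lemma is_form_add:
  assumes "is_form n d \<phi>" "is_form n d \<psi>"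
  shows "is_form n d (\<lambda>v. \<phi> v + \<psi> v)"
proof -
  obtain F where F: "\<And>\<alpha>. \<alpha> \<notin> monomials n d \<Longrightarrow> F \<alpha> = 0" "\<phi> = eval_form n d F"
    using assms(1) by (rule is_formE) blast
  obtain G where G: "\<And>\<alpha>. \<alpha> \<notin> monomials n d \<Longrightarrow> G \<alpha> = 0" "\<psi> = eval_form n d G"
    using assms(2) by (rule is_formE) blast
  show ?thesis
    unfolding is_form_def by (intro exI[of _ "\<lambda>\<alpha>. F \<alpha> + G \<alpha>"]) (simp add: F G eval_form_add)
qed

lemma is_form_cmult:
  assumes "is_form n d \<phi>"
  shows "is_form n d (\<lambda>v. c * \<phi> v)"
proof -
  obtain F where F: "\<And>\<alpha>. \<alpha> \<notin> monomials n d \<Longrightarrow> F \<alpha> = 0" "\<phi> = eval_form n d F"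
    using assms by (rule is_formE) blast
  show ?thesis
    unfolding is_form_def by (intro exI[of _ "\<lambda>\<alpha>. c * F \<alpha>"]) (simp add: F eval_form_cmult)
qed

lemma is_form_zero: "is_form n d (\<lambda>v. 0)"
  unfolding is_form_def by (intro exI[of _ "\<lambda>_. 0"]) (simp add: eval_form_def)

lemma is_form_sum: "(\<And>i. i \<in> J \<Longrightarrow> is_form n d (\<phi> i)) \<Longrightarrow> is_form n d (\<lambda>v. \<Sum>i\<in>J. \<phi> i v)"
  by (induction J rule: infinite_finite_induct) (simp_all add: is_form_zero is_form_add)

lemma is_form_mult:
  assumes "is_form n d \<phi>" "is_form n e \<psi>"
  shows "is_form n (d + e) (\<lambda>v. \<phi> v * \<psi> v)"
proof -
  obtain F where F: "\<phi> = eval_form n d F" using assms(1) by (rule is_formE)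
  obtain G where G: "\<psi> = eval_form n e G" using assms(2) by (rule is_formE)
  let ?S = "monomials n d \<times> monomials n e"
  let ?add = "\<lambda>(\<alpha>, \<beta>) i. \<alpha> i + \<beta> i :: nat"
  define E where "E = (\<lambda>\<gamma>. \<Sum>s | s \<in> ?S \<and> ?add s = \<gamma>. F (fst s) * G (snd s))"
  have im: "?add ` ?S \<subseteq> monomials n (d + e)" by (auto simp: monomials_def sum.distrib)
  have "E \<gamma> = 0" if "\<gamma> \<notin> monomials n (d + e)" for \<gamma>
  proof -
    have "{s. s \<in> ?S \<and> ?add s = \<gamma>} = {}" using im that by blast
    then show ?thesis unfolding E_def by (simp only: sum.empty)
  qed
  moreover have "eval_form n (d + e) E v = \<phi> v * \<psi> v" for v
  proof -
    let ?m = "\<lambda>\<alpha>. \<Prod>i\<le>n. v i ^ \<alpha> i"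
    have "eval_form n (d + e) E v =
      (\<Sum>\<gamma>\<in>monomials n (d + e). \<Sum>s | s \<in> ?S \<and> ?add s = \<gamma>. F (fst s) * G (snd s) * ?m (?add s))"
      unfolding eval_form_def E_def sum_distrib_right by (intro sum.cong refl) auto
    also have "\<dots> = (\<Sum>s\<in>?S. F (fst s) * G (snd s) * ?m (?add s))"
      by (rule sum.group[OF _ finite_monomials im]) (simp add: finite_monomials)
    also have "\<dots> = (\<Sum>s\<in>?S. (F (fst s) * ?m (fst s)) * (G (snd s) * ?m (snd s)))"
      by (intro sum.cong refl) (auto simp: power_add prod.distrib)
    also have "\<dots> = \<phi> v * \<psi> v"
      by (simp add: F G eval_form_def sum_product sum.cartesian_product split_beta)
    finally show ?thesis .
  qed
  ultimately show ?thesis unfolding is_form_def by blast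
qed

lemma is_form_one: "is_form n 0 (\<lambda>v. 1)"
proof -
  have "monomials n 0 = {\<lambda>_. 0}" by (auto simp: monomials_def fun_eq_iff) (metis atMost_iff not_le)
  then show ?thesis unfolding is_form_def
    by (intro exI[of _ "\<lambda>\<alpha>. if \<alpha> = (\<lambda>_. 0) then 1 else 0"]) (simp add: eval_form_def)
qed

lemma is_form_coord:
  assumes "i \<le> n"
  shows "is_form n 1 (\<lambda>v. v i)"
proof -
  define \<delta> where "\<delta> = (\<lambda>j. if j = i then 1 else 0 :: nat)"
  have \<delta>: "\<delta> \<in> monomials n 1" using assms by (auto simp: monomials_def \<delta>_def)
  have "eval_form n 1 (\<lambda>\<alpha>. if \<alpha> = \<delta> then 1 else 0) v = v i" for v
  proof -
    have "eval_form n 1 (\<lambda>\<alpha>. if \<alpha> = \<delta> then 1 else 0) v =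
      (\<Sum>\<alpha>\<in>monomials n 1. if \<alpha> = \<delta> then (\<Prod>j\<le>n. v j ^ \<delta> j) else 0)"
      unfolding eval_form_def by (intro sum.cong) auto
    also have "\<dots> = (\<Prod>j\<le>n. v j ^ \<delta> j)" using \<delta> by (simp add: finite_monomials)
    also have "\<dots> = (\<Prod>j\<le>n. if j = i then v j else 1)" by (intro prod.cong) (auto simp: \<delta>_def)
    also have "\<dots> = v i" using assms by simp
    finally show ?thesis .
  qed
  then show ?thesis using \<delta> unfolding is_form_def by (intro exI[of _ "\<lambda>\<alpha>. if \<alpha> = \<delta> then 1 else 0"]) auto
qed

lemma is_form_power: "is_form n d \<phi> \<Longrightarrow> is_form n (d * m) (\<lambda>v. \<phi> v ^ m)"
  by (induction m) (simp_all add: is_form_one is_form_mult)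

lemma is_form_prod:
  assumes "\<And>i. i < m \<Longrightarrow> is_form n d (\<phi> i)"
  shows "is_form n (d * m) (\<lambda>v. \<Prod>i<m. \<phi> i v)"
  using assms
proof (induction m)
  case (Suc m)
  have "is_form n (d * m + d) (\<lambda>v. (\<Prod>i<m. \<phi> i v) * \<phi> m v)"
    by (rule is_form_mult) (use Suc in auto)
  then show ?case by (simp add: add.commute)
qed (simp add: is_form_one)

lemma holomorphic_on_is_form:
  assumes "is_form n d \<phi>" "\<And>i. (\<lambda>x. v x i) holomorphic_on S"
  shows "(\<lambda>x. \<phi> (v x)) holomorphic_on S"
  using assms(1) by (elim is_formE) (simp add: holomorphic_on_eval_form assms(2))

lemma ex_max_coord:
  fixes v :: "nat \<Rightarrow> complex"
  obtains j where "j \<le> n" "\<And>i. i \<le> n \<Longrightarrow> cmod (v i) \<le> cmod (v j)"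
proof -
  let ?A = "(\<lambda>i. cmod (v i)) ` {..n}"
  have "Max ?A \<in> ?A" by (rule Max_in) auto
  then obtain j where "j \<le> n" "Max ?A = cmod (v j)" by (elim imageE) simp
  moreover have "cmod (v i) \<le> Max ?A" if "i \<le> n" for i using that by (intro Max_ge) auto
  ultimately show ?thesis using that by metis
qed

text \<open>Every monomial of degree \<open>k\<close> is bounded by the \<open>k\<close>-th power of
  the largest coordinate. Adding 1 makes the constant positive even for the zero form.\<close>

lemma is_form_bound:
  assumes "is_form n k \<phi>"
  obtains K where "K > 0" "\<And>v. (cmod (\<phi> v))\<^sup>2 \<le> K * nsq {..n} (\<lambda>j. v j ^ k)"
proof -
  obtain F where F: "\<phi> = eval_form n k F" using assms by (rule is_formE)
  define C where "C = (\<Sum>\<alpha>\<in>monomials n k. cmod (F \<alpha>))"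
  have C: "C \<ge> 0" unfolding C_def by (intro sum_nonneg) auto
  have "(cmod (\<phi> v))\<^sup>2 \<le> (C\<^sup>2 + 1) * nsq {..n} (\<lambda>j. v j ^ k)" for v
  proof -
    obtain j where j: "j \<le> n" "\<And>i. i \<le> n \<Longrightarrow> cmod (v i) \<le> cmod (v j)" by (rule ex_max_coord[of n v]) blast
    have m: "cmod (\<Prod>i\<le>n. v i ^ \<alpha> i) \<le> cmod (v j) ^ k" if "\<alpha> \<in> monomials n k" for \<alpha>
    proof -
      have "cmod (\<Prod>i\<le>n. v i ^ \<alpha> i) = (\<Prod>i\<le>n. cmod (v i) ^ \<alpha> i)"
        by (simp add: prod_norm[symmetric] norm_power)
      also have "\<dots> \<le> (\<Prod>i\<le>n. cmod (v j) ^ \<alpha> i)"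
        using j by (intro prod_mono) (auto intro: power_mono)
      also have "\<dots> = cmod (v j) ^ k" using that by (simp add: power_sum[symmetric] monomials_def)
      finally show ?thesis .
    qed
    have "cmod (\<phi> v) \<le> (\<Sum>\<alpha>\<in>monomials n k. cmod (F \<alpha>) * cmod (v j) ^ k)"
      unfolding F eval_form_def by (intro sum_norm_le) (auto simp: norm_mult intro: mult_left_mono m)
    also have "\<dots> = C * cmod (v j) ^ k" by (simp add: C_def sum_distrib_right)
    finally have "(cmod (\<phi> v))\<^sup>2 \<le> (C * cmod (v j) ^ k)\<^sup>2" by (rule power_mono) simp
    also have "\<dots> = C\<^sup>2 * (cmod (v j ^ k))\<^sup>2" by (simp add: power_mult_distrib norm_power)
    also have "\<dots> \<le> C\<^sup>2 * nsq {..n} (\<lambda>j. v j ^ k)"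
      by (intro mult_left_mono norm_le_nsq[where v = "\<lambda>j. v j ^ k"]) (use j in auto)
    also have "\<dots> \<le> (C\<^sup>2 + 1) * nsq {..n} (\<lambda>j. v j ^ k)"
      by (intro mult_right_mono nsq_nonneg) simp
    finally show ?thesis .
  qed
  then show ?thesis by (intro that[of "C\<^sup>2 + 1"]) (simp_all add: add_nonneg_pos)
qed

section \<open>Hyperbolic forms and their products\<close>

definition zero_locus :: "nat \<Rightarrow> ((nat \<Rightarrow> complex) \<Rightarrow> complex) \<Rightarrow> (nat \<Rightarrow> complex) set set" where
  "zero_locus n \<phi> = {p \<in> proj_space {..n}. \<forall>v\<in>p. \<phi> v = 0}"

lemma proj_point_in_zero_locus_iff:
  assumes "is_form n d \<phi>" "v \<in> nonzero_vecs {..n}"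
  shows "proj_point v \<in> zero_locus n \<phi> \<longleftrightarrow> \<phi> v = 0"
  using assms proj_point_self[of v]
  by (auto simp: zero_locus_def proj_space_def proj_point_def is_form_scale_vec[OF assms(1)])

lemma hypersurface_eq_zero_locus: "hypersurface n d (proj_point F) = zero_locus n (eval_form n d F)"
  by (auto simp: hypersurface_def zero_locus_def proj_point_def eval_form_cmult intro: exI[of _ 1])

definition brody_hyperbolic_form :: "nat \<Rightarrow> ((nat \<Rightarrow> complex) \<Rightarrow> complex) \<Rightarrow> bool" where
  "brody_hyperbolic_form n \<phi> \<longleftrightarrow>
     (\<forall>g. proj_hol {..n} UNIV g \<and> range g \<subseteq> zero_locus n \<phi> \<longrightarrow> g constant_on UNIV)"

lemma hyperbolic_form_eval: "hyperbolic_form n d F \<longleftrightarrow> brody_hyperbolic_form n (eval_form n d F)"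
  by (simp add: hyperbolic_form_def brody_hyperbolic_form_def hypersurface_eq_zero_locus)

lemma zero_locus_cmult: "c \<noteq> 0 \<Longrightarrow> zero_locus n (\<lambda>v. c * \<phi> v) = zero_locus n \<phi>"
  by (simp add: zero_locus_def)

text \<open>The parameters near which the curve lies in the locus form an open set; it is also
  closed by the identity theorem on a ball carrying a lift.\<close>

lemma zero_locus_identity:
  assumes g: "proj_hol {..n} UNIV g" and \<phi>: "is_form n d \<phi>"
    and e: "e > 0" "g ` ball z0 e \<subseteq> zero_locus n \<phi>"
  shows "range g \<subseteq> zero_locus n \<phi>"
proof -
  define A where "A = {z. \<exists>r>0. g ` ball z r \<subseteq> zero_locus n \<phi>}"
  have "open A" unfolding open_contains_ball
  proof
    fix z assume "z \<in> A"
    then obtain r where r: "r > 0" "g ` ball z r \<subseteq> zero_locus n \<phi>" by (auto simp: A_def)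
    have "w \<in> A" if w: "w \<in> ball z r" for w
    proof -
      obtain s where "s > 0" "ball w s \<subseteq> ball z r" by (rule openE[OF open_ball w])
      then show ?thesis using r by (auto simp: A_def)
    qed
    then show "\<exists>r>0. ball z r \<subseteq> A" using r(1) by blast
  qed
  moreover have "open (- A)" unfolding open_contains_ball
  proof
    fix z assume z: "z \<in> - A"
    obtain r v where r: "r > 0" "proj_lift {..n} (ball z r) g v" using proj_holE[OF g] by blast
    have iff: "g x \<in> zero_locus n \<phi> \<longleftrightarrow> \<phi> (v x) = 0" if "x \<in> ball z r" for x
      using proj_liftD(2,3)[OF r(2) that] proj_point_in_zero_locus_iff[OF \<phi>] by simp
    have "w \<notin> A" if w: "w \<in> ball z r" for w
    proof
      assume "w \<in> A"
      then obtain s where s: "s > 0" "g ` ball w s \<subseteq> zero_locus n \<phi>" by (auto simp: A_def)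
      have hol: "(\<lambda>x. \<phi> (v x)) holomorphic_on ball z r"
        by (rule holomorphic_on_is_form[OF \<phi> proj_liftD(1)[OF r(2)]])
      have "\<phi> (v x) = 0" if "x \<in> ball z r" for x
      proof (rule analytic_continuation_open[of "ball z r \<inter> ball w s" "ball z r" "\<lambda>x. \<phi> (v x)" "\<lambda>_. 0" x])
        show "ball z r \<inter> ball w s \<noteq> {}" using w s(1) by (metis IntI centre_in_ball empty_iff)
        show "\<phi> (v x) = 0" if "x \<in> ball z r \<inter> ball w s" for x
          using that s(2) iff[of x] by (simp add: image_subset_iff)
      qed (use hol that in auto)
      then have "g ` ball z r \<subseteq> zero_locus n \<phi>" using iff by blast
      then show False using z r(1) by (auto simp: A_def)
    qed
    then show "\<exists>r>0. ball z r \<subseteq> - A" using r(1) by blast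
  qed
  moreover have "z0 \<in> A" using e by (auto simp: A_def)
  ultimately have A: "A = UNIV" using clopen[of A] by (auto simp: closed_def)
  show ?thesis
  proof (rule image_subsetI)
    fix x
    have "x \<in> A" by (simp add: A)
    then obtain r where "r > 0" "g ` ball x r \<subseteq> zero_locus n \<phi>" unfolding A_def by blast
    then show "g x \<in> zero_locus n \<phi>" by (simp add: image_subset_iff)
  qed
qed

text \<open>A curve that leaves the first locus at one point leaves it on a whole ball. There it
  lies in the second locus, hence everywhere by \<open>zero_locus_identity\<close>.\<close>

lemma brody_hyperbolic_form_mult:
  assumes \<phi>: "is_form n d \<phi>" "brody_hyperbolic_form n \<phi>" and \<psi>: "is_form n e \<psi>" "brody_hyperbolic_form n \<psi>"
  shows "brody_hyperbolic_form n (\<lambda>v. \<phi> v * \<psi> v)"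
  unfolding brody_hyperbolic_form_def
proof (intro allI impI, elim conjE)
  fix g assume g: "proj_hol {..n} UNIV g" and r: "range g \<subseteq> zero_locus n (\<lambda>v. \<phi> v * \<psi> v)"
  have prod: "g z \<in> zero_locus n \<phi> \<or> g z \<in> zero_locus n \<psi>" for z
  proof -
    obtain s v where s: "s > 0" "proj_lift {..n} (ball z s) g v" using proj_holE[OF g] by blast
    have v: "v z \<in> nonzero_vecs {..n}" "g z = proj_point (v z)" using proj_liftD(2,3)[OF s(2)] s(1) by auto
    show ?thesis
      using r v proj_point_in_zero_locus_iff[OF is_form_mult[OF \<phi>(1) \<psi>(1)] v(1)]
      by (auto simp: proj_point_in_zero_locus_iff[OF \<phi>(1) v(1)] proj_point_in_zero_locus_iff[OF \<psi>(1) v(1)])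
  qed
  show "g constant_on UNIV"
  proof (cases "range g \<subseteq> zero_locus n \<phi>")
    case True
    then show ?thesis using \<phi>(2) g by (auto simp: brody_hyperbolic_form_def)
  next
    case False
    then obtain z where z: "g z \<notin> zero_locus n \<phi>" by blast
    obtain s v where s: "s > 0" "proj_lift {..n} (ball z s) g v" using proj_holE[OF g] by blast
    have iff: "g x \<in> zero_locus n \<phi> \<longleftrightarrow> \<phi> (v x) = 0" if "x \<in> ball z s" for x
      using proj_liftD(2,3)[OF s(2) that] proj_point_in_zero_locus_iff[OF \<phi>(1)] by simp
    have "continuous_on (ball z s) (\<lambda>x. \<phi> (v x))"
      by (intro holomorphic_on_imp_continuous_on holomorphic_on_is_form[OF \<phi>(1) proj_liftD(1)[OF s(2)]])
    then have "open (ball z s \<inter> (\<lambda>x. \<phi> (v x)) -` (- {0}))"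
      by (intro continuous_open_preimage) auto
    moreover have "z \<in> ball z s \<inter> (\<lambda>x. \<phi> (v x)) -` (- {0})" using z s(1) iff[of z] by auto
    ultimately obtain t where t: "t > 0" "ball z t \<subseteq> ball z s \<inter> (\<lambda>x. \<phi> (v x)) -` (- {0})"
      by (rule openE)
    have "g x \<notin> zero_locus n \<phi>" if "x \<in> ball z t" for x
      using subsetD[OF t(2) that] iff[of x] by simp
    then have "g ` ball z t \<subseteq> zero_locus n \<psi>" using prod by blast
    then have "range g \<subseteq> zero_locus n \<psi>" by (rule zero_locus_identity[OF g \<psi>(1) t(1)])
    then show ?thesis using \<psi>(2) g by (auto simp: brody_hyperbolic_form_def)
  qed
qed

lemma brody_hyperbolic_form_prod:
  fixes m :: nat
  assumes "\<And>i. i < m \<Longrightarrow> is_form n d (\<phi> i)" "\<And>i. i < m \<Longrightarrow> brody_hyperbolic_form n (\<phi> i)"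
  shows "brody_hyperbolic_form n (\<lambda>v. \<Prod>i<m. \<phi> i v)"
  using assms
proof (induction m)
  case 0
  have "zero_locus n (\<lambda>v. 1) = {}"
    by (auto simp: zero_locus_def proj_space_def intro: proj_point_self)
  then show ?case by (auto simp: brody_hyperbolic_form_def)
next
  case (Suc m)
  have "brody_hyperbolic_form n (\<lambda>v. (\<Prod>i<m. \<phi> i v) * \<phi> m v)"
    by (rule brody_hyperbolic_form_mult[OF is_form_prod[where d = d]]) (use Suc in auto)
  then show ?case by simp
qed

text \<open>If the form vanished identically, its locus would contain the projective line traced by
  \<open>(1 : z : 0 : ... : 0)\<close>, which exists for \<open>n > 0\<close>.\<close>

lemma brody_hyperbolic_form_nonzero:
  assumes n: "n > 0" and \<phi>: "is_form n d \<phi>" "brody_hyperbolic_form n \<phi>"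
  obtains a where "a \<in> nonzero_vecs {..n}" "\<phi> a \<noteq> 0"
proof (rule ccontr)
  assume "\<not> thesis"
  then have z: "\<phi> a = 0" if "a \<in> nonzero_vecs {..n}" for a using that \<open>\<And>a. \<lbrakk>a \<in> nonzero_vecs {..n}; \<phi> a \<noteq> 0\<rbrakk> \<Longrightarrow> thesis\<close> by blast
  define v where "v = (\<lambda>z (i :: nat). if i = 0 then 1 else if i = 1 then z else 0 :: complex)"
  have v: "v z \<in> nonzero_vecs {..n}" for z using n by (auto simp: v_def nonzero_vecs_def)
  have "(\<lambda>z. v z i) holomorphic_on UNIV" for i
    by (cases "i = 0"; cases "i = 1") (simp_all add: v_def holomorphic_on_ident)
  then have l: "proj_lift {..n} UNIV (\<lambda>z. proj_point (v z)) v" using v by (simp add: proj_lift_def)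
  have "range (\<lambda>z. proj_point (v z)) \<subseteq> zero_locus n \<phi>"
    using z v by (auto simp: proj_point_in_zero_locus_iff[OF \<phi>(1) v])
  then have "(\<lambda>z. proj_point (v z)) constant_on UNIV"
    using \<phi>(2) proj_lift_imp_proj_hol[OF l] by (auto simp: brody_hyperbolic_form_def)
  then have "proj_point (v 0) = proj_point (v 1)" by (auto simp: constant_on_def)
  then obtain c where "v 1 = (\<lambda>i. c * v 0 i)" by (rule proj_point_eqD)
  then have "v 1 1 = c * v 0 1" by simp
  then show False by (simp add: v_def)
qed

section \<open>Ratios of forms of equal degree along a curve\<close>

definition form_ratio :: "((nat \<Rightarrow> complex) \<Rightarrow> complex) \<Rightarrow> ((nat \<Rightarrow> complex) \<Rightarrow> complex) \<Rightarrow> (nat \<Rightarrow> complex) set \<Rightarrow> complex" where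
  "form_ratio \<phi> \<psi> p = (let v = SOME v. v \<in> p in \<phi> v / \<psi> v)"

lemma form_ratio_proj_point:
  assumes "is_form n d \<phi>" "is_form n d \<psi>"
  shows "form_ratio \<phi> \<psi> (proj_point v) = \<phi> v / \<psi> v"
proof -
  have "(SOME w. w \<in> proj_point v) \<in> proj_point v"
    using someI[of "\<lambda>w. w \<in> proj_point v" v] proj_point_self by blast
  then obtain c where c: "c \<noteq> 0" "(SOME w. w \<in> proj_point v) = (\<lambda>i. c * v i)"
    by (auto simp: proj_point_def)
  then show ?thesis
    by (simp add: form_ratio_def is_form_scale_vec[OF assms(1)] is_form_scale_vec[OF assms(2)])
qed

lemma holomorphic_form_ratio:
  assumes g: "proj_hol {..n} UNIV g" and \<phi>: "is_form n d \<phi>" and \<psi>: "is_form n d \<psi>"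
    and nz: "\<And>z. g z \<notin> zero_locus n \<psi>"
  shows "(\<lambda>z. form_ratio \<phi> \<psi> (g z)) holomorphic_on UNIV"
proof -
  have "(\<lambda>z. form_ratio \<phi> \<psi> (g z)) field_differentiable at z" for z
  proof -
    obtain e v where e: "e > 0" "proj_lift {..n} (ball z e) g v" using proj_holE[OF g] by blast
    have "\<psi> (v x) \<noteq> 0" if "x \<in> ball z e" for x
      using nz[of x] proj_liftD(2,3)[OF e(2) that] proj_point_in_zero_locus_iff[OF \<psi>] by simp
    then have "(\<lambda>x. \<phi> (v x) / \<psi> (v x)) holomorphic_on ball z e"
      by (intro holomorphic_on_divide holomorphic_on_is_form[OF \<phi>] holomorphic_on_is_form[OF \<psi>] proj_liftD(1)[OF e(2)])
    then have "(\<lambda>x. form_ratio \<phi> \<psi> (g x)) holomorphic_on ball z e"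
      by (rule holomorphic_transform) (simp add: proj_liftD(3)[OF e(2)] form_ratio_proj_point[OF \<phi> \<psi>])
    then show ?thesis using e(1) holomorphic_on_imp_differentiable_at by auto
  qed
  then show ?thesis by (simp add: holomorphic_on_def field_differentiable_at_within)
qed

text \<open>The power map is a holomorphic self-map of projective space, so it stretches speeds by a
  bounded factor. With \<open>m\<close> the largest coordinate modulus, a Wronskian of powers gains
  at most \<open>k * m^(2k-2)\<close>, the new norm square is at least \<open>m^(2k)\<close> and the
  old one at most \<open>(n + 1) * m^2\<close>.\<close>

lemma speed_power_le:
  assumes v: "proj_lift {..n} S g v" and S: "open S" "z \<in> S" and k: "k > 0"
  shows "speed {..n} (\<lambda>x i. v x i ^ k) z \<le> real k * real (Suc n) * speed {..n} v z"
proof -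
  obtain l where k': "k = Suc l" using k by (cases k) auto
  obtain j where j: "j \<le> n" "\<And>i. i \<le> n \<Longrightarrow> cmod (v z i) \<le> cmod (v z j)" by (rule ex_max_coord[of n "v z"]) blast
  let ?m = "cmod (v z j)"
  obtain i0 where "i0 \<in> {..n}" "v z i0 \<noteq> 0" using proj_liftD(2)[OF v S(2)] by (elim nonzero_vecsE)
  then have m: "?m > 0" using j(2)[of i0] by (metis atMost_iff less_le_trans zero_less_norm_iff)
  have d: "deriv (\<lambda>x. v x i ^ k) z = of_nat k * v z i ^ l * deriv (\<lambda>x. v x i) z" for i
  proof -
    have "((\<lambda>x. v x i) has_field_derivative deriv (\<lambda>x. v x i) z) (at z)"
      using holomorphic_derivI[OF proj_liftD(1)[OF v] S] .
    from DERIV_power[OF this, of k]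
    have "((\<lambda>x. v x i ^ k) has_field_derivative of_nat k * v z i ^ l * deriv (\<lambda>x. v x i) z) (at z)"
      by (rule DERIV_cong) (simp add: k' mult_ac)
    then show ?thesis by (rule DERIV_imp_deriv)
  qed
  have W: "wron (\<lambda>x i. v x i ^ k) i i' z = of_nat k * (v z i * v z i') ^ l * wron v i i' z" for i i'
    unfolding wron_def d by (simp add: k' power_mult_distrib algebra_simps)
  have "(\<Sum>i\<le>n. \<Sum>i'\<le>n. cmod (wron (\<lambda>x i. v x i ^ k) i i' z)) \<le>
     (\<Sum>i\<le>n. \<Sum>i'\<le>n. real k * (?m * ?m) ^ l * cmod (wron v i i' z))"
    unfolding W norm_mult norm_power norm_of_nat
    by (intro sum_mono mult_right_mono mult_left_mono power_mono mult_mono j(2)) auto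
  also have "\<dots> = real k * (?m * ?m) ^ l * (\<Sum>i\<le>n. \<Sum>i'\<le>n. cmod (wron v i i' z))"
    by (simp add: sum_distrib_left)
  finally have num: "(\<Sum>i\<le>n. \<Sum>i'\<le>n. cmod (wron (\<lambda>x i. v x i ^ k) i i' z)) \<le>
      real k * (?m * ?m) ^ l * (\<Sum>i\<le>n. \<Sum>i'\<le>n. cmod (wron v i i' z))" .
  let ?W = "\<Sum>i\<le>n. \<Sum>i'\<le>n. cmod (wron v i i' z)"
  have W0: "?W \<ge> 0" by (intro sum_nonneg) auto
  have N1: "nsq {..n} (v z) \<le> real (Suc n) * (?m * ?m)"
  proof -
    have "nsq {..n} (v z) \<le> (\<Sum>i\<le>n. ?m\<^sup>2)"
      unfolding nsq_def by (intro sum_mono power_mono j(2)) auto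
    then show ?thesis by (simp add: power2_eq_square)
  qed
  have N2: "(?m * ?m) ^ k \<le> nsq {..n} (\<lambda>i. v z i ^ k)"
    using norm_le_nsq[of "{..n}" j "\<lambda>i. v z i ^ k"] j(1)
    by (simp add: norm_power power_mult_distrib power2_eq_square)
  have pos: "nsq {..n} (v z) > 0" by (rule nsq_pos[OF finite_atMost proj_liftD(2)[OF v S(2)]])
  have "speed {..n} (\<lambda>x i. v x i ^ k) z \<le> real k * (?m * ?m) ^ l * ?W / (?m * ?m) ^ k"
    unfolding speed_def using m by (intro frac_le num N2 mult_nonneg_nonneg W0) auto
  also have "\<dots> = real k * (?W / (?m * ?m))" using m by (simp add: k')
  also have "\<dots> \<le> real k * (real (Suc n) * (?W / nsq {..n} (v z)))"
  proof (intro mult_left_mono)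
    have "?W * nsq {..n} (v z) \<le> ?W * (real (Suc n) * (?m * ?m))" by (intro mult_left_mono N1 W0)
    then show "?W / (?m * ?m) \<le> real (Suc n) * (?W / nsq {..n} (v z))"
      using m pos by (simp add: field_simps)
  qed simp
  finally show ?thesis by (simp add: speed_def mult.assoc)
qed

lemma continuous_on_is_form: "is_form n d \<phi> \<Longrightarrow> continuous_on A \<phi>"
  by (elim is_formE, simp, unfold eval_form_def [abs_def])
    (intro continuous_intros continuous_on_product_then_coordinatewise[OF continuous_on_id])

text \<open>Without common zeros the sum of squares has a positive minimum on the unit sphere, and
  both sides are homogeneous of degree \<open>2 * k\<close>.\<close>

lemma nsq_power_le_forms:
  assumes J: "finite J" "\<And>i. i \<in> J \<Longrightarrow> is_form n k (\<phi> i)"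
    and nz: "\<And>v. v \<in> nonzero_vecs {..n} \<Longrightarrow> \<exists>i\<in>J. \<phi> i v \<noteq> 0"
  obtains K where "K > 0" "\<And>v. v \<in> nonzero_vecs {..n} \<Longrightarrow> nsq {..n} v ^ k \<le> K * (\<Sum>i\<in>J. (cmod (\<phi> i v))\<^sup>2)"
proof -
  define S where "S = {v. v \<in> nonzero_vecs {..n} \<and> nsq {..n} v = 1}"
  let ?f = "\<lambda>v. \<Sum>i\<in>J. (cmod (\<phi> i v))\<^sup>2"
  have "(\<lambda>i. if i = 0 then 1 else 0) \<in> S"
    by (simp add: S_def nonzero_vecs_def nsq_def if_distrib[of cmod] if_distrib[of "\<lambda>x. x\<^sup>2"] cong: if_cong)
  then have "S \<noteq> {}" by blast
  moreover have "compact S" unfolding S_def by (rule compact_unit_sphere) simp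
  moreover have "continuous_on S ?f"
    by (intro continuous_intros continuous_on_is_form[OF J(2)])
  ultimately obtain w where w: "w \<in> S" "\<And>v. v \<in> S \<Longrightarrow> ?f w \<le> ?f v"
    using continuous_attains_inf[of S ?f] by blast
  obtain i where i: "i \<in> J" "\<phi> i w \<noteq> 0" using nz w(1) by (auto simp: S_def)
  have m: "?f w > 0" by (rule sum_pos2[OF J(1) i(1)]) (use i in auto)
  show ?thesis
  proof (rule that)
    show "1 / ?f w > 0" using m by simp
    fix v assume v: "v \<in> nonzero_vecs {..n}"
    let ?N = "nsq {..n} v"
    have N: "?N > 0" by (rule nsq_pos[OF finite_atMost v])
    define c where "c = complex_of_real (1 / sqrt ?N)"
    have c: "c \<noteq> 0" "(cmod c)\<^sup>2 = 1 / ?N" using N unfolding c_def norm_of_real by (simp_all add: power_divide)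
    have "(\<lambda>i. c * v i) \<in> S"
      using nonzero_vecs_scale[OF v c(1)] N by (simp add: S_def nsq_scale c(2))
    then have "?f w \<le> ?f (\<lambda>i. c * v i)" by (rule w(2))
    also have "\<dots> = (\<Sum>i\<in>J. ((cmod c)\<^sup>2) ^ k * (cmod (\<phi> i v))\<^sup>2)"
      by (intro sum.cong refl)
        (simp add: is_form_scale_vec[OF J(2)] norm_mult norm_power power_mult_distrib power_mult[symmetric] mult.commute)
    also have "\<dots> = (1 / ?N) ^ k * ?f v" by (simp add: c(2) sum_distrib_left)
    finally have "?f w * ?N ^ k \<le> ?f v" using N by (simp add: power_divide field_simps)
    then show "?N ^ k \<le> 1 / ?f w * ?f v" using m by (simp add: field_simps)
  qed
qed

text \<open>A finite map is constant on a curve only if the curve is constant: all monomials are bounded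
  by the given forms, so Liouville's theorem applies to them.\<close>

lemma constant_ratios_imp_constant:
  assumes g: "proj_hol {..n} UNIV g" and k: "k > 0"
    and J: "finite J" "\<And>i. i \<in> J \<Longrightarrow> is_form n k (\<phi> i)"
    and nz: "\<And>v. v \<in> nonzero_vecs {..n} \<Longrightarrow> \<exists>i\<in>J. \<phi> i v \<noteq> 0"
    and \<psi>: "is_form n k \<psi>" "\<And>z. g z \<notin> zero_locus n \<psi>"
    and c: "\<And>i z. i \<in> J \<Longrightarrow> form_ratio (\<phi> i) \<psi> (g z) = c i"
  shows "g constant_on UNIV"
proof -
  obtain K where K: "K > 0"
    "\<And>v. v \<in> nonzero_vecs {..n} \<Longrightarrow> nsq {..n} v ^ k \<le> K * (\<Sum>i\<in>J. (cmod (\<phi> i v))\<^sup>2)"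
    by (rule nsq_power_le_forms[OF J nz]) blast+
  have "\<exists>v. v \<in> nonzero_vecs {..n} \<and> g z = proj_point v" for z
    using proj_hol_in_space[OF g] by (auto simp: proj_space_def)
  then obtain v where v: "\<And>z. v z \<in> nonzero_vecs {..n}" "\<And>z. g z = proj_point (v z)" by metis
  have \<psi>v: "\<psi> (v z) \<noteq> 0" for z
    using \<psi>(2)[of z] proj_point_in_zero_locus_iff[OF \<psi>(1) v(1)] v(2) by simp
  have \<phi>v: "\<phi> i (v z) = c i * \<psi> (v z)" if "i \<in> J" for i z
    using c[OF that, of z] \<psi>v[of z] by (simp add: v(2) form_ratio_proj_point[OF J(2)[OF that] \<psi>(1)] field_simps)
  \<comment> \<open>These monomials suffice: for a \<open>j\<close> with nonzero entry, the
    quotients of \<open>\<theta> i j\<close> by \<open>\<theta> j j\<close> are the affine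
    coordinates of the point.\<close>
  define \<theta> where "\<theta> = (\<lambda>i j (w :: nat \<Rightarrow> complex). w i * w j ^ (k - 1))"
  have \<theta>: "is_form n k (\<theta> i j)" if "i \<le> n" "j \<le> n" for i j
    using is_form_mult[OF is_form_coord[OF that(1)] is_form_power[OF is_form_coord[OF that(2)], of "k - 1"]] k
    by (simp add: \<theta>_def)
  have "\<exists>d. \<forall>z. form_ratio (\<theta> i j) \<psi> (g z) = d" if ij: "i \<le> n" "j \<le> n" for i j
  proof -
    have "(\<lambda>z. form_ratio (\<theta> i j) \<psi> (g z)) holomorphic_on UNIV"
      by (rule holomorphic_form_ratio[OF g \<theta>[OF ij] \<psi>])
    moreover have "bounded (range (\<lambda>z. form_ratio (\<theta> i j) \<psi> (g z)))"
      unfolding bounded_iff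
    proof (intro exI ballI, clarify)
      fix z
      let ?N = "nsq {..n} (v z)"
      have "(cmod (\<theta> i j (v z)))\<^sup>2 = (cmod (v z i))\<^sup>2 * ((cmod (v z j))\<^sup>2) ^ (k - 1)"
        by (simp add: \<theta>_def norm_mult norm_power power_mult_distrib power_mult[symmetric] mult.commute)
      also have "\<dots> \<le> ?N * ?N ^ (k - 1)"
        by (intro mult_mono power_mono norm_le_nsq nsq_nonneg) (use ij in \<open>auto simp: nsq_nonneg\<close>)
      also have "\<dots> = ?N ^ k" using k by (cases k) auto
      also have "\<dots> \<le> K * (\<Sum>i\<in>J. (cmod (\<phi> i (v z)))\<^sup>2)" by (rule K(2)[OF v(1)])
      also have "\<dots> = K * (\<Sum>i\<in>J. (cmod (c i))\<^sup>2) * (cmod (\<psi> (v z)))\<^sup>2"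
        by (simp add: \<phi>v norm_mult power_mult_distrib sum_distrib_right mult.assoc)
      finally have le: "(cmod (\<theta> i j (v z)))\<^sup>2 \<le> K * (\<Sum>i\<in>J. (cmod (c i))\<^sup>2) * (cmod (\<psi> (v z)))\<^sup>2" .
      have "(cmod (form_ratio (\<theta> i j) \<psi> (g z)))\<^sup>2 = (cmod (\<theta> i j (v z)))\<^sup>2 / (cmod (\<psi> (v z)))\<^sup>2"
        by (simp add: v(2) form_ratio_proj_point[OF \<theta>[OF ij] \<psi>(1)] norm_divide power_divide)
      also have "\<dots> \<le> K * (\<Sum>i\<in>J. (cmod (c i))\<^sup>2)"
        using le \<psi>v[of z] by (simp add: divide_le_eq)
      finally show "norm (form_ratio (\<theta> i j) \<psi> (g z)) \<le> sqrt (K * (\<Sum>i\<in>J. (cmod (c i))\<^sup>2))"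
        by (rule real_le_rsqrt)
    qed
    ultimately obtain d where "\<And>z. form_ratio (\<theta> i j) \<psi> (g z) = d" using Liouville_theorem[of "\<lambda>z. form_ratio (\<theta> i j) \<psi> (g z)"] by (auto simp: constant_on_def)
    then show ?thesis by blast
  qed
  then obtain d where d: "\<And>i j z. i \<le> n \<Longrightarrow> j \<le> n \<Longrightarrow> form_ratio (\<theta> i j) \<psi> (g z) = d i j" by metis
  have \<theta>v: "\<theta> i j (v z) = d i j * \<psi> (v z)" if "i \<le> n" "j \<le> n" for i j z
    using d[OF that, of z] \<psi>v[of z] by (simp add: v(2) form_ratio_proj_point[OF \<theta>[OF that] \<psi>(1)] field_simps)
  \<comment> \<open>As the ratio \<open>d j j\<close> is constant and nonzero at 0, the
    \<open>j\<close>-th coordinate vanishes nowhere along the curve, so one chart covers it.\<close>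
  obtain j where j: "j \<le> n" "v 0 j \<noteq> 0" using v(1)[of 0] by (auto elim: nonzero_vecsE)
  have "g z = proj_point (\<lambda>i. if i \<le> n then d i j else 0)" for z
  proof -
    have "d j j \<noteq> 0" using \<theta>v[OF j(1) j(1), of 0] j(2) by (auto simp: \<theta>_def)
    then have "\<theta> j j (v z) \<noteq> 0" using \<theta>v[OF j(1) j(1), of z] \<psi>v[of z] by simp
    then have vj: "v z j ^ (k - 1) \<noteq> 0" by (simp add: \<theta>_def)
    define e where "e = v z j ^ (k - 1) / \<psi> (v z)"
    have e: "e \<noteq> 0" using vj \<psi>v[of z] by (simp add: e_def)
    have "(\<lambda>i. if i \<le> n then d i j else 0) = (\<lambda>i. e * v z i)"
    proof
      fix i show "(if i \<le> n then d i j else 0) = e * v z i"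
      proof (cases "i \<le> n")
        case True
        then show ?thesis using \<theta>v[OF True j(1), of z] \<psi>v[of z] by (simp add: e_def \<theta>_def field_simps)
      next
        case False
        then show ?thesis using v(1)[of z] by (simp add: nonzero_vecs_def)
      qed
    qed
    then show ?thesis using proj_point_scale[OF e, of "v z"] v(2) by simp
  qed
  then show ?thesis by (auto simp: constant_on_def)
qed

text \<open>Dividing the \<open>k\<close>-th powers of the coordinates by \<psi> gives an entire
  lift \<open>y\<close> of the image of the curve under the power map. Its speed is bounded by
  \<open>speed_power_le\<close>, and it dominates all ratios with denominator \<psi>, so
  \<open>unit_dominated_imp_exp_poly\<close> applies to it.\<close>

lemma entire_unit_ratios:
  assumes g: "brody_curve n g" and k: "k > 0"
    and \<psi>: "is_form n k \<psi>" "\<And>z. g z \<notin> zero_locus n \<psi>"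
    and \<phi>: "is_form n k \<phi>" "\<And>z. g z \<notin> zero_locus n \<phi>"
  obtains p where "\<And>z. form_ratio \<phi> \<psi> (g z) = exp (poly p z)"
proof -
  have gh: "proj_hol {..n} UNIV g" and sp: "\<And>z. fspeed {..n} g z \<le> 2"
    using g by (auto simp: brody_curve_def)
  define \<theta> where "\<theta> = (\<lambda>j (w :: nat \<Rightarrow> complex). w j ^ k)"
  have \<theta>: "is_form n k (\<theta> j)" if "j \<le> n" for j
    using is_form_power[OF is_form_coord[OF that], of k] by (simp add: \<theta>_def)
  define y where "y = (\<lambda>z j. if j \<le> n then form_ratio (\<theta> j) \<psi> (g z) else 0)"
  have yhol: "(\<lambda>z. y z j) holomorphic_on UNIV" for j
    using holomorphic_form_ratio[OF gh \<theta> \<psi>] by (cases "j \<le> n") (simp_all add: y_def)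
  have lift: "\<exists>v. v \<in> nonzero_vecs {..n} \<and> g z = proj_point v" for z
    using proj_hol_in_space[OF gh] by (auto simp: proj_space_def)
  have y: "y z j = (1 / \<psi> v) * v j ^ k" if "j \<le> n" "g z = proj_point v" for z v j
    using that by (simp add: y_def form_ratio_proj_point[OF \<theta> \<psi>(1)]) (simp add: \<theta>_def)
  have nsqy: "nsq {..n} (y z) = (cmod (1 / \<psi> v))\<^sup>2 * nsq {..n} (\<lambda>j. v j ^ k)" if "g z = proj_point v" for z v
    unfolding nsq_def sum_distrib_left
    by (intro sum.cong refl) (simp only: atMost_iff y[OF _ that] norm_mult power_mult_distrib)
  have dominated: "\<exists>K>0. \<forall>z. (cmod (form_ratio \<eta> \<psi> (g z)))\<^sup>2 \<le> K * nsq {..n} (y z)" if \<eta>: "is_form n k \<eta>" for \<eta>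
  proof -
    obtain K where K: "K > 0" "\<And>v. (cmod (\<eta> v))\<^sup>2 \<le> K * nsq {..n} (\<lambda>j. v j ^ k)"
      by (rule is_form_bound[OF \<eta>]) blast
    have "(cmod (form_ratio \<eta> \<psi> (g z)))\<^sup>2 \<le> K * nsq {..n} (y z)" for z
    proof -
      obtain v where v: "v \<in> nonzero_vecs {..n}" "g z = proj_point v" using lift by blast
      have "(cmod (1 / \<psi> v))\<^sup>2 * (cmod (\<eta> v))\<^sup>2 \<le> (cmod (1 / \<psi> v))\<^sup>2 * (K * nsq {..n} (\<lambda>j. v j ^ k))"
        by (intro mult_left_mono K(2)) simp
      then show ?thesis
        by (simp add: v(2) nsqy[OF v(2)] form_ratio_proj_point[OF \<eta> \<psi>(1)] norm_divide power_divide mult_ac)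
    qed
    then show ?thesis using K(1) by blast
  qed
  obtain K0 where K0: "K0 > 0" "\<And>z. (cmod (form_ratio \<psi> \<psi> (g z)))\<^sup>2 \<le> K0 * nsq {..n} (y z)"
    using dominated[OF \<psi>(1)] by blast
  \<comment> \<open>The ratio of \<psi> by itself is 1 and is dominated by \<open>y\<close>.\<close>
  have lower: "1 / K0 \<le> nsq {..n} (y z)" for z
  proof -
    obtain v where v: "v \<in> nonzero_vecs {..n}" "g z = proj_point v" using lift by blast
    have "\<psi> v \<noteq> 0" using \<psi>(2)[of z] proj_point_in_zero_locus_iff[OF \<psi>(1) v(1)] v(2) by simp
    then have "form_ratio \<psi> \<psi> (g z) = 1" by (simp add: v(2) form_ratio_proj_point[OF \<psi>(1) \<psi>(1)])
    then show ?thesis using K0(2)[of z] K0(1) by (simp add: field_simps)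
  qed
  obtain K where K: "\<And>z. (cmod (form_ratio \<phi> \<psi> (g z)))\<^sup>2 \<le> K * nsq {..n} (y z)"
    using dominated[OF \<phi>(1)] by blast
  have speed_y: "speed {..n} y z \<le> real k * real (Suc n) * 2" for z
  proof -
    obtain e v where e: "e > 0" "proj_lift {..n} (ball z e) g v" using proj_holE[OF gh] by blast
    have zb: "z \<in> ball z e" using e(1) by simp
    have nz: "\<psi> (v x) \<noteq> 0" if "x \<in> ball z e" for x
      using \<psi>(2)[of x] proj_point_in_zero_locus_iff[OF \<psi>(1) proj_liftD(2)[OF e(2) that]] proj_liftD(3)[OF e(2) that] by simp
    have "speed {..n} y z = speed {..n} (\<lambda>x i. if i \<le> n then v x i ^ k else 0) z"
    proof (rule speed_scale[OF open_ball zb])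
      show "(\<lambda>x. if i \<le> n then v x i ^ k else 0) holomorphic_on ball z e" for i
        by (cases "i \<le> n") (auto intro!: holomorphic_intros proj_liftD(1)[OF e(2)])
      show "(\<lambda>x. 1 / \<psi> (v x)) holomorphic_on ball z e"
        using nz by (intro holomorphic_intros holomorphic_on_is_form[OF \<psi>(1)] proj_liftD(1)[OF e(2)]) auto
      show "y x = (\<lambda>i. 1 / \<psi> (v x) * (if i \<le> n then v x i ^ k else 0))" if "x \<in> ball z e" for x
        using y[OF _ proj_liftD(3)[OF e(2) that]] by (auto simp: fun_eq_iff y_def)
      show "1 / \<psi> (v z) \<noteq> 0" using nz[OF zb] by simp
    qed
    also have "\<dots> = speed {..n} (\<lambda>x i. v x i ^ k) z"
      by (simp add: speed_def wron_def nsq_def)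
    also have "\<dots> \<le> real k * real (Suc n) * speed {..n} v z"
      by (rule speed_power_le[OF e(2) open_ball zb k])
    also have "\<dots> \<le> real k * real (Suc n) * 2"
      using sp[of z] fspeed_eq[OF e(2) open_ball zb] by (intro mult_left_mono) auto
    finally show ?thesis .
  qed
  have unz: "form_ratio \<phi> \<psi> (g z) \<noteq> 0" for z
  proof -
    obtain v where v: "v \<in> nonzero_vecs {..n}" "g z = proj_point v" using lift by blast
    show ?thesis
      using \<psi>(2)[of z] \<phi>(2)[of z] v
      by (simp add: proj_point_in_zero_locus_iff[OF \<psi>(1)] proj_point_in_zero_locus_iff[OF \<phi>(1)]
          form_ratio_proj_point[OF \<phi>(1) \<psi>(1)])
  qed
  show ?thesis
    by (rule unit_dominated_imp_exp_poly[OF yhol finite_atMost _ lower speed_y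
          holomorphic_form_ratio[OF gh \<phi>(1) \<psi>] unz K]) (use K0(1) in simp, rule that)
qed

section \<open>A hyperbolically embedded complement\<close>

text \<open>Partial sums over subsets of \<open>{..n}\<close> are enough: since the total vanishes,
  every nonempty proper subset of \<open>{..Suc n}\<close> or its complement is of this kind.
  Absence of common zeros makes the forms a finite map.\<close>

locale hyperbolic_configuration =
  fixes n k :: nat and \<phi> :: "nat \<Rightarrow> (nat \<Rightarrow> complex) \<Rightarrow> complex"
  assumes k: "k > 0"
    and form: "\<And>i. i \<le> Suc n \<Longrightarrow> is_form n k (\<phi> i)"
    and sum0: "\<And>v. (\<Sum>i\<le>Suc n. \<phi> i v) = 0"
    and partial: "\<And>J. J \<noteq> {} \<Longrightarrow> J \<subseteq> {..n} \<Longrightarrow> brody_hyperbolic_form n (\<lambda>v. \<Sum>i\<in>J. \<phi> i v)"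
    and no_common_zero: "\<And>v. v \<in> nonzero_vecs {..n} \<Longrightarrow> \<exists>i\<le>n. \<phi> i v \<noteq> 0"
begin

lemma no_brody_curve_in_complement:
  assumes g: "brody_curve n g" and av: "\<And>i z. i \<le> Suc n \<Longrightarrow> g z \<notin> zero_locus n (\<phi> i)"
  shows False
proof -
  have gh: "proj_hol {..n} UNIV g" and nc: "\<not> g constant_on UNIV"
    using g by (auto simp: brody_curve_def)
  define u where "u = (\<lambda>i z. form_ratio (\<phi> i) (\<phi> 0) (g z))"
  have f0: "is_form n k (\<phi> 0)" "\<And>z. g z \<notin> zero_locus n (\<phi> 0)" using form[of 0] av[of 0] by auto
  have "\<exists>p. \<forall>z. u i z = exp (poly p z)" if "i \<le> Suc n" for i
    unfolding u_def by (rule entire_unit_ratios[OF g k f0 form[OF that] av[OF that]]) blast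
  then obtain p where p: "\<And>i z. i \<le> Suc n \<Longrightarrow> u i z = exp (poly (p i) z)" by metis
  have "\<exists>v. v \<in> nonzero_vecs {..n} \<and> g z = proj_point v" for z
    using proj_hol_in_space[OF gh] by (auto simp: proj_space_def)
  then obtain v where v: "\<And>z. v z \<in> nonzero_vecs {..n}" "\<And>z. g z = proj_point (v z)" by metis
  have f0v: "\<phi> 0 (v z) \<noteq> 0" for z
    using f0(2)[of z] proj_point_in_zero_locus_iff[OF f0(1) v(1)] v(2) by simp
  have u: "\<phi> i (v z) = u i z * \<phi> 0 (v z)" if "i \<le> Suc n" for i z
    using f0v[of z] by (simp add: u_def v(2) form_ratio_proj_point[OF form[OF that] f0(1)])
  have usum: "(\<Sum>i\<in>J. \<phi> i (v z)) = (\<Sum>i\<in>J. u i z) * \<phi> 0 (v z)" if "J \<subseteq> {..Suc n}" for J z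
    unfolding sum_distrib_right by (intro sum.cong refl u) (use that in auto)
  have "(\<Sum>i\<le>Suc n. exp (poly (p i) z)) = 0" for z
  proof -
    have "(\<Sum>i\<le>Suc n. u i z) * \<phi> 0 (v z) = 0" using usum[of "{..Suc n}" z] sum0 by simp
    then have "(\<Sum>i\<le>Suc n. u i z) = 0" using f0v[of z] by simp
    then show ?thesis using p by simp
  qed
  \<comment> \<open>The class of the ratio \<phi>_0/\<phi>_0 = 1, that is, the indices whose ratio
    is constant along the curve.\<close>
  define J where "J = {i. i \<in> {..Suc n} \<and> degree (p i - p 0) = 0}"
  have J: "J \<subseteq> {..Suc n}" "0 \<in> J" by (auto simp: J_def)
  have "(\<Sum>i\<in>J. exp (poly (p i) z)) = 0" for z
    unfolding J_def by (rule exp_poly_sum_class) (use \<open>\<And>z. (\<Sum>i\<le>Suc n. exp (poly (p i) z)) = 0\<close> in auto)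
  moreover have "(\<Sum>i\<in>J. exp (poly (p i) z)) = (\<Sum>i\<in>J. u i z)" for z
    using J(1) p by (intro sum.cong) auto
  ultimately have J0: "(\<Sum>i\<in>J. \<phi> i (v z)) = 0" for z using usum[OF J(1)] by simp
  have contra: False if J': "J' \<noteq> {}" "J' \<subseteq> {..n}" "\<And>z. (\<Sum>i\<in>J'. \<phi> i (v z)) = 0" for J'
  proof -
    have form': "is_form n k (\<lambda>v. \<Sum>i\<in>J'. \<phi> i v)" using J'(2) by (intro is_form_sum form) auto
    have "range g \<subseteq> zero_locus n (\<lambda>v. \<Sum>i\<in>J'. \<phi> i v)"
      using J'(3) by (auto simp: v(2) proj_point_in_zero_locus_iff[OF form' v(1)])
    then show False using partial[OF J'(1,2)] gh nc by (auto simp: brody_hyperbolic_form_def)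
  qed
  show False
  proof (cases "J = {..Suc n}")
    case True
    have "g constant_on UNIV"
    proof (rule constant_ratios_imp_constant[OF gh k finite_atMost _ _ f0, of n \<phi>])
      show "is_form n k (\<phi> i)" if "i \<in> {..n}" for i using that by (intro form) simp
      show "\<exists>i\<in>{..n}. \<phi> i v \<noteq> 0" if "v \<in> nonzero_vecs {..n}" for v
        using no_common_zero[OF that] by auto
      fix i z assume i: "i \<in> {..n}"
      then have "i \<in> J" by (simp add: True)
      then have "degree (p i - p 0) = 0" unfolding J_def by blast
      then obtain c where c: "p i - p 0 = [:c:]" by (rule degree_eq_zeroE)
      have "u 0 z = 1" using f0v[of z] by (simp add: u_def v(2) form_ratio_proj_point[OF f0(1) f0(1)])
      then have "u i z = exp (poly (p i) z) / exp (poly (p 0) z)" using p[of i z] p[of 0 z] i by simp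
      also have "\<dots> = exp (poly (p i - p 0) z)" by (simp add: exp_diff)
      also have "\<dots> = exp (coeff (p i - p 0) 0)" by (simp add: c)
      finally show "form_ratio (\<phi> i) (\<phi> 0) (g z) = exp (coeff (p i - p 0) 0)" by (simp add: u_def)
    qed
    then show False using nc by simp
  next
    case False
    show False
    \<comment> \<open>If the sum over \<open>J\<close> involves the last form, the complementary sum
      vanishes too and is taken instead; it is nonempty because \<open>J\<close> is proper.\<close>
    proof (cases "Suc n \<in> J")
      case True
      show False
      proof (rule contra[of "{..Suc n} - J"])
        show "{..Suc n} - J \<noteq> {}" using False J by blast
        show "{..Suc n} - J \<subseteq> {..n}" using True by (auto simp: le_Suc_eq)
        show "(\<Sum>i\<in>{..Suc n} - J. \<phi> i (v z)) = 0" for z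
          using J(1) J0[of z] sum0[of "v z"] by (simp add: sum_diff)
      qed
    next
      case F: False
      have "J \<subseteq> {..n}"
      proof
        fix i assume "i \<in> J"
        with J(1) F have "i \<le> Suc n" "i \<noteq> Suc n" by auto
        then show "i \<in> {..n}" by simp
      qed
      then show False using contra[of J] J(2) J0 by blast
    qed
  qed
qed

end

text \<open>The point \<open>a\<close> is returned as well: none of the forms vanishes there, which
  later shows that their product is not the zero form.\<close>

lemma hyperbolic_configuration_exists:
  assumes n: "n > 0" and k: "k > 0" and hF: "hyperbolic_form n k F" and supp: "\<And>\<alpha>. \<alpha> \<notin> monomials n k \<Longrightarrow> F \<alpha> = 0"
  obtains \<phi> a where "hyperbolic_configuration n k \<phi>" "a \<in> nonzero_vecs {..n}" "\<And>i. i \<le> Suc n \<Longrightarrow> \<phi> i a \<noteq> 0"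
proof -
  let ?F = "eval_form n k F"
  have fF: "is_form n k ?F" by (rule is_form_eval[OF supp])
  obtain e where e: "e > 0" "\<And>G. near_form n k e F G \<Longrightarrow> hyperbolic_form n k G"
    by (rule hyperbolic_form_near[OF hF]) blast
  obtain a where a: "a \<in> nonzero_vecs {..n}" "?F a \<noteq> 0"
    by (rule brody_hyperbolic_form_nonzero[OF n fF]) (use hF hyperbolic_form_eval in blast)+
  obtain i0 where i0: "i0 \<le> n" "a i0 \<noteq> 0" using a(1) by (auto elim: nonzero_vecsE)
  \<comment> \<open>The minors of \<open>v\<close> against \<open>a\<close> in the columns
    \<open>i\<close> and \<open>i0\<close>. They vanish together exactly on the line through
    \<open>a\<close>, and \<open>L i0\<close> is identically zero.\<close>
  define L where "L = (\<lambda>i v. a i0 * v i + (- a i) * v i0)"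
  have Lk: "is_form n k (\<lambda>v. L i v ^ k)" if "i \<le> n" for i
  proof -
    have "is_form n 1 (L i)"
      unfolding L_def by (intro is_form_add is_form_cmult is_form_coord that i0(1))
    then show ?thesis using is_form_power[of n 1 "L i" k] by simp
  qed
  have "\<exists>E. (\<forall>\<alpha>. \<alpha> \<notin> monomials n k \<longrightarrow> E \<alpha> = 0) \<and> (\<forall>v. eval_form n k E v = L i v ^ k)" if "i \<le> n" for i
    using Lk[OF that] by (simp add: is_form_def)
  then obtain E where E: "\<And>i \<alpha>. i \<le> n \<Longrightarrow> \<alpha> \<notin> monomials n k \<Longrightarrow> E i \<alpha> = 0"
    "\<And>i v. i \<le> n \<Longrightarrow> eval_form n k (E i) v = L i v ^ k" by metis
  \<comment> \<open>\<open>S\<close> bounds every coefficient of every partial sum of the powers, so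
    \<epsilon> is small enough for all \<open>J\<close> at once; \<open>S + 1\<close> avoids a
    division by zero.\<close>
  define S where "S = (\<Sum>i\<le>n. \<Sum>\<alpha>\<in>monomials n k. cmod (E i \<alpha>))"
  have S: "S \<ge> 0" unfolding S_def by (intro sum_nonneg) auto
  define \<epsilon> where "\<epsilon> = e / (S + 1)"
  have \<epsilon>: "\<epsilon> > 0" using e(1) S by (simp add: \<epsilon>_def)
  have \<epsilon>S: "\<epsilon> * S < e" using e(1) S by (simp add: \<epsilon>_def field_simps)
  define \<phi> where "\<phi> = (\<lambda>i v. if i \<le> n then ?F v + of_real \<epsilon> * L i v ^ k else - (\<Sum>j\<le>n. ?F v + of_real \<epsilon> * L j v ^ k))"
  have \<phi>n: "\<phi> i v = ?F v + of_real \<epsilon> * L i v ^ k" if "i \<le> n" for i v using that by (simp add: \<phi>_def)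
  have \<phi>S: "\<phi> (Suc n) v = - (\<Sum>j\<le>n. \<phi> j v)" for v by (simp add: \<phi>_def)
  have hyp: "brody_hyperbolic_form n (\<lambda>v. \<Sum>i\<in>J. \<phi> i v)" if J: "J \<noteq> {}" "J \<subseteq> {..n}" for J
  proof -
    have fin: "finite J" using J(2) finite_subset by blast
    define c where "c = real (card J)"
    have c: "c \<ge> 1" using J(1) fin by (simp add: c_def Suc_le_eq card_gt_0_iff)
    \<comment> \<open>The partial sum over \<open>J\<close> divided by the number of its terms:
      \<open>f\<close> plus a correction of size at most \<open>\<epsilon> * S\<close>.\<close>
    define G where "G = (\<lambda>\<alpha>. F \<alpha> + of_real (\<epsilon> / c) * (\<Sum>i\<in>J. E i \<alpha>))"
    have "near_form n k e F G"
      unfolding near_form_def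
    proof
      fix \<alpha> assume \<alpha>: "\<alpha> \<in> monomials n k"
      have "cmod (\<Sum>i\<in>J. E i \<alpha>) \<le> (\<Sum>i\<in>J. cmod (E i \<alpha>))" by (rule norm_sum)
      also have "\<dots> \<le> (\<Sum>i\<le>n. cmod (E i \<alpha>))" using J(2) by (intro sum_mono2) auto
      also have "\<dots> \<le> S" unfolding S_def
        using \<alpha> by (intro sum_mono member_le_sum[where f = "\<lambda>\<alpha>. cmod (E _ \<alpha>)"]) (auto simp: finite_monomials)
      finally have "cmod (\<Sum>i\<in>J. E i \<alpha>) \<le> S" .
      then have "(\<epsilon> / c) * cmod (\<Sum>i\<in>J. E i \<alpha>) \<le> \<epsilon> * S"
        using \<epsilon> c by (intro mult_mono) (auto simp: divide_le_eq mult_le_cancel_left1)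
      then show "cmod (G \<alpha> - F \<alpha>) < e" using \<epsilon> c \<epsilon>S by (simp add: G_def norm_mult norm_divide)
    qed
    then have hG: "brody_hyperbolic_form n (eval_form n k G)" using e(2) hyperbolic_form_eval by blast
    have "(\<Sum>i\<in>J. \<phi> i v) = of_real c * eval_form n k G v" for v
    proof -
      have "eval_form n k G v = ?F v + of_real (\<epsilon> / c) * (\<Sum>i\<in>J. L i v ^ k)"
        unfolding G_def eval_form_add eval_form_cmult eval_form_sum
        using J(2) E(2) by (auto intro!: sum.cong)
      then have "of_real c * eval_form n k G v = of_real c * ?F v + of_real \<epsilon> * (\<Sum>i\<in>J. L i v ^ k)"
        using c by (simp add: distrib_left)
      also have "\<dots> = (\<Sum>i\<in>J. ?F v + of_real \<epsilon> * L i v ^ k)"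
        by (simp add: sum.distrib sum_distrib_left c_def)
      also have "\<dots> = (\<Sum>i\<in>J. \<phi> i v)" using J(2) by (intro sum.cong) (auto simp: \<phi>n)
      finally show ?thesis by simp
    qed
    then have "zero_locus n (\<lambda>v. \<Sum>i\<in>J. \<phi> i v) = zero_locus n (eval_form n k G)"
      using zero_locus_cmult[of "of_real c" n "eval_form n k G"] c by simp
    then show ?thesis using hG by (simp add: brody_hyperbolic_form_def)
  qed
  have formn: "is_form n k (\<phi> i)" if "i \<le> n" for i
  proof -
    have "\<phi> i = (\<lambda>v. ?F v + of_real \<epsilon> * L i v ^ k)" using that by (simp add: \<phi>_def)
    then show ?thesis using is_form_add[OF fF is_form_cmult[OF Lk[OF that], of "of_real \<epsilon>"]] by simp
  qed
  have form: "is_form n k (\<phi> i)" if "i \<le> Suc n" for i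
  proof (cases "i \<le> n")
    case False
    with that have "i = Suc n" by simp
    moreover have "is_form n k (\<lambda>v. (- 1) * (\<Sum>j\<le>n. \<phi> j v))"
      by (intro is_form_cmult is_form_sum formn) auto
    ultimately show ?thesis by (simp add: \<phi>S[abs_def])
  qed (rule formn)
  have La: "L i a = 0" for i by (simp add: L_def)
  have ncz: "\<exists>i\<le>n. \<phi> i v \<noteq> 0" if v: "v \<in> nonzero_vecs {..n}" for v
  proof (rule ccontr)
    assume "\<not> ?thesis"
    then have z: "\<phi> i v = 0" if "i \<le> n" for i using that by blast
    \<comment> \<open>Hence \<open>\<phi> i0\<close> is the unperturbed form, so it vanishes at
      \<open>v\<close>; the other equations then reduce to \<open>L i v = 0\<close>, and
      \<open>v\<close> is a multiple of \<open>a\<close>.\<close>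
    have "L i0 v = 0" by (simp add: L_def)
    then have F0: "?F v = 0" using z[OF i0(1)] by (simp add: \<phi>n i0(1) zero_power[OF k])
    have "L i v = 0" if "i \<le> n" for i using z[OF that] \<epsilon> by (simp add: \<phi>n[OF that] F0)
    then have "v i = (v i0 / a i0) * a i" if "i \<le> n" for i
      using that i0(2) by (simp add: L_def field_simps)
    moreover have "v i = (v i0 / a i0) * a i" if "\<not> i \<le> n" for i
      using that v a(1) by (simp add: nonzero_vecs_def)
    ultimately have veq: "v = (\<lambda>i. (v i0 / a i0) * a i)" by blast
    have "v i0 \<noteq> 0"
    proof
      assume "v i0 = 0"
      then have "v = (\<lambda>i. 0)" using veq by simp
      then show False using v by (simp add: nonzero_vecs_def)
    qed
    then have "?F (\<lambda>i. (v i0 / a i0) * a i) \<noteq> 0"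
      unfolding eval_form_scale_vec using a(2) i0(2) by simp
    then show False using F0 veq by metis
  qed
  have "hyperbolic_configuration n k \<phi>"
    by unfold_locales (use k form hyp ncz in \<open>auto simp: \<phi>S\<close>)
  moreover have "\<phi> i a \<noteq> 0" if "i \<le> Suc n" for i
  proof (cases "i \<le> n")
    case True
    then show ?thesis using a(2) by (simp add: \<phi>n La zero_power[OF k])
  next
    case False
    with that have "i = Suc n" by simp
    \<comment> \<open>All perturbations vanish at \<open>a\<close>, so each of the first
      \<open>n + 1\<close> forms takes the value of the original form there.\<close>
    moreover have "(\<Sum>j\<le>n. \<phi> j a) = of_nat (Suc n) * ?F a" by (simp add: \<phi>n La zero_power[OF k])
    ultimately show ?thesis using a(2) by (simp add: \<phi>S del: of_nat_Suc)
  qed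
  ultimately show ?thesis by (rule that[OF _ a(1)])
qed

context hyperbolic_configuration
begin

lemma brody_hyperbolic_form_member:
  assumes "i \<le> Suc n"
  shows "brody_hyperbolic_form n (\<phi> i)"
proof (cases "i \<le> n")
  case True
  then show ?thesis using partial[of "{i}"] by simp
next
  case False
  with assms have i: "i = Suc n" by simp
  have "\<phi> (Suc n) v = (- 1) * (\<Sum>j\<le>n. \<phi> j v)" for v
    using sum0[of v] by (simp add: add_eq_0_iff)
  then have "zero_locus n (\<phi> i) = zero_locus n (\<lambda>v. \<Sum>j\<le>n. \<phi> j v)"
    using zero_locus_cmult[of "- 1" n "\<lambda>v. \<Sum>j\<le>n. \<phi> j v"] by (simp add: i zero_locus_def)
  then show ?thesis using partial[of "{..n}"] by (simp add: brody_hyperbolic_form_def)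
qed

text \<open>A curve inside the product hypersurface is constant because each factor is hyperbolic; a
  Brody curve avoiding the product avoids every factor, which
  \<open>no_brody_curve_in_complement\<close> excludes.\<close>

lemma HE_Int_H_nonempty:
  assumes m: "m \<ge> n + 2" and a: "a \<in> nonzero_vecs {..n}" "\<And>i. i \<le> Suc n \<Longrightarrow> \<phi> i a \<noteq> 0"
  shows "HE n (k * m) \<inter> H n (k * m) \<noteq> {}"
proof -
  \<comment> \<open>The first \<open>n + 2\<close> factors run through all forms of the
    configuration, which is where \<open>m \<ge> n + 2\<close> enters; further copies of
    \<open>\<phi> 0\<close> fill up the degree to \<open>k * m\<close>.\<close>
  define s where "s = (\<lambda>i. if i \<le> Suc n then i else 0)"
  have s: "s i \<le> Suc n" for i by (simp add: s_def)
  have "is_form n (k * m) (\<lambda>v. \<Prod>i<m. \<phi> (s i) v)"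
    by (rule is_form_prod) (rule form[OF s])
  then obtain P where P: "\<And>\<alpha>. \<alpha> \<notin> monomials n (k * m) \<Longrightarrow> P \<alpha> = 0"
    "(\<lambda>v. \<Prod>i<m. \<phi> (s i) v) = eval_form n (k * m) P"
    by (rule is_formE) blast
  have evP: "eval_form n (k * m) P v = (\<Prod>i<m. \<phi> (s i) v)" for v using fun_cong[OF P(2)] by simp
  have "P \<noteq> (\<lambda>_. 0)"
  proof
    assume "P = (\<lambda>_. 0)"
    then have "eval_form n (k * m) P a = 0" by (simp add: eval_form_def)
    then show False using a(2)[OF s] by (simp add: evP)
  qed
  then have Pnz: "P \<in> nonzero_vecs (monomials n (k * m))" using P(1) by (auto simp: nonzero_vecs_def)
  have hypP: "hyperbolic_form n (k * m) P"
    unfolding hyperbolic_form_eval P(2)[symmetric]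
    by (rule brody_hyperbolic_form_prod[where d = k]) (auto intro: form brody_hyperbolic_form_member s)
  have "\<not> in_or_avoids n (k * m) P UNIV g" if g: "brody_curve n g" for g
  proof
    assume "in_or_avoids n (k * m) P UNIV g"
    then consider "range g \<subseteq> hypersurface n (k * m) (proj_point P)"
      | "range g \<inter> hypersurface n (k * m) (proj_point P) = {}" by (auto simp: in_or_avoids_def)
    then show False
    proof cases
      case 1
      then show False using hypP g by (auto simp: hyperbolic_form_def brody_curve_def)
    next
      case 2
      have "g z \<notin> zero_locus n (\<phi> i)" if i: "i \<le> Suc n" for i z
      proof
        assume gz: "g z \<in> zero_locus n (\<phi> i)"
        then obtain w where w: "w \<in> nonzero_vecs {..n}" "g z = proj_point w"
          by (auto simp: zero_locus_def proj_space_def)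
        then have "\<phi> i w = 0" using gz proj_point_in_zero_locus_iff[OF form[OF i]] by simp
        moreover have "i < m" "s i = i" using i m by (auto simp: s_def)
        ultimately have "eval_form n (k * m) P w = 0" by (auto simp: evP intro!: bexI[of _ i])
        then have "g z \<in> hypersurface n (k * m) (proj_point P)"
          by (simp add: w proj_point_in_hypersurface_iff)
        then show False using 2 by blast
      qed
      then show False using no_brody_curve_in_complement[OF g] by blast
    qed
  qed
  then obtain e C where "e > 0" "\<And>G. near_form n (k * m) e P G \<Longrightarrow> discs_bounded n (k * m) G C"
    by (rule discs_bounded_near) blast+
  then have "proj_point P \<in> HE n (k * m) \<inter> H n (k * m)"
    using HE_Int_H_iff[OF Pnz] by blast
  then show ?thesis by blast
qed

end

theorem theorem24:
  fixes n k \<delta> :: nat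
  assumes "n > 0" and "k > 0"
    and "H n k \<noteq> {}"
    and "\<delta> \<ge> (n + 2) * k" and "k dvd \<delta>"
  shows "HE n \<delta> \<inter> H n \<delta> \<noteq> {} \<and>
         openin (proj_topology (monomials n \<delta>)) (HE n \<delta> \<inter> H n \<delta>)"
proof
  obtain m where m: "\<delta> = k * m" using assms(5) by blast
  have "k * (n + 2) \<le> k * m" using assms(4) by (simp add: m mult.commute)
  then have mn: "m \<ge> n + 2" using assms(2) by (simp only: mult_le_cancel1)
  obtain F where F: "F \<in> nonzero_vecs (monomials n k)" "proj_point F \<in> H n k"
    using assms(3) by (auto simp: H_def hypersurface_space_def proj_space_def)
  have hF: "hyperbolic_form n k F" using F(2) by (simp add: H_def hyperbolic_form_iff)
  have supp: "F \<alpha> = 0" if "\<alpha> \<notin> monomials n k" for \<alpha> using that F(1) by (simp add: nonzero_vecs_def)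
  obtain \<phi> a where "hyperbolic_configuration n k \<phi>" "a \<in> nonzero_vecs {..n}"
    "\<And>i. i \<le> Suc n \<Longrightarrow> \<phi> i a \<noteq> 0"
    using hyperbolic_configuration_exists[OF assms(1,2) hF supp] by metis
  then show "HE n \<delta> \<inter> H n \<delta> \<noteq> {}"
    unfolding m by (rule hyperbolic_configuration.HE_Int_H_nonempty[OF _ mn])
qed (rule openin_HE_Int_H)

end
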